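(* Let $h$ be a positive integer such that $h \equiv 3 \bmod 8$ and such that $h$, $h-2$, $h-6$ and $h-8$ are all prime numbers. Then the plane cubic over $\mathbb{Q}$ given by the affine equation in the variables $w,z$ $$3w^2z+2z^3+w^3+6wz^2+2(h-2)^2(h-8)=12z^2-6w^2$$ has a point over every completion of $\mathbb{Q}$ (that is, over $\mathbb{R}$ and over $\mathbb{Q}_p$ for every prime $p$), but has no point over $\mathbb{Q}$.
   Context: The plane cubic means the projective plane curve that is the closure in $\mathbb{P}^2$ of the displayed affine curve. *)

theory Defs
  imports "HOL-Algebra.Algebraic_Closure_Type" "HOL-Computational_Algebra.Computational_Algebra"
    "HOL-Number_Theory.Cong"
begin

section \<open>Completions of the rationals\<close>

locale rat_abs_value =
  fixes v :: "rat \<Rightarrow> real"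
  assumes nonneg: "v x \<ge> 0"
    and zero_iff: "v x = 0 \<longleftrightarrow> x = 0"
    and mult: "v (x * y) = v x * v y"
    and triangle: "v (x + y) \<le> v x + v y"

definition cauchy_seqs :: "(rat \<Rightarrow> real) \<Rightarrow> (nat \<Rightarrow> rat) set" where
  "cauchy_seqs v = {s. \<forall>e>0. \<exists>N. \<forall>m\<ge>N. \<forall>n\<ge>N. v (s m - s n) < e}"

definition null_seqs :: "(rat \<Rightarrow> real) \<Rightarrow> (nat \<Rightarrow> rat) set" where
  "null_seqs v = {s. (\<lambda>n. v (s n)) \<longlonglongrightarrow> 0}"

definition cauchy_ring :: "(rat \<Rightarrow> real) \<Rightarrow> (nat \<Rightarrow> rat) ring" where
  "cauchy_ring v =
     \<lparr>carrier = cauchy_seqs v, monoid.mult = (\<lambda>s t n. s n * t n), one = (\<lambda>n. 1),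
      zero = (\<lambda>n. 0), add = (\<lambda>s t n. s n + t n)\<rparr>"

definition completion :: "(rat \<Rightarrow> real) \<Rightarrow> (nat \<Rightarrow> rat) set ring" where
  "completion v = cauchy_ring v Quot null_seqs v"

definition completion_emb :: "(rat \<Rightarrow> real) \<Rightarrow> rat \<Rightarrow> (nat \<Rightarrow> rat) set" where
  "completion_emb v q = null_seqs v +>\<^bsub>cauchy_ring v\<^esub> (\<lambda>n. q)"

definition padic_abs :: "nat \<Rightarrow> rat \<Rightarrow> real" where
  "padic_abs p x = (if x = 0 then 0 else
     real p powi (int (multiplicity (int p) (snd (quotient_of x)))
                - int (multiplicity (int p) (fst (quotient_of x)))))"

abbreviation padic_field :: "nat \<Rightarrow> (nat \<Rightarrow> rat) set ring" where
  "padic_field p \<equiv> completion (padic_abs p)"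

abbreviation padic_emb :: "nat \<Rightarrow> rat \<Rightarrow> (nat \<Rightarrow> rat) set" where
  "padic_emb p \<equiv> completion_emb (padic_abs p)"

context rat_abs_value
begin

lemma v0 [simp]: "v 0 = 0"
  using zero_iff by simp

lemma v1 [simp]: "v 1 = 1"
  using mult[of 1 1] zero_iff[of 1] by simp

lemma v_minus [simp]: "v (- x) = v x"
proof -
  have "v (-1) * v (-1) = 1" using mult[of "-1" "-1"] by simp
  hence "v (-1) = 1" using nonneg[of "-1"]
    by (metis abs_of_nonneg mult_cancel_left2 power2_eq_square real_sqrt_abs real_sqrt_one)
  thus ?thesis using mult[of "-1" x] by simp
qed

lemma v_diff: "v (x - y) \<le> v x + v y"
  using triangle[of x "-y"] by simp

lemma v_diff_commute: "v (x - y) = v (y - x)"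
  using v_minus[of "x - y"] by simp

lemma v_inverse: "v (inverse x) = inverse (v x)"
  by (cases "x = 0") (use mult[of x "inverse x"] zero_iff[of x] in \<open>auto simp: field_simps\<close>)

lemma const_cauchy: "(\<lambda>n. q) \<in> cauchy_seqs v"
  by (simp add: cauchy_seqs_def)

lemma cauchy_bounded:
  assumes "s \<in> cauchy_seqs v"
  shows "\<exists>B>0. \<forall>n. v (s n) \<le> B"
proof -
  obtain N where N: "\<And>m n. m \<ge> N \<Longrightarrow> n \<ge> N \<Longrightarrow> v (s m - s n) < 1"
    using assms unfolding cauchy_seqs_def mem_Collect_eq by (metis zero_less_one)
  define B where "B = Max ((\<lambda>n. v (s n)) ` {..N}) + 1"
  have 1: "v (s n) \<le> B - 1" if "n \<le> N" for n
    unfolding B_def using that by (auto intro!: Max_ge)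
  have "v (s n) \<le> B" for n
  proof (cases "n \<le> N")
    case False
    have "v (s n) \<le> v (s n - s N) + v (s N)" using triangle[of "s n - s N" "s N"] by simp
    thus ?thesis using 1[of N] N[of n N] False by simp
  qed (use 1[of n] in simp)
  moreover have "B > 0" using 1[of N] nonneg[of "s N"] by simp
  ultimately show ?thesis by blast
qed

lemma cauchy_add:
  assumes "s \<in> cauchy_seqs v" "t \<in> cauchy_seqs v"
  shows "(\<lambda>n. s n + t n) \<in> cauchy_seqs v"
  unfolding cauchy_seqs_def
proof (clarsimp)
  fix e :: real assume "e > 0"
  then obtain M N where
    M: "\<And>m n. m \<ge> M \<Longrightarrow> n \<ge> M \<Longrightarrow> v (s m - s n) < e/2" and
    N: "\<And>m n. m \<ge> N \<Longrightarrow> n \<ge> N \<Longrightarrow> v (t m - t n) < e/2"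
    using assms unfolding cauchy_seqs_def mem_Collect_eq by (metis half_gt_zero)
  have "v (s m + t m - (s n + t n)) < e" if "m \<ge> max M N" "n \<ge> max M N" for m n
    using triangle[of "s m - s n" "t m - t n"] M[of m n] N[of m n] that
    by (simp add: algebra_simps)
  thus "\<exists>N. \<forall>m\<ge>N. \<forall>n\<ge>N. v (s m + t m - (s n + t n)) < e" by blast
qed

lemma cauchy_mult:
  assumes "s \<in> cauchy_seqs v" "t \<in> cauchy_seqs v"
  shows "(\<lambda>n. s n * t n) \<in> cauchy_seqs v"
  unfolding cauchy_seqs_def
proof (clarsimp)
  fix e :: real assume e: "e > 0"
  obtain B C where B: "B > 0" "\<And>n. v (s n) \<le> B" and C: "C > 0" "\<And>n. v (t n) \<le> C"
    using assms cauchy_bounded by metis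
  have "e / (2*C) > 0" "e / (2*B) > 0" using e B C by auto
  then obtain M N where
    M: "\<And>m n. m \<ge> M \<Longrightarrow> n \<ge> M \<Longrightarrow> v (s m - s n) < e / (2*C)" and
    N: "\<And>m n. m \<ge> N \<Longrightarrow> n \<ge> N \<Longrightarrow> v (t m - t n) < e / (2*B)"
    using assms unfolding cauchy_seqs_def mem_Collect_eq by metis
  have "v (s m * t m - s n * t n) < e" if "m \<ge> max M N" "n \<ge> max M N" for m n
  proof -
    have "s m * t m - s n * t n = s m * (t m - t n) + (s m - s n) * t n"
      by (simp add: algebra_simps)
    hence "v (s m * t m - s n * t n) \<le> v (s m) * v (t m - t n) + v (s m - s n) * v (t n)"
      using triangle mult by metis
    also have "\<dots> \<le> B * v (t m - t n) + v (s m - s n) * C"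
      using B C nonneg by (intro add_mono mult_mono) (auto simp: less_imp_le)
    also have "\<dots> < B * (e / (2*B)) + e / (2*C) * C"
      using B C M[of m n] N[of m n] that
      by (intro add_strict_mono mult_strict_left_mono mult_strict_right_mono) auto
    also have "\<dots> = e" using B C by simp
    finally show ?thesis .
  qed
  thus "\<exists>N. \<forall>m\<ge>N. \<forall>n\<ge>N. v (s m * t m - s n * t n) < e" by blast
qed

lemma cauchy_uminus: "s \<in> cauchy_seqs v \<Longrightarrow> (\<lambda>n. - s n) \<in> cauchy_seqs v"
  using cauchy_mult[OF const_cauchy[of "-1"]] by simp

lemma null_imp_cauchy: "s \<in> null_seqs v \<Longrightarrow> s \<in> cauchy_seqs v"
  unfolding cauchy_seqs_def
proof (clarsimp)
  fix e :: real assume s: "s \<in> null_seqs v" and "e > 0"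
  then obtain N where N: "\<And>n. n \<ge> N \<Longrightarrow> v (s n) < e/2"
    unfolding null_seqs_def using LIMSEQ_D[of "\<lambda>n. v (s n)" 0 "e/2"] nonneg by auto
  have "v (s m - s n) < e" if "m \<ge> N" "n \<ge> N" for m n
    using v_diff[of "s m" "s n"] N[of m] N[of n] that by simp
  thus "\<exists>N. \<forall>m\<ge>N. \<forall>n\<ge>N. v (s m - s n) < e" by blast
qed

lemma null_add:
  assumes "s \<in> null_seqs v" "t \<in> null_seqs v"
  shows "(\<lambda>n. s n + t n) \<in> null_seqs v"
proof -
  have "(\<lambda>n. v (s n) + v (t n)) \<longlonglongrightarrow> 0"
    using assms unfolding null_seqs_def by (auto intro: tendsto_add_zero)
  thus ?thesis unfolding null_seqs_def
    by (auto intro!: tendsto_sandwich[of "\<lambda>_. 0" "\<lambda>n. v (s n + t n)" _ "\<lambda>n. v (s n) + v (t n)"]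
             simp: nonneg triangle)
qed

lemma null_mult:
  assumes "s \<in> null_seqs v" "t \<in> cauchy_seqs v"
  shows "(\<lambda>n. t n * s n) \<in> null_seqs v"
proof -
  obtain B where B: "B > 0" "\<And>n. v (t n) \<le> B" using cauchy_bounded assms by metis
  have "(\<lambda>n. B * v (s n)) \<longlonglongrightarrow> 0"
    using assms unfolding null_seqs_def by (auto intro: tendsto_mult_right_zero)
  moreover have "v (t n * s n) \<le> B * v (s n)" for n
    unfolding mult by (intro mult_right_mono B nonneg)
  ultimately have "(\<lambda>n. v (t n * s n)) \<longlonglongrightarrow> 0"
    by (intro tendsto_sandwich[of "\<lambda>_. 0" "\<lambda>n. v (t n * s n)" _ "\<lambda>n. B * v (s n)"])
       (auto simp: nonneg)
  thus ?thesis by (simp add: null_seqs_def)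
qed

lemma cauchy_ring_cring: "cring (cauchy_ring v)"
proof (intro cringI abelian_groupI comm_monoidI)
  fix x assume "x \<in> carrier (cauchy_ring v)"
  thus "\<exists>y\<in>carrier (cauchy_ring v). y \<oplus>\<^bsub>cauchy_ring v\<^esub> x = \<zero>\<^bsub>cauchy_ring v\<^esub>"
    by (intro bexI[of _ "\<lambda>n. - x n"]) (auto simp: cauchy_ring_def cauchy_uminus)
qed (auto simp: cauchy_ring_def cauchy_add cauchy_mult const_cauchy algebra_simps)

lemma cauchy_ring_uminus:
  assumes "s \<in> cauchy_seqs v"
  shows "\<ominus>\<^bsub>cauchy_ring v\<^esub> s = (\<lambda>n. - s n)"
proof -
  interpret cring "cauchy_ring v" by (rule cauchy_ring_cring)
  show ?thesis
    by (rule sym, rule sum_zero_eq_neg) (use assms in \<open>auto simp: cauchy_ring_def cauchy_uminus\<close>)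
qed

lemma null_seqs_ideal: "ideal (null_seqs v) (cauchy_ring v)"
proof -
  interpret C: cring "cauchy_ring v" by (rule cauchy_ring_cring)
  have inv: "inv\<^bsub>add_monoid (cauchy_ring v)\<^esub> s = (\<lambda>n. - s n)" if "s \<in> null_seqs v" for s
    using cauchy_ring_uminus[OF null_imp_cauchy[OF that]] by (simp add: a_inv_def)
  show ?thesis
  proof (intro idealI C.ring_axioms)
    show "subgroup (null_seqs v) (add_monoid (cauchy_ring v))"
    proof (rule group.subgroupI)
      show "group (add_monoid (cauchy_ring v))" by (rule C.add.group_axioms)
      have "(\<lambda>n. 0) \<in> null_seqs v" by (simp add: null_seqs_def)
      thus "null_seqs v \<noteq> {}" by blast
      show "inv\<^bsub>add_monoid (cauchy_ring v)\<^esub> s \<in> null_seqs v" if "s \<in> null_seqs v" for s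
        using that unfolding inv[OF that] by (simp add: null_seqs_def)
    qed (auto simp: cauchy_ring_def null_imp_cauchy null_add)
  qed (use null_mult in \<open>auto simp: cauchy_ring_def mult.commute\<close>)
qed

lemma completion_cring: "cring (completion v)"
  unfolding completion_def
  by (rule ideal.quotient_is_cring[OF null_seqs_ideal cauchy_ring_cring])

lemma coset_hom:
  "(\<lambda>s. null_seqs v +>\<^bsub>cauchy_ring v\<^esub> s) \<in> ring_hom (cauchy_ring v) (completion v)"
  unfolding completion_def by (rule ideal.rcos_ring_hom[OF null_seqs_ideal])

lemma carrier_completion:
  "carrier (completion v) = (\<lambda>s. null_seqs v +>\<^bsub>cauchy_ring v\<^esub> s) ` cauchy_seqs v"
  unfolding completion_def FactRing_def A_RCOSETS_def RCOSETS_def a_r_coset_def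
  by (auto simp: cauchy_ring_def)

lemma coset_eq_zero_iff:
  assumes "s \<in> cauchy_seqs v"
  shows "null_seqs v +>\<^bsub>cauchy_ring v\<^esub> s = \<zero>\<^bsub>completion v\<^esub> \<longleftrightarrow> s \<in> null_seqs v"
proof -
  interpret I: ideal "null_seqs v" "cauchy_ring v" by (rule null_seqs_ideal)
  have s: "s \<in> carrier (cauchy_ring v)" using assms by (simp add: cauchy_ring_def)
  show ?thesis
    using I.a_rcos_const I.a_rcos_self[OF s]
    by (auto simp: completion_def FactRing_def)
qed

lemma completion_emb_hom: "completion_emb v \<in> ring_hom (ring_of_type_algebra :: rat ring) (completion v)"
proof -
  have "(\<lambda>q n. q) \<in> ring_hom (ring_of_type_algebra :: rat ring) (cauchy_ring v)"
    by (intro ring_hom_memI) (auto simp: ring_of_type_algebra_def cauchy_ring_def const_cauchy)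
  from ring_hom_trans[OF this coset_hom] show ?thesis
    by (simp add: completion_emb_def[abs_def] comp_def)
qed

lemma nonnull_bounded_away:
  assumes s: "s \<in> cauchy_seqs v" "s \<notin> null_seqs v"
  shows "\<exists>d>0. \<exists>N. \<forall>n\<ge>N. v (s n) \<ge> d"
proof -
  obtain e where e: "e > 0" "\<And>N. \<exists>n\<ge>N. v (s n) \<ge> e"
    using s(2) unfolding null_seqs_def LIMSEQ_iff by (force simp: not_less nonneg)
  then obtain N where N: "\<And>m n. m \<ge> N \<Longrightarrow> n \<ge> N \<Longrightarrow> v (s m - s n) < e/2"
    using s(1) unfolding cauchy_seqs_def mem_Collect_eq by (metis half_gt_zero)
  obtain m where m: "m \<ge> N" "v (s m) \<ge> e" using e(2) by blast
  have "v (s n) \<ge> e/2" if "n \<ge> N" for n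
    using triangle[of "s m - s n" "s n"] N[of m n] m that by simp
  thus ?thesis using e(1) by (intro exI[of _ "e/2"]) auto
qed

lemma cauchy_inverse:
  assumes s: "s \<in> cauchy_seqs v" "s \<notin> null_seqs v"
  shows "(\<lambda>n. inverse (s n)) \<in> cauchy_seqs v"
  unfolding cauchy_seqs_def
proof (clarsimp)
  fix e :: real assume e: "e > 0"
  obtain d M where d: "d > 0" and M: "\<And>n. n \<ge> M \<Longrightarrow> v (s n) \<ge> d"
    using nonnull_bounded_away[OF s] by blast
  have "e * d * d > 0" using e d by simp
  then obtain N where N: "\<And>m n. m \<ge> N \<Longrightarrow> n \<ge> N \<Longrightarrow> v (s m - s n) < e * d * d"
    using s(1) unfolding cauchy_seqs_def mem_Collect_eq by metis
  have "v (inverse (s m) - inverse (s n)) < e" if "m \<ge> max M N" "n \<ge> max M N" for m n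
  proof -
    have ge: "v (s m) \<ge> d" "v (s n) \<ge> d" using M that by auto
    hence nz: "s m \<noteq> 0" "s n \<noteq> 0" using d by auto
    have "inverse (s m) - inverse (s n) = (s n - s m) * inverse (s m * s n)"
      using nz by (simp add: field_simps)
    hence "v (inverse (s m) - inverse (s n)) = v (s n - s m) / (v (s m) * v (s n))"
      by (simp add: mult v_inverse divide_inverse)
    also have "\<dots> \<le> v (s n - s m) / (d * d)"
      using ge d nonneg by (intro divide_left_mono mult_mono mult_pos_pos) auto
    also have "\<dots> < e"
      using N[of n m] that d by (simp add: field_simps)
    finally show ?thesis .
  qed
  thus "\<exists>N. \<forall>m\<ge>N. \<forall>n\<ge>N. v (inverse (s m) - inverse (s n)) < e" by blast
qed

theorem completion_field: "field (completion v)"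
proof -
  interpret C: cring "completion v" by (rule completion_cring)
  let ?c = "\<lambda>s. null_seqs v +>\<^bsub>cauchy_ring v\<^esub> s"
  have one: "\<one>\<^bsub>completion v\<^esub> = ?c (\<lambda>n. 1)"
    using ring_hom_one[OF coset_hom] by (simp add: cauchy_ring_def)
  show ?thesis
  proof (rule C.cring_fieldI2)
    have "(\<lambda>n. 1) \<notin> null_seqs v" by (simp add: null_seqs_def LIMSEQ_const_iff)
    thus "\<zero>\<^bsub>completion v\<^esub> \<noteq> \<one>\<^bsub>completion v\<^esub>"
      using coset_eq_zero_iff[OF const_cauchy] one by metis
  next
    fix a assume "a \<in> carrier (completion v)" and a0: "a \<noteq> \<zero>\<^bsub>completion v\<^esub>"
    then obtain s where s: "s \<in> cauchy_seqs v" "a = ?c s"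
      by (auto simp: carrier_completion)
    hence nn: "s \<notin> null_seqs v" using a0 coset_eq_zero_iff by blast
    define t where "t = (\<lambda>n. inverse (s n))"
    have t: "t \<in> cauchy_seqs v" unfolding t_def by (rule cauchy_inverse[OF s(1) nn])
    define u where "u = (\<lambda>n. s n * t n - 1)"
    obtain d N where "d > 0" "\<And>n. n \<ge> N \<Longrightarrow> v (s n) \<ge> d"
      using nonnull_bounded_away[OF s(1) nn] by blast
    hence "s n \<noteq> 0" if "n \<ge> N" for n using that by fastforce
    hence "eventually (\<lambda>n. v (u n) = 0) sequentially"
      by (intro eventually_sequentiallyI[of N]) (simp add: u_def t_def)
    hence u: "u \<in> null_seqs v"
      unfolding null_seqs_def by (simp add: tendsto_eventually)
    have "a \<otimes>\<^bsub>completion v\<^esub> ?c t = ?c (\<lambda>n. s n * t n)"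
      using ring_hom_mult[OF coset_hom, of s t] s t by (simp add: cauchy_ring_def)
    also have "(\<lambda>n. s n * t n) = u \<oplus>\<^bsub>cauchy_ring v\<^esub> (\<lambda>n. 1)"
      by (simp add: cauchy_ring_def u_def)
    also have "?c \<dots> = ?c u \<oplus>\<^bsub>completion v\<^esub> ?c (\<lambda>n. 1)"
      using ring_hom_add[OF coset_hom, of u "\<lambda>n. 1"] null_imp_cauchy[OF u] const_cauchy
      by (simp add: cauchy_ring_def)
    also have "\<dots> = \<one>\<^bsub>completion v\<^esub>"
      using coset_eq_zero_iff[OF null_imp_cauchy[OF u]] u one C.l_zero[OF C.one_closed] by simp
    finally show "\<exists>b\<in>carrier (completion v). a \<otimes>\<^bsub>completion v\<^esub> b = \<one>\<^bsub>completion v\<^esub>"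
      using t by (auto simp: carrier_completion)
  qed
qed

end


lemma padic_abs_divide:
  assumes p: "prime p" and ab: "a \<noteq> 0" "b \<noteq> 0"
  shows "padic_abs p (of_int a / of_int b) =
           real p powi (int (multiplicity (int p) b) - int (multiplicity (int p) a))"
proof -
  obtain c d where q: "quotient_of (of_int a / of_int b) = (c, d)" by (metis surj_pair)
  have eq: "of_int a / of_int b = (of_int c / of_int d :: rat)" and d: "d > 0"
    using quotient_of_div[OF q] quotient_of_denom_pos[OF q] by auto
  have "(of_int (a * d) :: rat) = of_int (c * b)"
    using eq ab d by (simp add: field_simps)
  hence e: "a * d = c * b" using of_int_eq_iff by blast
  hence c: "c \<noteq> 0" using ab d by auto
  have "prime_elem (int p)" using p by simp
  hence "multiplicity (int p) a + multiplicity (int p) d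
       = multiplicity (int p) c + multiplicity (int p) b"
    using e ab c d by (metis less_irrefl prime_elem_multiplicity_mult_distrib)
  hence "int (multiplicity (int p) d) - int (multiplicity (int p) c)
       = int (multiplicity (int p) b) - int (multiplicity (int p) a)" by linarith
  thus ?thesis using ab q by (simp add: padic_abs_def)
qed

lemma padic_abs_ultrametric:
  assumes p: "prime p"
  shows "padic_abs p (x + y) \<le> max (padic_abs p x) (padic_abs p y)"
proof (cases "x = 0 \<or> y = 0 \<or> x + y = 0")
  case False
  have pos: "real p > 1" using prime_gt_1_nat[OF p] by simp
  obtain a b where x: "x = of_int a / of_int b" "b \<noteq> 0"
    by (metis quotient_of_div quotient_of_denom_pos less_irrefl surj_pair)
  obtain c d where y: "y = of_int c / of_int d" "d \<noteq> 0"
    by (metis quotient_of_div quotient_of_denom_pos less_irrefl surj_pair)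
  define k m n where "k = a * d" and "m = c * b" and "n = b * d"
  have xyz: "x = of_int k / of_int n" "y = of_int m / of_int n" "x + y = of_int (k + m) / of_int n"
    using x y by (simp_all add: k_def m_def n_def field_simps)
  have nz: "k \<noteq> 0" "m \<noteq> 0" "k + m \<noteq> 0" "n \<noteq> 0"
    using False xyz by auto
  let ?\<mu> = "multiplicity (int p)"
  have "int p ^ min (?\<mu> k) (?\<mu> m) dvd k + m"
    by (intro dvd_add) (auto intro: multiplicity_dvd' )
  hence "min (?\<mu> k) (?\<mu> m) \<le> ?\<mu> (k + m)"
    using nz p by (intro multiplicity_geI) (auto simp: not_prime_1)
  hence "?\<mu> k \<le> ?\<mu> (k + m) \<or> ?\<mu> m \<le> ?\<mu> (k + m)" by linarith
  moreover have "padic_abs p x = real p powi (int (?\<mu> n) - int (?\<mu> k))"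
    unfolding xyz(1) by (rule padic_abs_divide[OF p nz(1,4)])
  moreover have "padic_abs p y = real p powi (int (?\<mu> n) - int (?\<mu> m))"
    unfolding xyz(2) by (rule padic_abs_divide[OF p nz(2,4)])
  moreover have "padic_abs p (x + y) = real p powi (int (?\<mu> n) - int (?\<mu> (k + m)))"
    unfolding xyz(3) by (rule padic_abs_divide[OF p nz(3,4)])
  ultimately have "padic_abs p (x + y) \<le> padic_abs p x \<or> padic_abs p (x + y) \<le> padic_abs p y"
    using pos by (auto intro!: power_int_increasing)
  thus ?thesis by linarith
qed (auto simp: padic_abs_def le_max_iff_disj)

lemma padic_abs_value:
  assumes p: "prime p"
  shows "rat_abs_value (padic_abs p)"
proof
  fix x y :: rat
  have pos: "real p > 0" using prime_gt_0_nat[OF p] by simp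
  show nn: "padic_abs p x \<ge> 0" for x using pos by (simp add: padic_abs_def)
  show "padic_abs p x = 0 \<longleftrightarrow> x = 0" using pos by (simp add: padic_abs_def)
  show "padic_abs p (x + y) \<le> padic_abs p x + padic_abs p y"
    using padic_abs_ultrametric[OF p, of x y] nn[of x] nn[of y] by linarith
  show "padic_abs p (x * y) = padic_abs p x * padic_abs p y"
  proof (cases "x = 0 \<or> y = 0")
    case False
    obtain a b where x: "x = of_int a / of_int b" "b \<noteq> 0"
      by (metis quotient_of_div quotient_of_denom_pos less_irrefl surj_pair)
    obtain c d where y: "y = of_int c / of_int d" "d \<noteq> 0"
      by (metis quotient_of_div quotient_of_denom_pos less_irrefl surj_pair)
    have nz: "a \<noteq> 0" "c \<noteq> 0" using False x y by auto
    have xy: "x * y = of_int (a * c) / of_int (b * d)" using x y by simp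
    have pe: "prime_elem (int p)" using p by simp
    have "padic_abs p (x * y) = real p powi (int (multiplicity (int p) (b * d)) - int (multiplicity (int p) (a * c)))"
      unfolding xy using nz x y by (intro padic_abs_divide p) auto
    also have "int (multiplicity (int p) (b * d)) - int (multiplicity (int p) (a * c)) =
        (int (multiplicity (int p) b) - int (multiplicity (int p) a)) +
        (int (multiplicity (int p) d) - int (multiplicity (int p) c))"
      using nz x y by (simp add: prime_elem_multiplicity_mult_distrib[OF pe])
    also have "real p powi \<dots> = padic_abs p x * padic_abs p y"
      unfolding x y padic_abs_divide[OF p nz(1) x(2)] padic_abs_divide[OF p nz(2) y(2)]
      using pos by (subst power_int_add) auto
    finally show ?thesis .
  qed (auto simp: padic_abs_def)
qed

corollary padic_field_field: "prime p \<Longrightarrow> field (padic_field p)"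
  by (intro rat_abs_value.completion_field padic_abs_value)


section \<open>Projective closures of affine plane curves\<close>

definition proj_triples :: "('a, 'b) ring_scheme \<Rightarrow> ('a \<times> 'a \<times> 'a) set" where
  "proj_triples K = carrier K \<times> carrier K \<times> carrier K - {(\<zero>\<^bsub>K\<^esub>, \<zero>\<^bsub>K\<^esub>, \<zero>\<^bsub>K\<^esub>)}"

definition proj_point :: "('a, 'b) ring_scheme \<Rightarrow> 'a \<times> 'a \<times> 'a \<Rightarrow> ('a \<times> 'a \<times> 'a) set" where
  "proj_point K = (\<lambda>(x, y, t).
     {(c \<otimes>\<^bsub>K\<^esub> x, c \<otimes>\<^bsub>K\<^esub> y, c \<otimes>\<^bsub>K\<^esub> t) | c. c \<in> carrier K - {\<zero>\<^bsub>K\<^esub>}})"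

text \<open>A polynomial \<open>f\<close> in two variables \<open>w, z\<close> is an element of \<open>\<rat>[w][z]\<close>, so that the
  coefficient of \<open>w\<^sup>i z\<^sup>j\<close> is \<open>coeff (coeff f j) i\<close>.\<close>

definition bimonomials :: "'a::zero poly poly \<Rightarrow> (nat \<times> nat) set" where
  "bimonomials f = {(i, j). Polynomial.coeff (Polynomial.coeff f j) i \<noteq> 0}"

definition total_degree :: "'a::zero poly poly \<Rightarrow> nat" where
  "total_degree f = Max (insert 0 ((\<lambda>(i, j). i + j) ` bimonomials f))"

text \<open>The value at \<open>(x, y, t)\<close> of the homogenisation \<open>t\<^sup>d f(w/t, z/t)\<close>, \<open>d\<close> the total degree of
  \<open>f\<close>, where \<open>\<phi>\<close> maps the rational coefficients into \<open>K\<close>.\<close>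

definition eval_homogenization ::
  "('a, 'b) ring_scheme \<Rightarrow> (rat \<Rightarrow> 'a) \<Rightarrow> rat poly poly \<Rightarrow> 'a \<times> 'a \<times> 'a \<Rightarrow> 'a" where
  "eval_homogenization K \<phi> f = (\<lambda>(x, y, t).
     finsum K (\<lambda>(i, j).
       \<phi> (Polynomial.coeff (Polynomial.coeff f j) i)
         \<otimes>\<^bsub>K\<^esub> x [^]\<^bsub>K\<^esub> i \<otimes>\<^bsub>K\<^esub> y [^]\<^bsub>K\<^esub> j \<otimes>\<^bsub>K\<^esub> t [^]\<^bsub>K\<^esub> (total_degree f - (i + j)))
       (bimonomials f))"

text \<open>The \<open>K\<close>-points of the closure in the projective plane of the affine curve \<open>f = 0\<close> over
  \<open>\<rat>\<close>, for a field extension \<open>\<phi> : \<rat> \<rightarrow> K\<close>.\<close>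

definition closure_points ::
  "('a, 'b) ring_scheme \<Rightarrow> (rat \<Rightarrow> 'a) \<Rightarrow> rat poly poly \<Rightarrow> ('a \<times> 'a \<times> 'a) set set" where
  "closure_points K \<phi> f =
     proj_point K ` {v \<in> proj_triples K. eval_homogenization K \<phi> f v = \<zero>\<^bsub>K\<^esub>}"

definition cubic_poly :: "int \<Rightarrow> rat poly poly" where
  "cubic_poly h = (let w = [:[:0, 1:]:]; z = [:0, 1:] in
     (3 * w^2 * z + 2 * z^3 + w^3 + 6 * w * z^2 + of_int (2 * (h - 2)^2 * (h - 8)))
       - (12 * z^2 - 6 * w^2))"

lemma cubic_poly_explicit:
  "cubic_poly h = [:[:of_int (2 * (h - 2)^2 * (h - 8)), 0, 6, 1:], [:0, 0, 3:], [:-12, 6:], [:2:]:]"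
  unfolding cubic_poly_def Let_def of_int_poly
  by (simp add: power2_eq_square power3_eq_cube numeral_poly)

lemma bimonomials_cubic_poly:
  assumes "h \<noteq> 2" "h \<noteq> 8"
  shows "bimonomials (cubic_poly h) = {(0,0), (2,0), (3,0), (2,1), (0,2), (1,2), (0,3)}"
proof -
  define c :: rat where "c = of_int (2 * (h - 2)^2 * (h - 8))"
  have c: "c \<noteq> 0" using assms unfolding c_def by (simp only: of_int_eq_0_iff) simp
  have nat: "k = 0 \<or> k = Suc 0 \<or> k = Suc (Suc 0) \<or> k = Suc (Suc (Suc 0)) \<or>
      (\<exists>l. k = Suc (Suc (Suc (Suc l))))" for k :: nat
    by presburger
  have "Polynomial.coeff (Polynomial.coeff (cubic_poly h) j) i \<noteq> 0 \<longleftrightarrow>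
      (i, j) \<in> {(0,0), (2,0), (3,0), (2,1), (0,2), (1,2), (0,3)}" for i j
    unfolding cubic_poly_explicit c_def[symmetric]
    using nat[of i] nat[of j]
    by (elim disjE exE) (simp_all add: c numeral_2_eq_2 numeral_3_eq_3)
  thus ?thesis unfolding bimonomials_def by auto
qed

lemma total_degree_cubic_poly:
  assumes "h \<noteq> 2" "h \<noteq> 8"
  shows "total_degree (cubic_poly h) = 3"
  by (simp add: total_degree_def bimonomials_cubic_poly[OF assms])

text \<open>In a type-class field the homogeneous equation becomes the expected ternary cubic form.\<close>

lemma ring_of_type_algebra_simps:
  "carrier (ring_of_type_algebra :: 'a::field ring) = UNIV"
  "\<zero>\<^bsub>ring_of_type_algebra :: 'a ring\<^esub> = 0" "\<one>\<^bsub>ring_of_type_algebra :: 'a ring\<^esub> = 1"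
  "a \<oplus>\<^bsub>ring_of_type_algebra :: 'a ring\<^esub> b = a + b"
  "a \<otimes>\<^bsub>ring_of_type_algebra :: 'a ring\<^esub> b = a * b"
  by (simp_all add: ring_of_type_algebra_def)

lemma ring_of_type_algebra_pow:
  "a [^]\<^bsub>ring_of_type_algebra :: 'a::field ring\<^esub> (n::nat) = a ^ n"
  by (induction n) (simp_all add: nat_pow_def ring_of_type_algebra_def)

lemma eval_homogenization_cubic_poly:
  fixes x y t :: "'a::field_char_0"
  assumes "h \<noteq> 2" "h \<noteq> 8"
  shows "eval_homogenization ring_of_type_algebra of_rat (cubic_poly h) (x, y, t) =
    3 * x^2 * y + 2 * y^3 + x^3 + 6 * x * y^2 + of_int (2 * (h - 2)^2 * (h - 8)) * t^3
      - (12 * y^2 * t - 6 * x^2 * t)"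
proof -
  interpret K: field "ring_of_type_algebra :: 'a ring"
    by (rule field_from_type_algebra)
  have fs: "finsum (ring_of_type_algebra :: 'a ring) g A = sum g A" if "finite A"
    for g :: "nat \<times> nat \<Rightarrow> 'a" and A
    using that by (induction A) (simp_all add: K.finsum_insert ring_of_type_algebra_simps)
  define c :: rat where "c = of_int (2 * (h - 2)^2 * (h - 8))"
  have cu: "cubic_poly h = [:[:c, 0, 6, 1:], [:0, 0, 3:], [:-12, 6:], [:2:]:]"
    unfolding cubic_poly_explicit c_def ..
  have "eval_homogenization ring_of_type_algebra of_rat (cubic_poly h) (x, y, t) =
      of_rat c * t^3 + (6 * x^2 * t + (x^3 + (3 * x^2 * y + (-12 * y^2 * t + (6 * x * y^2 + 2 * y^3)))))"
    unfolding eval_homogenization_def bimonomials_cubic_poly[OF assms] total_degree_cubic_poly[OF assms]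
    by (simp add: fs ring_of_type_algebra_simps ring_of_type_algebra_pow cu of_rat_minus
        coeff_pCons numeral_2_eq_2 numeral_3_eq_3)
  also have "of_rat c = (of_int (2 * (h - 2)^2 * (h - 8)) :: 'a)"
    unfolding c_def by (rule of_rat_of_int_eq)
  finally show ?thesis by simp
qed

end

theory Submission
  imports Defs "HOL-Number_Theory.Number_Theory"
begin

text \<open>
  Put \<open>p = h - 2\<close> and \<open>c = p\<^sup>2 (p - 6)\<close>. With \<open>x = w + z \<surd>2\<close> four times the equation is
  \<open>\<alpha> x\<^sup>3 + \<alpha>' x'\<^sup>3 + 8 c t\<^sup>3 + 24 x x' t = 0\<close>, \<open>\<alpha> = 2 + \<surd>2\<close>, a 3-covering of the elliptic curve
  \<open>E : \<eta>\<^sup>2 = \<xi> (\<xi>\<^sup>2 + 2 a \<xi> + 4 b)\<close>, \<open>a = 3 (12 - p\<^sup>2)\<close>, \<open>b = 3 p\<^sup>3 (p - 4)\<close>, \<open>a\<^sup>2 - 4 b = - 3 (p + 2) (p - 6)\<^sup>3\<close>,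
  the covering map being \<open>\<xi> = 2 p\<^sup>2 - w\<^sup>2 + 2 z\<^sup>2\<close> on the chart \<open>t = 1\<close>. The parametrisation is such that \<open>E\<close> has a
  rational 2-torsion point, and descent by the corresponding isogeny shows that every rational
  point is, up to 2-torsion, the double of a rational point. Apart from the 2-torsion all rational
  points lie, up to 2-torsion, in the kernel of reduction at 2, where doubling shrinks the 2-adic
  parameter; hence \<open>E\<close> has no rational points but the 2-torsion, which does not lift to the cubic.

  At a prime \<open>l\<close> with \<open>-6\<close> a nonresidue, \<open>1 + \<surd>2\<close> has a power with exponent congruent to 1 modulo 3
  that is 1 modulo \<open>l\<close>, and this yields a point with \<open>t = 0\<close>. If \<open>-6\<close> is a residue, the number of zeros modulo \<open>l\<close> is
  congruent modulo \<open>l\<close> to that of the twist with a rational flex. If the cubic had no zero, the twist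
  would have \<open>l\<close> or \<open>2 l\<close> points; but it carries a free action of the cube roots of unity.
\<close>

section \<open>Quadratic residues\<close>

text \<open>Origin of \<open>c\<close>: for n = w^2 - 2 z^2 the map to \<open>E\<close> gives
  \<eta>^2 = 8 (3 n + c)^2 - n^3, and c = p^2 (p - 6) makes n = 2 p^2 a root, since then 3 n + c =
  p^3. This 2-torsion point lets a descent over the rationals settle a 3-covering. Role of the four
  primes: apart from 2 and 3, b has the prime factors p and p - 4, and a^2 - 4 b has p + 2 and p -
  6, all with odd exponent. In each descent the primes of one number bound the square class, and the
  odd exponents in the other force it to be a residue there. Besides 1 and the class of the torsion
  point only classes survive that fail at 2 or 3. Locally no Hasse-Weil bound is used: a count known
  modulo l suffices together with a crude bound and divisibility by 3. The primes above 3 dividing c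
  (c + 32) are p, p + 2, p - 4 and p - 6; at the first three -6 is a nonresidue, so only p - 6 needs
  a point of its own.\<close>

lemma Legendre_cases: "Legendre a p \<in> {-1, 0, 1}"
  by (simp add: Legendre_def)

lemma Legendre_unique:
  assumes "p > 2" "x \<in> {-1, 0, 1}" "[Legendre a p = x] (mod p)"
  shows "Legendre a p = x"
proof -
  have "p dvd Legendre a p - x" using assms(3) by (simp add: cong_iff_dvd_diff)
  moreover have "\<bar>Legendre a p - x\<bar> < p" 
    using assms(1,2) Legendre_cases[of a p] by auto
  ultimately show ?thesis using zdvd_not_zless[of "\<bar>Legendre a p - x\<bar>" p] by auto
qed

lemma euler_criterion_int:
  assumes "prime (p::int)" "p > 2"
  shows "[Legendre a p = a ^ (nat (p - 1) div 2)] (mod p)"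
proof -
  have "nat p - 1 = nat (p - 1)" using assms by auto
  thus ?thesis using euler_criterion[of "nat p" a] assms by auto
qed

lemma Legendre_mult:
  assumes "prime (p::int)" "p > 2"
  shows "Legendre (a * b) p = Legendre a p * Legendre b p"
proof (rule Legendre_unique)
  show "Legendre a p * Legendre b p \<in> {- 1, 0, 1}"
    using Legendre_cases[of a p] Legendre_cases[of b p] by auto
  have "[Legendre (a * b) p = a ^ (nat (p - 1) div 2) * b ^ (nat (p - 1) div 2)] (mod p)"
    using euler_criterion_int[OF assms, of "a * b"] by (simp add: power_mult_distrib)
  also have "[a ^ (nat (p - 1) div 2) * b ^ (nat (p - 1) div 2) = Legendre a p * Legendre b p] (mod p)"
    by (intro cong_mult cong_sym[OF euler_criterion_int] assms)
  finally show "[Legendre (a * b) p = Legendre a p * Legendre b p] (mod p)" .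
qed (use assms in auto)

lemma Legendre_cong:
  assumes "[a = b] (mod p)"
  shows "Legendre a p = Legendre b p"
proof -
  have "[a = 0] (mod p) \<longleftrightarrow> [b = 0] (mod p)" "QuadRes p a \<longleftrightarrow> QuadRes p b"
    using assms unfolding QuadRes_def by (meson cong_sym cong_trans)+
  thus ?thesis by (simp add: Legendre_def)
qed

lemma Legendre_square:
  assumes "prime p" "\<not> p dvd a" shows "Legendre (a\<^sup>2) p = 1"
proof -
  have "QuadRes p (a\<^sup>2)" unfolding QuadRes_def by (rule exI[of _ a]) (rule cong_refl)
  thus ?thesis using assms by (auto simp: Legendre_def cong_0_iff dest: prime_dvd_power)
qed

lemma Legendre_square_nonneg: "Legendre (a\<^sup>2) p = 0 \<or> Legendre (a\<^sup>2) p = 1"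
proof -
  have "QuadRes p (a\<^sup>2)" unfolding QuadRes_def by (rule exI[of _ a]) (rule cong_refl)
  thus ?thesis by (simp add: Legendre_def)
qed

lemma Legendre_minus_one:
  assumes "prime (p::int)" "p > 2"
  shows "Legendre (-1) p = (if p mod 4 = 1 then 1 else -1)"
proof (rule Legendre_unique)
  define k where "k = (p - 1) div 2"
  have "odd p" using assms by (intro prime_odd_int) auto
  hence k: "p = 2 * k + 1" by (simp add: k_def)
  have "nat (p - 1) div 2 = nat k" using k by (simp add: nat_mult_distrib)
  moreover have "even (nat k) \<longleftrightarrow> even k" using k assms(2) by (intro even_nat_iff) auto
  moreover have "even k \<longleftrightarrow> p mod 4 = 1" using k by presburger
  ultimately have "(-1) ^ (nat (p - 1) div 2) = (if p mod 4 = 1 then 1 else -1 :: int)" by auto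
  thus "[Legendre (-1) p = (if p mod 4 = 1 then 1 else -1)] (mod p)"
    using euler_criterion_int[OF assms, of "-1"] by simp
qed (use assms in auto)

text \<open>Gauss's lemma: the doubles 2, 4, ..., 2 m are already reduced modulo p = 2 m + 1, and
  those above m are the doubles of the x > \<open>m div 2\<close>, so the sign is the parity of
  \<open>m - m div 2\<close>.\<close>

lemma Legendre_two:
  assumes "prime (p::int)" "p > 2"
  shows "Legendre 2 p = (if p mod 8 = 1 \<or> p mod 8 = 7 then 1 else -1)"
proof -
  have pp: "prime (nat p)" "int (nat p) = p" using assms by auto
  have odd: "odd p" using assms by (intro prime_odd_int) auto
  interpret G: GAUSS "nat p" 2
  proof
    show "[2 \<noteq> 0] (mod int (nat p))" using assms zdvd_not_zless[of 2 p] by (auto simp: cong_0_iff pp)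
  qed (use pp assms in auto)
  define m where "m = (p - 1) div 2"
  have m: "p = 2 * m + 1" "m > 0" using odd assms(2) by (auto simp: m_def)
  have C: "G.C = (\<lambda>x. x * 2) ` {0<..m}"
  proof -
    have "x * 2 mod p = x * 2" if "x \<in> {0<..m}" for x using that m by (intro mod_pos_pos_trivial) auto
    thus ?thesis unfolding G.C_def G.B_def G.A_def pp(2) m_def[symmetric] image_image
      by (intro image_cong) auto
  qed
  have "G.E = (\<lambda>x. x * 2) ` {m div 2<..m}"
    unfolding G.E_def C pp(2) m_def[symmetric] using m(2) by auto
  hence "card G.E = nat (m - m div 2)"
    by (simp add: card_image inj_on_def)
  hence L: "Legendre 2 p = (-1) ^ nat (m - m div 2)" using G.gauss_lemma pp by simp
  have "p mod 8 = 1 \<or> p mod 8 = 3 \<or> p mod 8 = 5 \<or> p mod 8 = 7" using odd by presburger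
  moreover have "even (nat (m - m div 2)) \<longleftrightarrow> even (m - m div 2)" using m(2) by (intro even_nat_iff) auto
  moreover have "even (m - m div 2) \<longleftrightarrow> p mod 8 = 1 \<or> p mod 8 = 7" using m(1) by presburger
  ultimately show ?thesis unfolding L by auto
qed

text \<open>Reciprocity between 3 and p costs a sign that is itself the symbol of -1 at p. It
  cancels the factor -1 of -3 and leaves \<open>Legendre p 3\<close>.\<close>

lemma Legendre_minus_three:
  assumes "prime (p::int)" "p > 3"
  shows "Legendre (-3) p = (if p mod 3 = 1 then 1 else -1)"
proof -
  have odd: "odd p" using assms by (intro prime_odd_int) auto
  have n3: "\<not> 3 dvd p"
  proof
    assume "3 dvd p"
    hence "3 = p" using assms(1) primes_dvd_imp_eq[of 3 p] by simp
    thus False using assms by simp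
  qed
  have "Legendre p 3 = (if p mod 3 = 1 then 1 else -1)"
  proof (cases "p mod 3 = 1")
    case True
    hence "Legendre p 3 = Legendre (1^2) 3" by (intro Legendre_cong) (simp add: cong_def)
    thus ?thesis using True Legendre_square[of 3 1] by simp
  next
    case False
    hence "p mod 3 = 2" using n3 by presburger
    hence "Legendre p 3 = Legendre (-1) 3" by (intro Legendre_cong) (simp add: cong_def)
    thus ?thesis using False Legendre_minus_one[of 3] by simp
  qed
  moreover have "Legendre 3 p * Legendre p 3 = (-1) ^ nat ((3 - 1) div 2 * ((p - 1) div 2))"
    using assms by (intro Quadratic_Reciprocity_int) auto
  moreover have "(-1::int) ^ nat ((3 - 1) div 2 * ((p - 1) div 2)) = Legendre (-1) p"
  proof -
    define k where "k = (p - 1) div 2"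
    have k: "p = 2 * k + 1" using odd by (simp add: k_def)
    have "nat ((3 - 1) div 2 * ((p - 1) div 2)) = nat k" by (simp add: k_def)
    moreover have "even (nat k) \<longleftrightarrow> even k" using k assms(2) by (intro even_nat_iff) auto
    moreover have "even k \<longleftrightarrow> p mod 4 = 1" using k by presburger
    ultimately have "even (nat ((3 - 1) div 2 * ((p - 1) div 2))) \<longleftrightarrow> p mod 4 = 1" by simp
    thus ?thesis using Legendre_minus_one[of p] assms by (simp add: )
  qed
  moreover have "Legendre (-3) p = Legendre (-1) p * Legendre 3 p"
    using Legendre_mult[of p "-1" 3] assms by simp
  moreover have "Legendre (-1) p * Legendre (-1) p = 1" 
    using Legendre_minus_one[of p] assms by (auto split: if_splits)
  moreover have "Legendre p 3 * Legendre p 3 = 1"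
    using \<open>Legendre p 3 = _\<close> by simp
  ultimately have "Legendre (-3) p = Legendre p 3"
    by (metis mult.assoc mult.right_neutral)
  thus ?thesis using \<open>Legendre p 3 = _\<close> by simp
qed

section \<open>Two-isogeny descent over the rationals\<close>

text \<open>For a nonresidue d the form d N^2 - K^2 is anisotropic modulo l: if l divides the value,
  it divides both N and K. Nonzero values therefore have even l-adic valuation, and the induction
  strips off l^2 each time.\<close>

lemma nonresidue_form_odd_valuation:
  fixes l d :: int
  assumes l: "prime l" "l > 2" and d: "Legendre d l = -1"
    and eq: "d * N\<^sup>2 - K\<^sup>2 = l ^ (2 * k + 1) * g" and g: "\<not> l dvd g"
  shows False
  using eq
proof (induction k arbitrary: N K)
  have step: "l dvd N \<and> l dvd K" if "l dvd d * N\<^sup>2 - K\<^sup>2" for N K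
  proof -
    have "[d * N\<^sup>2 = K\<^sup>2] (mod l)" using that by (simp add: cong_iff_dvd_diff)
    hence "Legendre d l * Legendre (N\<^sup>2) l = Legendre (K\<^sup>2) l"
      using Legendre_cong Legendre_mult[OF l] by metis
    hence N: "Legendre (N\<^sup>2) l = 0" using d Legendre_square_nonneg[of N l] Legendre_square_nonneg[of K l] by auto
    have "l dvd N"
    proof (rule ccontr)
      assume "\<not> l dvd N"
      from Legendre_square[OF l(1) this] N show False by simp
    qed
    moreover from this have "l dvd d * N\<^sup>2" by (simp add: dvd_mult power2_eq_square)
    hence "l dvd K\<^sup>2" using that by (metis dvd_diff_right_iff dvd_minus_iff minus_diff_eq dvd_diffD1 dvd_add_right_iff diff_add_cancel)
    ultimately show ?thesis using prime_dvd_power[OF l(1)] by blast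
  qed
  {
    case 0
    have "l dvd N \<and> l dvd K" using step[of N K] 0 by simp
    then obtain n k where "N = l * n" "K = l * k" by (auto elim!: dvdE)
    hence "l * g = l * (l * (d * n\<^sup>2 - k\<^sup>2))" using 0 by (simp add: power2_eq_square algebra_simps)
    hence "g = l * (d * n\<^sup>2 - k\<^sup>2)" using l by simp
    thus False using g by simp
  next
    case (Suc k N K)
    have "l dvd d * N\<^sup>2 - K\<^sup>2" using Suc.prems by simp
    from step[OF this] obtain n m where "N = l * n" "K = l * m" by (auto elim!: dvdE)
    hence "l^2 * (d * n\<^sup>2 - m\<^sup>2) = l^2 * (l ^ (2 * k + 1) * g)"
      using Suc.prems by (simp add: power2_eq_square algebra_simps)
    hence "d * n\<^sup>2 - m\<^sup>2 = l ^ (2 * k + 1) * g" using l by simp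
    thus False by (rule Suc.IH)
  }
qed

text \<open>The equation is a descent quartic with its square completed. If l does not divide s, the
  odd valuation of the remainder rules out a nonresidue d by the previous lemma. If l divides s, the
  equation modulo l equates d times a square with a nonzero square.\<close>

lemma residue_of_form_odd_valuation:
  fixes l d :: int
  assumes l: "prime l" "l > 2" and d: "\<not> l dvd d" and cop: "coprime (d * r) s"
    and eq: "d * N\<^sup>2 = (d * r\<^sup>2 + e * s\<^sup>2)\<^sup>2 + l ^ (2 * k + 1) * g * s ^ 4" and g: "\<not> l dvd g"
  shows "Legendre d l = 1"
proof (rule ccontr)
  assume "Legendre d l \<noteq> 1"
  hence m1: "Legendre d l = -1" using Legendre_cases[of d l] d by (auto simp: Legendre_def cong_0_iff)
  have "\<not> l dvd s"
  proof
    assume s: "l dvd s"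
    hence "\<not> l dvd d * r" using cop l(1) by (meson coprime_common_divisor not_prime_unit)
    hence nd: "\<not> l dvd d * r\<^sup>2" using l(1) by (auto simp: prime_dvd_mult_iff dest: prime_dvd_power)
    have "l dvd s\<^sup>2" "l dvd s ^ 4" using s by (auto simp: dvd_power_iff intro: dvd_power_le[of l s 1, simplified] dvd_trans[OF s])
    hence "[d * N\<^sup>2 = (d * r\<^sup>2 + 0)\<^sup>2 + 0] (mod l)"
      unfolding eq by (intro cong_add cong_pow cong_refl) (auto simp: cong_0_iff)
    hence "Legendre d l * Legendre (N\<^sup>2) l = Legendre ((d * r\<^sup>2)\<^sup>2) l"
      using Legendre_cong Legendre_mult[OF l] by (metis add.right_neutral)
    also have "\<dots> = 1" using nd by (rule Legendre_square[OF l(1)])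
    finally have "Legendre (N\<^sup>2) l = -1" using m1 by simp
    thus False using Legendre_square_nonneg[of N l] by simp
  qed
  hence "\<not> l dvd g * s ^ 4" using g l(1) by (auto simp: prime_dvd_mult_iff dest: prime_dvd_power)
  moreover have "d * N\<^sup>2 - (d * r\<^sup>2 + e * s\<^sup>2)\<^sup>2 = l ^ (2 * k + 1) * (g * s ^ 4)"
    using eq by simp
  ultimately show False using nonresidue_form_odd_valuation[OF l m1] by blast
qed

text \<open>Iterated over the primes that may divide a descent class, it leaves only a unit.\<close>

lemma squarefree_peel_prime:
  fixes d :: int
  assumes "squarefree d" "prime r"
  obtains e d' where "e \<in> {1, r}" "d = e * d'" "squarefree d'" "\<not> r dvd d'"
proof (cases "r dvd d")
  case True
  then obtain d' where d: "d = r * d'" by (elim dvdE)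
  have "\<not> r dvd d'"
  proof
    assume "r dvd d'"
    hence "r\<^sup>2 dvd d" unfolding d power2_eq_square by simp
    thus False using assms squarefreeD not_prime_unit by blast
  qed
  moreover have "squarefree d'" using squarefree_mono[of d' d] assms(1) d by simp
  ultimately show ?thesis using that[of r d'] d by simp
next
  case False thus ?thesis using that[of 1 d] assms by simp
qed

lemma int_unit_of_no_prime_divisor:
  fixes d :: int
  assumes "\<And>r. prime r \<Longrightarrow> \<not> r dvd d" shows "d \<in> {1, -1}"
proof (rule ccontr)
  assume "d \<notin> {1, -1}"
  hence "\<not> is_unit d" by auto
  thus False using assms prime_divisor_exists[of d] by (cases "d = 0") (auto intro: two_is_prime)
qed

lemma squarefree_dvd_of_dvd_square:
  fixes d :: int
  assumes "squarefree d" "d dvd x\<^sup>2" shows "d dvd x"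
proof (cases "x = 0")
  case False
  have d0: "d \<noteq> 0" using assms(1) by auto
  show ?thesis
  proof (rule multiplicity_le_imp_dvd[OF d0])
    fix r :: int assume r: "prime r"
    have "multiplicity r d \<le> 1"
      using assms(1) r d0 by (auto simp: squarefree_factorial_semiring'' )
    moreover have "multiplicity r d \<le> 2 * multiplicity r x"
      using dvd_imp_multiplicity_le[OF assms(2), of r] False r
      by (simp add: prime_elem_multiplicity_power_distrib[OF prime_imp_prime_elem])
    ultimately show "multiplicity r d \<le> multiplicity r x" by linarith
  qed
qed simp

lemma int_square_of_rat_square:
  assumes "(x::rat)\<^sup>2 = of_int n" shows "\<exists>m::int. x = of_int m"
proof -
  obtain a b where q: "quotient_of x = (a, b)" by (metis surj_pair)
  have x: "x = of_int a / of_int b" and b: "b > 0" and cop: "coprime a b"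
    using quotient_of_div[OF q] quotient_of_denom_pos[OF q] quotient_of_coprime[OF q] by auto
  have "of_int (a\<^sup>2) = (of_int (n * b\<^sup>2) :: rat)"
    using assms x b by (simp add: field_simps power2_eq_square)
  hence "a\<^sup>2 = n * b\<^sup>2" using of_int_eq_iff by blast
  hence "b\<^sup>2 dvd a\<^sup>2" by simp
  hence "b dvd a" by simp
  hence "is_unit b" using cop by (metis coprime_common_divisor dvd_refl)
  thus ?thesis using x b by (intro exI[of _ a]) simp
qed

lemma int_coprime_mult_square:
  fixes a b y :: int
  assumes "coprime a b" "a * b = y\<^sup>2" "a > 0" "b \<noteq> 0"
  shows "\<exists>x>0. a = x\<^sup>2"
proof -
  have b: "b > 0" using assms by (metis zero_le_mult_iff zero_le_power2 less_le not_less)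
  have "nat a * nat b = (nat \<bar>y\<bar>)\<^sup>2"
    using assms b by (metis nat_mult_distrib less_imp_le nat_power_eq abs_ge_zero power2_abs)
  hence "is_nth_power 2 (nat a * nat b)" by auto
  moreover have "coprime (nat a) (nat b)" using assms(1,3) b
    by (metis coprime_int_iff int_nat_eq less_imp_le)
  ultimately have "is_nth_power 2 (nat a)" using assms b by (intro is_nth_power_mult_coprime_natD(1)[of "nat a" "nat b"]) auto
  then obtain x where x: "nat a = x\<^sup>2" by (auto simp: is_nth_power_def)
  hence "a = (int x)\<^sup>2" using assms(3) by (metis int_nat_eq less_imp_le of_nat_power)
  moreover have "int x > 0" using calculation assms(3) by (cases x) auto
  ultimately show ?thesis by blast
qed

text \<open>Here d is the square class of \<xi>. With \<xi> = M / D in lowest terms, \<eta>^2 D^4 =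
  D M Q and D is coprime to M Q, so D is a square s^2 and M Q is a square too; d and r come from the
  squarefree decomposition of M. The primes of d divide B because d divides B s^4 and is coprime to
  s.\<close>

lemma two_isogeny_descent:
  fixes \<xi> \<eta> :: rat and A B :: int
  assumes eq: "\<eta>\<^sup>2 = \<xi> * (\<xi>\<^sup>2 + of_int A * \<xi> + of_int B)" and \<xi>: "\<xi> \<noteq> 0" and K0: "\<xi>\<^sup>2 + of_int A * \<xi> + of_int B \<noteq> 0"
  obtains d r s N where "squarefree d" "\<xi> = of_int d * (of_int r / of_int s)\<^sup>2" "s \<noteq> 0" "r \<noteq> 0"
    "coprime (d * r) s" "d * N\<^sup>2 = (d * r\<^sup>2)\<^sup>2 + A * (d * r\<^sup>2) * s\<^sup>2 + B * s ^ 4"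
    "\<And>x. prime x \<Longrightarrow> x dvd d \<Longrightarrow> x dvd B"
proof -
  obtain M D where q: "quotient_of \<xi> = (M, D)" by (metis surj_pair)
  have x: "\<xi> = of_int M / of_int D" and D: "D > 0" and cop: "coprime M D"
    using quotient_of_div[OF q] quotient_of_denom_pos[OF q] quotient_of_coprime[OF q] by auto
  have M: "M \<noteq> 0" using \<xi> x by auto
  define Q where "Q = M\<^sup>2 + A * M * D + B * D\<^sup>2"
  have Qr: "of_int Q = (of_int D)\<^sup>2 * (\<xi>\<^sup>2 + of_int A * \<xi> + of_int B)"
    unfolding x Q_def using D by (simp add: field_simps power2_eq_square)
  hence Q0: "Q \<noteq> 0" using K0 D by auto
  \<comment> \<open>The second factor of the curve equation is Q / D^2 and the first is M / D, so
    D^4 clears all denominators and leaves D M Q.\<close>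
  have "(\<eta> * of_int D ^ 2)\<^sup>2 = of_int (D * (M * Q))"
  proof -
    have "of_int M = \<xi> * of_int D" using x D by simp
    thus ?thesis unfolding power_mult_distrib eq of_int_mult Qr by (simp add: algebra_simps power2_eq_square)
  qed
  then obtain Y where "(of_int Y)\<^sup>2 = (of_int (D * (M * Q)) :: rat)" using int_square_of_rat_square by metis
  hence Y: "Y\<^sup>2 = D * (M * Q)" using of_int_eq_iff by (metis of_int_power)
  have "coprime (M\<^sup>2) D" using cop by simp
  hence "coprime Q D"
  proof -
    have "Q = (A * M + B * D) * D + M\<^sup>2" by (simp add: Q_def power2_eq_square algebra_simps)
    hence "gcd D Q = gcd D (M\<^sup>2)" using gcd_add_mult[of D "A * M + B * D" "M\<^sup>2"] by simp
    thus ?thesis using \<open>coprime (M\<^sup>2) D\<close> by (simp add: coprime_iff_gcd_eq_1 gcd.commute)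
  qed
  hence "coprime D (M * Q)" using cop by (simp add: coprime_commute)
  then obtain s where s: "s > 0" "D = s\<^sup>2" using int_coprime_mult_square[of D "M * Q" Y] Y D M Q0 by auto
  have "s\<^sup>2 dvd Y\<^sup>2" using Y s by simp
  hence "s dvd Y" by simp
  then obtain Z where "Y = s * Z" by (elim dvdE)
  hence Z: "Z\<^sup>2 = M * Q" using Y s by (simp add: power_mult_distrib)
  define d r where "d = squarefree_part M" and "r = square_part M"
  have Mdr: "M = d * r\<^sup>2" unfolding d_def r_def by (rule squarefree_decompose)
  have sq: "squarefree d" by (simp add: d_def)
  have r0: "r \<noteq> 0" and d0: "d \<noteq> 0" using M Mdr by auto
  have "r\<^sup>2 dvd Z\<^sup>2" using Z Mdr by simp
  hence "r dvd Z" by simp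
  then obtain W where "Z = r * W" by (elim dvdE)
  hence W: "W\<^sup>2 = d * Q" using Z Mdr r0 by (simp add: power_mult_distrib)
  hence "d dvd W" using squarefree_dvd_of_dvd_square[OF sq, of W] by simp
  then obtain N where "W = d * N" by (elim dvdE)
  hence N: "d * N\<^sup>2 = Q" using W d0 by (simp add: power2_eq_square mult_ac)
  have cdr: "coprime (d * r) s" using cop Mdr s by (simp add: power2_eq_square)
  show ?thesis
  proof (rule that[of d r s N])
    show "\<xi> = of_int d * (of_int r / of_int s)\<^sup>2" using x Mdr s by (simp add: power_divide)
    show "d * N\<^sup>2 = (d * r\<^sup>2)\<^sup>2 + A * (d * r\<^sup>2) * s\<^sup>2 + B * s ^ 4"
      unfolding N Q_def Mdr s by simp
    fix x :: int assume xp: "prime x" "x dvd d"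
    have "x dvd B * s ^ 4"
    proof -
      have "B * s ^ 4 = d * (N\<^sup>2 - d * r^4 - A * r\<^sup>2 * s\<^sup>2)"
        using N unfolding Q_def Mdr s by (simp add: algebra_simps power2_eq_square power4_eq_xxxx)
      thus ?thesis using xp(2) by simp
    qed
    moreover have "\<not> x dvd s" using cdr xp by (meson coprime_common_divisor dvd_mult2 not_prime_unit)
    ultimately show "x dvd B" using xp(1) by (auto simp: prime_dvd_mult_iff dest: prime_dvd_power)
  qed (use s r0 sq cdr in auto)
qed

lemma three_dvd_sum_two_squares:
  fixes x y :: int assumes "3 dvd x\<^sup>2 + y\<^sup>2" shows "3 dvd x" "3 dvd y"
proof -
  have sq: "z\<^sup>2 mod 3 = (if 3 dvd z then 0 else 1)" for z :: int
  proof -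
    have "z mod 3 = 0 \<or> z mod 3 = 1 \<or> z mod 3 = 2" by presburger
    thus ?thesis by (elim disjE) (simp_all add: power_mod[of z 3 2, symmetric] dvd_eq_mod_eq_0)
  qed
  have "(x\<^sup>2 mod 3 + y\<^sup>2 mod 3) mod 3 = 0" using assms by (simp add: mod_add_eq dvd_eq_mod_eq_0)
  thus "3 dvd x" "3 dvd y" unfolding sq by (auto split: if_splits)
qed

lemma square_mod_8_odd: "odd (x::int) \<Longrightarrow> [x\<^sup>2 = 1] (mod 8)"
proof -
  assume "odd x"
  hence "x mod 8 = 1 \<or> x mod 8 = 3 \<or> x mod 8 = 5 \<or> x mod 8 = 7" by presburger
  thus ?thesis unfolding cong_def by (elim disjE) (simp_all add: power_mod[of x 8 2, symmetric])
qed

lemma square_mod_8: "(x::int)\<^sup>2 mod 8 \<in> {0, 1, 4}"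
proof -
  have "x mod 8 = 0 \<or> x mod 8 = 1 \<or> x mod 8 = 2 \<or> x mod 8 = 3 \<or> x mod 8 = 4 \<or> x mod 8 = 5 \<or> x mod 8 = 6 \<or> x mod 8 = 7" by presburger
  thus ?thesis by (elim disjE) (simp_all add: power_mod[of x 8 2, symmetric])
qed

lemma prime_3_int: "prime (3::int)" by simp

lemma not_3_dvd_both:
  fixes x y :: int
  assumes "coprime x y" shows "\<not> (3 dvd x \<and> 3 dvd y)"
proof
  assume "3 dvd x \<and> 3 dvd y"
  hence "is_unit (3::int)" using coprime_common_divisor[OF assms] by blast
  thus False by simp
qed

section \<open>The four primes and their mutual residue symbols\<close>

locale prime_constellation =
  fixes p :: int
  assumes p: "prime p" and h: "prime (p + 2)" and l: "prime (p - 4)" and q: "prime (p - 6)"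
    and p8: "p mod 8 = 1"
begin

lemma p_gt: "p > 8"
  using prime_gt_1_int[OF q] p8 by presburger

lemma p3: "p mod 3 = 2"
proof -
  have "\<not> 3 dvd p" using primes_dvd_imp_eq[of 3 p] p p_gt by auto
  moreover have "\<not> 3 dvd p + 2" using primes_dvd_imp_eq[of 3 "p + 2"] h p_gt by auto
  ultimately show ?thesis by presburger
qed

text \<open>Excludes p = 9, for which p - 6 would be the prime 3.\<close>

lemma p_gt': "p > 16"
proof (rule ccontr)
  assume "\<not> p > 16"
  hence "p = 9" using p_gt p8 by presburger
  thus False using p3 by simp
qed

text \<open>The last two facts say 2 (p - 4) = 2 (p + 2) = -1 modulo 3. They turn descent quartics
  into sums of two squares modulo 3.\<close>

lemma not_3_dvd: "\<not> 3 dvd p" "\<not> 3 dvd (2::int)" "\<not> 3 dvd p - 6" "\<not> 3 dvd p + 2" "3 dvd 2 * (p - 4) + 1" "3 dvd 2 * (p + 2) + 1"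
proof -
  define m where "m = p div 3"
  have m: "p = 3 * m + 2" using p3 div_mult_mod_eq[of p 3] by (simp add: m_def)
  show "\<not> 3 dvd p" "\<not> 3 dvd (2::int)" "\<not> 3 dvd p - 6" "\<not> 3 dvd p + 2" "3 dvd 2 * (p - 4) + 1" "3 dvd 2 * (p + 2) + 1"
    unfolding m by presburger+
qed

lemma residues_mod:
  "(p + 2) mod 8 = 3" "(p - 4) mod 8 = 5" "(p - 6) mod 8 = 3"
  "(p + 2) mod 4 = 3" "(p - 4) mod 4 = 1" "(p - 6) mod 4 = 3" "p mod 4 = 1"
  "(p + 2) mod 3 = 1" "(p - 4) mod 3 = 1" "(p - 6) mod 3 = 2"
proof -
  define k where "k = p div 8"
  have k: "p = 8 * k + 1" using p8 div_mult_mod_eq[of p 8] by (simp add: k_def)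
  define m where "m = p div 3"
  have m: "p = 3 * m + 2" using p3 div_mult_mod_eq[of p 3] by (simp add: m_def)
  show "(p + 2) mod 8 = 3" "(p - 4) mod 8 = 5" "(p - 6) mod 8 = 3"
    "(p + 2) mod 4 = 3" "(p - 4) mod 4 = 1" "(p - 6) mod 4 = 3" "p mod 4 = 1"
    unfolding k by presburger+
  show "(p + 2) mod 3 = 1" "(p - 4) mod 3 = 1" "(p - 6) mod 3 = 2"
    unfolding m by presburger+
qed

text \<open>Modulo one of the four primes the others are small constants (modulo p + 2, for
  instance, p is -2 and p - 4 is -6). All symbols needed thus reduce to those of -1, 2 and 3, which
  are fixed by p = 17 modulo 24.\<close>

lemma Legendre_at_h:
  "Legendre (-1) (p + 2) = -1" "Legendre 2 (p + 2) = -1" "Legendre 3 (p + 2) = -1"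
  "Legendre p (p + 2) = 1" "Legendre (p - 4) (p + 2) = -1"
proof -
  have g: "p + 2 > 2" "p + 2 > 3" using p_gt by auto
  note M = Legendre_mult[OF h g(1)]
  show 1: "Legendre (-1) (p + 2) = -1" using Legendre_minus_one[OF h g(1), unfolded residues_mod p8 p3] by simp
  show 2: "Legendre 2 (p + 2) = -1" using Legendre_two[OF h g(1), unfolded residues_mod p8 p3] by simp
  have m3: "Legendre (-3) (p + 2) = 1" using Legendre_minus_three[OF h g(2), unfolded residues_mod p8 p3] by simp
  show "Legendre 3 (p + 2) = -1" using M[of "-1" "-3"] 1 m3 by simp
  have "Legendre p (p + 2) = Legendre (-1 * 2) (p + 2)"
    by (intro Legendre_cong, unfold cong_iff_dvd_diff, intro dvdI[of _ _ 1]) simp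
  thus "Legendre p (p + 2) = 1" unfolding M 1 2 by simp
  have "Legendre (p - 4) (p + 2) = Legendre (-3 * 2) (p + 2)"
    by (intro Legendre_cong, unfold cong_iff_dvd_diff, intro dvdI[of _ _ 1]) simp
  thus "Legendre (p - 4) (p + 2) = -1" unfolding M m3 2 by simp
qed

lemma Legendre_at_q:
  "Legendre (-1) (p - 6) = -1" "Legendre 2 (p - 6) = -1" "Legendre 3 (p - 6) = 1"
  "Legendre p (p - 6) = -1" "Legendre (p - 4) (p - 6) = -1"
proof -
  have g: "p - 6 > 2" "p - 6 > 3" using p_gt' by auto
  note M = Legendre_mult[OF q g(1)]
  show 1: "Legendre (-1) (p - 6) = -1" using Legendre_minus_one[OF q g(1), unfolded residues_mod p8 p3] by simp
  show 2: "Legendre 2 (p - 6) = -1" using Legendre_two[OF q g(1), unfolded residues_mod p8 p3] by simp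
  have "Legendre (-3) (p - 6) = -1" using Legendre_minus_three[OF q g(2), unfolded residues_mod p8 p3] by simp
  thus 3: "Legendre 3 (p - 6) = 1" using M[of "-1" "-3"] 1 by simp
  have "Legendre p (p - 6) = Legendre (3 * 2) (p - 6)"
    by (intro Legendre_cong, unfold cong_iff_dvd_diff, intro dvdI[of _ _ 1]) simp
  thus "Legendre p (p - 6) = -1" unfolding M 3 2 by simp
  have "Legendre (p - 4) (p - 6) = Legendre 2 (p - 6)"
    by (intro Legendre_cong, unfold cong_iff_dvd_diff, intro dvdI[of _ _ 1]) simp
  thus "Legendre (p - 4) (p - 6) = -1" unfolding 2 by simp
qed

lemma Legendre_at_l:
  "Legendre (-1) (p - 4) = 1" "Legendre 2 (p - 4) = -1" "Legendre 3 (p - 4) = 1"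
  "Legendre (p + 2) (p - 4) = -1" "Legendre (p - 6) (p - 4) = -1"
proof -
  have g: "p - 4 > 2" "p - 4 > 3" using p_gt by auto
  note M = Legendre_mult[OF l g(1)]
  show 1: "Legendre (-1) (p - 4) = 1" using Legendre_minus_one[OF l g(1), unfolded residues_mod p8 p3] by simp
  show 2: "Legendre 2 (p - 4) = -1" using Legendre_two[OF l g(1), unfolded residues_mod p8 p3] by simp
  have "Legendre (-3) (p - 4) = 1" using Legendre_minus_three[OF l g(2), unfolded residues_mod p8 p3] by simp
  thus 3: "Legendre 3 (p - 4) = 1" using M[of "-1" "-3"] 1 by simp
  have "Legendre (p + 2) (p - 4) = Legendre (3 * 2) (p - 4)"
    by (intro Legendre_cong, unfold cong_iff_dvd_diff, intro dvdI[of _ _ 1]) simp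
  thus "Legendre (p + 2) (p - 4) = -1" unfolding M 3 2 by simp
  have "Legendre (p - 6) (p - 4) = Legendre (-1 * 2) (p - 4)"
    by (intro Legendre_cong, unfold cong_iff_dvd_diff, intro dvdI[of _ _ 1]) simp
  thus "Legendre (p - 6) (p - 4) = -1" unfolding M 1 2 by simp
qed

lemma Legendre_at_p:
  "Legendre (-1) p = 1" "Legendre 2 p = 1" "Legendre 3 p = -1"
  "Legendre (p + 2) p = 1" "Legendre (p - 6) p = -1"
proof -
  have g: "p > 2" "p > 3" using p_gt by auto
  note M = Legendre_mult[OF p g(1)]
  show 1: "Legendre (-1) p = 1" using Legendre_minus_one[OF p g(1), unfolded residues_mod p8 p3] by simp
  show 2: "Legendre 2 p = 1" using Legendre_two[OF p g(1), unfolded residues_mod p8 p3] by simp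
  have m3: "Legendre (-3) p = -1" using Legendre_minus_three[OF p g(2), unfolded residues_mod p8 p3] by simp
  thus 3: "Legendre 3 p = -1" using M[of "-1" "-3"] 1 by simp
  have "Legendre (p + 2) p = Legendre 2 p"
    by (intro Legendre_cong, unfold cong_iff_dvd_diff, intro dvdI[of _ _ 1]) simp
  thus "Legendre (p + 2) p = 1" unfolding 2 by simp
  have "Legendre (p - 6) p = Legendre (-3 * 2) p"
    by (intro Legendre_cong, unfold cong_iff_dvd_diff, intro dvdI[of _ _ 1]) simp
  thus "Legendre (p - 6) p = -1" unfolding M m3 2 by simp
qed

lemma distinct_primes:
  assumes "prime (x::int)"
  shows "x dvd 2 \<longleftrightarrow> x = 2" "x dvd 3 \<longleftrightarrow> x = 3" "x dvd p \<longleftrightarrow> x = p"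
    "x dvd p + 2 \<longleftrightarrow> x = p + 2" "x dvd p - 4 \<longleftrightarrow> x = p - 4" "x dvd p - 6 \<longleftrightarrow> x = p - 6"
proof -
  have "x dvd y \<longleftrightarrow> x = y" if "prime y" for y
    using primes_dvd_imp_eq[OF assms that] by auto
  thus "x dvd 2 \<longleftrightarrow> x = 2" "x dvd 3 \<longleftrightarrow> x = 3" "x dvd p \<longleftrightarrow> x = p"
    "x dvd p + 2 \<longleftrightarrow> x = p + 2" "x dvd p - 4 \<longleftrightarrow> x = p - 4" "x dvd p - 6 \<longleftrightarrow> x = p - 6"
    using p h l q by simp_all
qed

section \<open>The curve \<open>E\<close> and the descents by its 2-isogeny and the dual one\<close>

definition a :: int where "a = 3 * (12 - p\<^sup>2)"
definition b :: int where "b = 3 * p ^ 3 * (p - 4)"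

lemma disc: "4 * b = a\<^sup>2 + 3 * (p + 2) * (p - 6) ^ 3"
  unfolding a_def b_def by (simp add: algebra_simps power2_eq_square power3_eq_cube)

lemma b_pos: "b > 0" using p_gt by (simp add: b_def)

lemma a_mod_8: "[a = 1] (mod 8)"
proof -
  have "odd p" using p8 by presburger
  hence "[a = 3 * (12 - 1)] (mod 8)"
    unfolding a_def by (intro cong_mult cong_diff cong_refl square_mod_8_odd)
  thus ?thesis by (simp add: cong_def)
qed

lemma p_mod_8: "[p = 1] (mod 8)" "[p + 2 = 3] (mod 8)" "[p - 4 = 5] (mod 8)" "[p - 6 = 3] (mod 8)"
  unfolding cong_def p8 residues_mod by simp_all

lemma b_mod_8: "[b = 7] (mod 8)"
proof -
  have "[b = 3 * 1 ^ 3 * 5] (mod 8)"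
    unfolding b_def by (intro cong_mult cong_pow cong_refl p_mod_8)
  thus ?thesis by (simp add: cong_def)
qed

text \<open>Modulo 8 the right side is 7 if u is odd. If u = 2 k, a factor 4 cancels and the
  quotient is 4 k^4 + 2 k^2 + 7, which is 5 or 7 modulo 8. Neither is a square.\<close>

lemma no_odd_point:
  fixes u v N :: int
  assumes eq: "N\<^sup>2 = u ^ 4 + 2 * a * u\<^sup>2 * v\<^sup>2 + 4 * b * v ^ 4" and v: "odd v"
  shows False
proof -
  have v2: "[v\<^sup>2 = 1] (mod 8)" using square_mod_8_odd[OF v] .
  have v4: "[v ^ 4 = 1] (mod 8)" using cong_pow[OF v2, of 2] by simp
  show False
  proof (cases "odd u")
    case True
    have u2: "[u\<^sup>2 = 1] (mod 8)" using square_mod_8_odd[OF True] .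
    have u4: "[u ^ 4 = 1] (mod 8)" using cong_pow[OF u2, of 2] by simp
    have "[N\<^sup>2 = 1 + 2 * 1 * 1 * 1 + 4 * 7 * 1] (mod 8)"
      unfolding eq by (intro cong_add cong_mult cong_refl u2 u4 v2 v4 a_mod_8 b_mod_8)
    thus False using square_mod_8[of N] by (auto simp: cong_def)
  next
    case False
    then obtain k where k: "u = 2 * k" by (auto elim: evenE)
    have "even (N\<^sup>2)" unfolding eq k by simp
    then obtain M where M: "N = 2 * M" by (auto elim: evenE)
    have M2: "M\<^sup>2 = 4 * (k\<^sup>2)\<^sup>2 + 2 * a * k\<^sup>2 * v\<^sup>2 + b * v ^ 4"
      using eq unfolding k M by (simp add: power_mult_distrib)
    have "[M\<^sup>2 = 4 * (k\<^sup>2)\<^sup>2 + 2 * 1 * k\<^sup>2 * 1 + 7 * 1] (mod 8)"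
      unfolding M2 by (intro cong_add cong_mult cong_refl v2 v4 a_mod_8 b_mod_8)
    hence *: "[M\<^sup>2 = 4 * (k\<^sup>2)\<^sup>2 + 2 * k\<^sup>2 + 7] (mod 8)" by (simp only: mult_1_right)
    define j where "j = k\<^sup>2 mod 8"
    have "[k\<^sup>2 = j] (mod 8)" by (simp add: j_def cong_def)
    hence "[4 * (k\<^sup>2)\<^sup>2 + 2 * k\<^sup>2 + 7 = 4 * j\<^sup>2 + 2 * j + 7] (mod 8)"
      by (intro cong_add cong_mult cong_pow cong_refl)
    with * have "[M\<^sup>2 = 4 * j\<^sup>2 + 2 * j + 7] (mod 8)" by (rule cong_trans)
    moreover have "j \<in> {0, 1, 4}" unfolding j_def by (rule square_mod_8)
    ultimately show False using square_mod_8[of M] by (elim insertE emptyE) (simp_all add: cong_def)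
  qed
qed

text \<open>By \<open>disc\<close> the quadratic factor is a square plus a positive number, so the
  class d is positive, and the odd exponents of p + 2 and p - 6 in that number make d a residue at
  both. The second alternative is the class of 4 b, the image of the torsion point (0, 0).\<close>

lemma two_isogeny_image:
  fixes \<xi> \<eta> :: rat
  assumes eq: "\<eta>\<^sup>2 = \<xi> * (\<xi>\<^sup>2 + of_int (2 * a) * \<xi> + of_int (4 * b))" and \<xi>: "\<xi> \<noteq> 0"
  shows "\<exists>\<rho>. \<xi> = \<rho>\<^sup>2 \<or> of_int (4 * b) / \<xi> = \<rho>\<^sup>2"
proof -
  have K: "d\<^sup>2 + 2 * a * d * e + 4 * b * e\<^sup>2 = (d + a * e)\<^sup>2 + 3 * (p + 2) * (p - 6)^3 * e\<^sup>2" for d e :: int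
  proof -
    have "4 * b * e\<^sup>2 = a\<^sup>2 * e\<^sup>2 + 3 * (p + 2) * (p - 6)^3 * e\<^sup>2"
      unfolding disc by (rule distrib_right)
    moreover have "(d + a * e)\<^sup>2 = d\<^sup>2 + 2 * a * d * e + a\<^sup>2 * e\<^sup>2"
      by (simp add: power2_eq_square algebra_simps)
    ultimately show ?thesis by linarith
  qed
  have q3: "(p - 6) ^ 3 > 0" using p_gt by simp
  have "\<xi>\<^sup>2 + of_int (2 * a) * \<xi> + of_int (4 * b) = (\<xi> + of_int a)\<^sup>2 + of_int (3 * (p + 2) * (p - 6)^3)"
  proof -
    have "of_int (4 * b) = (of_int (a\<^sup>2 + 3 * (p + 2) * (p - 6)^3) :: rat)"
      unfolding disc ..
    also have "\<dots> = (of_int a)\<^sup>2 + of_int (3 * (p + 2) * (p - 6)^3)"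
      by (simp only: of_int_add of_int_power)
    moreover have "(\<xi> + of_int a)\<^sup>2 = \<xi>\<^sup>2 + of_int (2 * a) * \<xi> + (of_int a)\<^sup>2"
      by (simp add: power2_eq_square algebra_simps)
    ultimately show ?thesis by linarith
  qed
  moreover have "of_int (3 * (p + 2) * (p - 6)^3) > (0::rat)"
    unfolding of_int_0_less_iff using q3 p_gt by simp
  ultimately have pos: "\<xi>\<^sup>2 + of_int (2 * a) * \<xi> + of_int (4 * b) > 0"
    by (metis add_nonneg_pos zero_le_power2)
  obtain d r s N where d: "squarefree d" and x: "\<xi> = of_int d * (of_int r / of_int s)\<^sup>2"
    and s: "s \<noteq> 0" and r: "r \<noteq> 0" and cop: "coprime (d * r) s"
    and N: "d * N\<^sup>2 = (d * r\<^sup>2)\<^sup>2 + (2 * a) * (d * r\<^sup>2) * s\<^sup>2 + (4 * b) * s ^ 4"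
    and dB: "\<And>x. prime x \<Longrightarrow> x dvd d \<Longrightarrow> x dvd 4 * b"
    using two_isogeny_descent[OF eq \<xi>] pos by (metis less_irrefl)
  have N': "d * N\<^sup>2 = (d * r\<^sup>2 + a * s\<^sup>2)\<^sup>2 + 3 * (p + 2) * (p - 6)^3 * s ^ 4"
    using K[of "d * r\<^sup>2" "s\<^sup>2"] N by simp
  have "0 < 3 * (p + 2) * (p - 6)^3 * s ^ 4" using q3 p_gt s by simp
  hence "d * N\<^sup>2 > 0" unfolding N' by (intro add_nonneg_pos) auto
  hence dpos: "d > 0" by (simp add: zero_less_mult_iff)
  have dp: "x \<in> {2, 3, p, p - 4}" if "prime x" "x dvd d" for x
  proof -
    have "x dvd 2 * (2 * (3 * (p ^ 3 * (p - 4))))"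
      using dB[OF that] by (simp add: b_def mult.assoc)
    hence "x dvd 2 \<or> x dvd 3 \<or> x dvd p \<or> x dvd p - 4"
      using that(1) by (metis prime_dvd_mult_iff prime_dvd_power)
    thus ?thesis using distinct_primes[OF that(1)] by auto
  qed
  have Lh: "Legendre d (p + 2) = 1"
  proof (rule residue_of_form_odd_valuation[OF h _ _ cop])
    show "\<not> p + 2 dvd d" using dp[OF h] p_gt by auto
    show "\<not> p + 2 dvd 3 * (p - 6)^3"
    proof
      assume "p + 2 dvd 3 * (p - 6)^3"
      hence "p + 2 dvd 3 \<or> p + 2 dvd p - 6" using h by (metis prime_dvd_mult_iff prime_dvd_power)
      thus False using distinct_primes[OF h] p_gt by auto
    qed
    show "d * N\<^sup>2 = (d * r\<^sup>2 + a * s\<^sup>2)\<^sup>2 + (p + 2) ^ (2 * 0 + 1) * (3 * (p - 6)^3) * s ^ 4"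
      unfolding N' by (simp only: mult_ac mult_0 power_one_right add_0)
    show "p + 2 > 2" using p_gt by simp
  qed
  have Lq: "Legendre d (p - 6) = 1"
  proof (rule residue_of_form_odd_valuation[OF q _ _ cop])
    show "\<not> p - 6 dvd d" using dp[OF q] p_gt' by auto
    show "\<not> p - 6 dvd 3 * (p + 2)"
    proof
      assume "p - 6 dvd 3 * (p + 2)"
      hence "p - 6 dvd 3 \<or> p - 6 dvd p + 2" using q by (metis prime_dvd_mult_iff)
      thus False using distinct_primes[OF q] p_gt' by auto
    qed
    have "2 * 1 + 1 = (3::nat)" by simp
    thus "d * N\<^sup>2 = (d * r\<^sup>2 + a * s\<^sup>2)\<^sup>2 + (p - 6) ^ (2 * 1 + 1) * (3 * (p + 2)) * s ^ 4"
      unfolding N' by (simp only: mult_ac)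
    show "p - 6 > 2" using p_gt by simp
  qed
  obtain e1 d1 where 1: "e1 \<in> {1, 2}" "d = e1 * d1" "squarefree d1" "\<not> 2 dvd d1"
    by (rule squarefree_peel_prime[OF d, of 2]) auto
  obtain e2 d2 where 2: "e2 \<in> {1, 3}" "d1 = e2 * d2" "squarefree d2" "\<not> 3 dvd d2"
    by (rule squarefree_peel_prime[OF 1(3), of 3]) auto
  obtain e3 d3 where 3: "e3 \<in> {1, p}" "d2 = e3 * d3" "squarefree d3" "\<not> p dvd d3"
    by (rule squarefree_peel_prime[OF 2(3) p]) auto
  obtain e4 d4 where 4: "e4 \<in> {1, p - 4}" "d3 = e4 * d4" "squarefree d4" "\<not> p - 4 dvd d4"
    by (rule squarefree_peel_prime[OF 3(3) l]) auto
  have "d4 \<in> {1, -1}"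
  proof (rule int_unit_of_no_prime_divisor, rule notI)
    fix x :: int assume x: "prime x" "x dvd d4"
    hence "x dvd d" "x dvd d1" "x dvd d2" "x dvd d3" using 1 2 3 4 by auto
    thus False using dp[OF x(1)] x(2) 1(4) 2(4) 3(4) 4(4) by auto
  qed
  moreover have "d4 > 0"
  proof -
    have "e1 > 0" "e2 > 0" "e3 > 0" "e4 > 0" using 1(1) 2(1) 3(1) 4(1) p_gt by auto
    thus ?thesis using dpos unfolding 1(2) 2(2) 3(2) 4(2) by (simp add: zero_less_mult_iff)
  qed
  ultimately have de: "d = e1 * e2 * e3 * e4" using 1 2 3 4 by auto
  have g: "p + 2 > 2" "p - 6 > 2" using p_gt by auto
  have one: "Legendre 1 x = 1" if "prime x" for x
    using Legendre_square[OF that, of 1] not_prime_unit that by auto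
  note vals = Legendre_at_h Legendre_at_q one[OF h] one[OF q]
  have "Legendre e1 (p + 2) * Legendre e2 (p + 2) * Legendre e3 (p + 2) * Legendre e4 (p + 2) = 1"
    using Lh unfolding de Legendre_mult[OF h g(1)] .
  moreover have "Legendre e1 (p - 6) * Legendre e2 (p - 6) * Legendre e3 (p - 6) * Legendre e4 (p - 6) = 1"
    using Lq unfolding de Legendre_mult[OF q g(2)] .
  ultimately have "(e1, e2, e3, e4) \<in> {(1, 1, 1, 1), (2, 3, p, 1), (1, 3, p, p - 4), (2, 1, 1, p - 4)}"
    using 1(1) 2(1) 3(1) 4(1) by (elim insertE emptyE; hypsubst) (simp_all add: vals)
  hence "d \<in> {1, 6 * p, 3 * p * (p - 4), 2 * (p - 4)}" unfolding de by auto
  \<comment> \<open>After division by 6 p the quartic reads N^2 = - (p s^2)^2 modulo 3, because 3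
    divides a and 2 (p - 4) = -1. So 3 divides s as well as d.\<close>
  moreover have "d \<noteq> 6 * p"
  proof
    assume d6: "d = 6 * p"
    have "(6 * p) * N\<^sup>2 = (6 * p) * (6 * p * r ^ 4 + 2 * a * r\<^sup>2 * s\<^sup>2 + 2 * p\<^sup>2 * (p - 4) * s ^ 4)"
      using N unfolding d6 b_def by (simp add: algebra_simps power2_eq_square power3_eq_cube power4_eq_xxxx)
    hence "N\<^sup>2 = 6 * p * r ^ 4 + 2 * a * r\<^sup>2 * s\<^sup>2 + 2 * p\<^sup>2 * (p - 4) * s ^ 4"
      using p_gt by (subst (asm) mult_cancel_left) auto
    hence "N\<^sup>2 + (p * s\<^sup>2)\<^sup>2 = 3 * (2 * p * r ^ 4 + 2 * (12 - p\<^sup>2) * r\<^sup>2 * s\<^sup>2) + (2 * (p - 4) + 1) * (p\<^sup>2 * s ^ 4)"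
      by (simp add: a_def algebra_simps power2_eq_square power4_eq_xxxx)
    moreover have "3 dvd 2 * (p - 4) + 1" by (rule not_3_dvd)
    ultimately have "3 dvd N\<^sup>2 + (p * s\<^sup>2)\<^sup>2" by (simp only: dvd_add dvd_triv_left dvd_mult2)
    hence "3 dvd p * s\<^sup>2" by (rule three_dvd_sum_two_squares)
    hence "3 dvd s" using not_3_dvd(1) by (metis prime_dvd_mult_iff prime_dvd_power prime_3_int)
    moreover have "3 dvd d * r" unfolding d6 by simp
    ultimately show False using not_3_dvd_both[OF cop] by blast
  qed
  \<comment> \<open>Now N^2 + r^4 = 0 modulo 3 makes N and r divisible by 3, and the equation modulo
    9 then does the same for s.\<close>
  moreover have "d \<noteq> 2 * (p - 4)"
  proof
    assume d6: "d = 2 * (p - 4)"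
    have "(2 * (p - 4)) * N\<^sup>2 = (2 * (p - 4)) * (2 * (p - 4) * r ^ 4 + 2 * a * r\<^sup>2 * s\<^sup>2 + 6 * p ^ 3 * s ^ 4)"
      using N unfolding d6 b_def by (simp add: algebra_simps power2_eq_square power3_eq_cube power4_eq_xxxx)
    hence N2: "N\<^sup>2 = 2 * (p - 4) * r ^ 4 + 2 * a * r\<^sup>2 * s\<^sup>2 + 6 * p ^ 3 * s ^ 4"
      using p_gt by (subst (asm) mult_cancel_left) auto
    hence "N\<^sup>2 + (r\<^sup>2)\<^sup>2 = 3 * (2 * (12 - p\<^sup>2) * r\<^sup>2 * s\<^sup>2 + 2 * p ^ 3 * s ^ 4) + (2 * (p - 4) + 1) * r ^ 4"
      by (simp add: a_def algebra_simps power2_eq_square power4_eq_xxxx)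
    moreover have "3 dvd 2 * (p - 4) + 1" by (rule not_3_dvd)
    ultimately have *: "3 dvd N\<^sup>2 + (r\<^sup>2)\<^sup>2" by (simp only: dvd_add dvd_triv_left dvd_mult2)
    hence "3 dvd N" by (rule three_dvd_sum_two_squares)
    from * have "3 dvd r\<^sup>2" by (rule three_dvd_sum_two_squares)
    hence "3 dvd r" by (rule prime_dvd_power[OF prime_3_int])
    with \<open>3 dvd N\<close> obtain n m where nm: "N = 3 * n" "r = 3 * m" by (auto elim!: dvdE)
    have "3 * (2 * p ^ 3 * s ^ 4) = 3 * (3 * (n\<^sup>2 - 18 * (p - 4) * m ^ 4 - 6 * (12 - p\<^sup>2) * m\<^sup>2 * s\<^sup>2))"
      using N2 unfolding nm a_def by (simp add: algebra_simps power2_eq_square power4_eq_xxxx)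
    hence "2 * p ^ 3 * s ^ 4 = 3 * (n\<^sup>2 - 18 * (p - 4) * m ^ 4 - 6 * (12 - p\<^sup>2) * m\<^sup>2 * s\<^sup>2)" by linarith
    hence "3 dvd 2 * p ^ 3 * s ^ 4" by (rule dvdI)
    hence "3 dvd s" using not_3_dvd(1,2) by (metis prime_dvd_mult_iff prime_dvd_power prime_3_int)
    moreover have "3 dvd d * r" unfolding nm by simp
    ultimately show False using not_3_dvd_both[OF cop] by blast
  qed
  ultimately consider "d = 1" | "d = 3 * p * (p - 4)" by auto
  thus ?thesis
  proof cases
    case 1 thus ?thesis using x by auto
  next
    case 2
    have "of_int (4 * b) / \<xi> = (2 * of_int p * of_int s / of_int r)\<^sup>2"
    proof -
      have "p - 4 \<noteq> 0" "p \<noteq> 0" using p_gt by auto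
      hence "of_int p \<noteq> (0::rat)" "of_int (p - 4) \<noteq> (0::rat)" by (simp_all only: of_int_eq_0_iff not_False_eq_True)
      moreover have "\<xi> = 3 * of_int p * of_int (p - 4) * (of_int r / of_int s)\<^sup>2"
        unfolding x 2 by (simp only: of_int_mult of_int_numeral)
      moreover have "of_int (4 * b) = (12 * of_int p ^ 3 * of_int (p - 4) :: rat)"
        unfolding b_def by (simp only: of_int_mult of_int_numeral of_int_power)
      ultimately show ?thesis using r s by (simp only: power_divide power_mult_distrib) (simp add: field_simps power2_eq_square power3_eq_cube)
    qed
    thus ?thesis by blast
  qed
qed

end

context prime_constellation
begin

text \<open>Both r and s are odd, so halving the equation gives 2 M^2 = \<alpha> + \<beta> - 2 = 4
  modulo 8, that is M^2 = 2 modulo 4. This disposes of the classes -2 (p + 2) and 6 (p - 6) in the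
  dual descent.\<close>

lemma no_two_adic_solution:
  fixes \<alpha> \<beta> r s N :: int
  assumes eq: "N\<^sup>2 = 2 * \<alpha> * r ^ 4 - 4 * a * r\<^sup>2 * s\<^sup>2 + 2 * \<beta> * s ^ 4"
    and ab: "[\<alpha> + \<beta> = 6] (mod 8)" "odd \<beta>" and s: "odd s"
  shows False
proof -
  have "even (N\<^sup>2)" unfolding eq by simp
  then obtain M where M: "N = 2 * M" by (auto elim: evenE)
  have M2: "2 * M\<^sup>2 = \<alpha> * r ^ 4 - 2 * a * r\<^sup>2 * s\<^sup>2 + \<beta> * s ^ 4"
    using eq unfolding M by (simp add: power_mult_distrib)
  have "odd r"
  proof
    assume "even r"
    hence "odd (\<alpha> * r ^ 4 - 2 * a * r\<^sup>2 * s\<^sup>2 + \<beta> * s ^ 4)" using ab s by simp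
    thus False unfolding M2[symmetric] by simp
  qed
  hence r2: "[r\<^sup>2 = 1] (mod 8)" by (rule square_mod_8_odd)
  have s2: "[s\<^sup>2 = 1] (mod 8)" using s by (rule square_mod_8_odd)
  have r4: "[r ^ 4 = 1] (mod 8)" using cong_pow[OF r2, of 2] by simp
  have s4: "[s ^ 4 = 1] (mod 8)" using cong_pow[OF s2, of 2] by simp
  have "[2 * M\<^sup>2 = \<alpha> * 1 - 2 * 1 * 1 * 1 + \<beta> * 1] (mod 8)"
    unfolding M2 by (intro cong_add cong_diff cong_mult cong_refl r2 r4 s2 s4 a_mod_8)
  hence "[2 * M\<^sup>2 = (\<alpha> + \<beta>) - 2] (mod 8)" by (simp add: algebra_simps)
  also have "[(\<alpha> + \<beta>) - 2 = 6 - 2] (mod 8)" by (intro cong_diff cong_refl ab)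
  finally have "(2 * M\<^sup>2) mod 8 = 4" by (simp add: cong_def)
  hence "M\<^sup>2 mod 4 = 2" by presburger
  moreover have "M\<^sup>2 mod 4 = (M\<^sup>2 mod 8) mod 4" by (simp add: mod_mod_cancel)
  ultimately show False using square_mod_8[of M] by auto
qed

text \<open>The dual curve has coefficients -4 a and 4 (a^2 - 4 b). Completing its square leaves -16
  b, in which p - 4 and p have odd exponents, so d is a residue at both. Eight classes pass this
  test; 1 and the class of the constant term, again the image of (0, 0), are the two that remain
  after excluding six at 2 or 3.\<close>

lemma dual_two_isogeny_image:
  fixes \<xi> \<eta> :: rat
  assumes eq: "\<eta>\<^sup>2 = \<xi> * (\<xi>\<^sup>2 + of_int (- 4 * a) * \<xi> + of_int (- 12 * (p + 2) * (p - 6) ^ 3))"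
    and \<eta>: "\<eta> \<noteq> 0"
  shows "\<exists>\<tau>. \<xi> = \<tau>\<^sup>2 \<or> of_int (- 12 * (p + 2) * (p - 6) ^ 3) / \<xi> = \<tau>\<^sup>2"
proof -
  have \<xi>: "\<xi> \<noteq> 0" and K0: "\<xi>\<^sup>2 + of_int (- 4 * a) * \<xi> + of_int (- 12 * (p + 2) * (p - 6) ^ 3) \<noteq> 0"
    using eq \<eta> by auto
  obtain d r s N where d: "squarefree d" and x: "\<xi> = of_int d * (of_int r / of_int s)\<^sup>2"
    and s: "s \<noteq> 0" and r: "r \<noteq> 0" and cop: "coprime (d * r) s"
    and N: "d * N\<^sup>2 = (d * r\<^sup>2)\<^sup>2 + (- 4 * a) * (d * r\<^sup>2) * s\<^sup>2 + (- 12 * (p + 2) * (p - 6) ^ 3) * s ^ 4"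
    and dB: "\<And>x. prime x \<Longrightarrow> x dvd d \<Longrightarrow> x dvd - 12 * (p + 2) * (p - 6) ^ 3"
    using two_isogeny_descent[OF eq \<xi> K0] by metis
  have "(d * r\<^sup>2)\<^sup>2 + (- 4 * a) * (d * r\<^sup>2) * s\<^sup>2 + (- 12 * (p + 2) * (p - 6) ^ 3) * s ^ 4
      = (d * r\<^sup>2 + (- 2 * a) * s\<^sup>2)\<^sup>2 - 4 * (a\<^sup>2 + 3 * (p + 2) * (p - 6) ^ 3) * s ^ 4"
    by (simp add: power2_eq_square power4_eq_xxxx algebra_simps)
  hence N': "d * N\<^sup>2 = (d * r\<^sup>2 + (- 2 * a) * s\<^sup>2)\<^sup>2 - 4 * (4 * b) * s ^ 4"
    unfolding N disc .
  have dp: "x \<in> {2, 3, p + 2, p - 6}" if "prime x" "x dvd d" for x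
  proof -
    have "- 12 * (p + 2) * (p - 6) ^ 3 = - (2 * (2 * (3 * ((p + 2) * (p - 6) ^ 3))))"
      by (simp add: algebra_simps)
    hence "x dvd 2 * (2 * (3 * ((p + 2) * (p - 6) ^ 3)))"
      using dB[OF that] by (simp only: dvd_minus_iff)
    hence "x dvd 2 \<or> x dvd 3 \<or> x dvd p + 2 \<or> x dvd p - 6"
      using that(1) by (metis prime_dvd_mult_iff prime_dvd_power)
    thus ?thesis using distinct_primes[OF that(1)] by auto
  qed
  have b2: "x dvd 2 \<or> x dvd 3 \<or> x dvd y" if "x dvd - 48 * y" "prime x" for x y :: int
  proof -
    have "x dvd 2 * (2 * (2 * (2 * (3 * y))))" using that(1) by simp
    thus ?thesis using that(2) by (metis prime_dvd_mult_iff)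
  qed
  have Ll: "Legendre d (p - 4) = 1"
  proof (rule residue_of_form_odd_valuation[OF l _ _ cop])
    show "\<not> p - 4 dvd d" using dp[OF l] p_gt' by auto
    show "\<not> p - 4 dvd - 48 * p ^ 3"
    proof
      assume "p - 4 dvd - 48 * p ^ 3"
      from b2[OF this l] have "p - 4 dvd 2 \<or> p - 4 dvd 3 \<or> p - 4 dvd p" using l by (metis prime_dvd_power)
      thus False using distinct_primes[OF l] p_gt' by auto
    qed
    show "d * N\<^sup>2 = (d * r\<^sup>2 + (- 2 * a) * s\<^sup>2)\<^sup>2 + (p - 4) ^ (2 * 0 + 1) * (- 48 * p ^ 3) * s ^ 4"
      unfolding N' b_def by simp
    show "p - 4 > 2" using p_gt by simp
  qed
  have Lp: "Legendre d p = 1"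
  proof (rule residue_of_form_odd_valuation[OF p _ _ cop])
    show "\<not> p dvd d" using dp[OF p] p_gt' by auto
    show "\<not> p dvd - 48 * (p - 4)"
    proof
      assume "p dvd - 48 * (p - 4)"
      from b2[OF this p] show False using distinct_primes[OF p] p_gt' by auto
    qed
    have three: "2 * 1 + 1 = (3::nat)" by simp
    show "d * N\<^sup>2 = (d * r\<^sup>2 + (- 2 * a) * s\<^sup>2)\<^sup>2 + p ^ (2 * 1 + 1) * (- 48 * (p - 4)) * s ^ 4"
      unfolding N' b_def three by (simp add: algebra_simps)
    show "p > 2" using p_gt by simp
  qed
  obtain e1 d1 where 1: "e1 \<in> {1, 2}" "d = e1 * d1" "squarefree d1" "\<not> 2 dvd d1"
    by (rule squarefree_peel_prime[OF d, of 2]) auto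
  obtain e2 d2 where 2: "e2 \<in> {1, 3}" "d1 = e2 * d2" "squarefree d2" "\<not> 3 dvd d2"
    by (rule squarefree_peel_prime[OF 1(3), of 3]) auto
  obtain e3 d3 where 3: "e3 \<in> {1, p + 2}" "d2 = e3 * d3" "squarefree d3" "\<not> p + 2 dvd d3"
    by (rule squarefree_peel_prime[OF 2(3) h]) auto
  obtain e4 d4 where 4: "e4 \<in> {1, p - 6}" "d3 = e4 * d4" "squarefree d4" "\<not> p - 6 dvd d4"
    by (rule squarefree_peel_prime[OF 3(3) q]) auto
  have d4: "d4 \<in> {1, -1}"
  proof (rule int_unit_of_no_prime_divisor, rule notI)
    fix x :: int assume x: "prime x" "x dvd d4"
    hence "x dvd d" "x dvd d1" "x dvd d2" "x dvd d3" using 1 2 3 4 by auto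
    thus False using dp[OF x(1)] x(2) 1(4) 2(4) 3(4) 4(4) by auto
  qed
  have de: "d = e1 * e2 * e3 * e4 * d4" using 1 2 3 4 by auto
  have g: "p - 4 > 2" "p > 2" using p_gt by auto
  have one: "Legendre 1 x = 1" if "prime x" for x
    using Legendre_square[OF that, of 1] not_prime_unit that by auto
  note vals = Legendre_at_l Legendre_at_p one[OF l] one[OF p]
  \<comment> \<open>As -1 is a residue at p - 4 and at p, the symbols do not see the sign of
    d.\<close>
  have L4: "Legendre d4 (p - 4) = 1" "Legendre d4 p = 1" using d4 vals by auto
  have "Legendre e1 (p - 4) * Legendre e2 (p - 4) * Legendre e3 (p - 4) * Legendre e4 (p - 4) = 1"
    using Ll unfolding de Legendre_mult[OF l g(1)] L4 by (simp only: mult_1_right)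
  moreover have "Legendre e1 p * Legendre e2 p * Legendre e3 p * Legendre e4 p = 1"
    using Lp unfolding de Legendre_mult[OF p g(2)] L4 by (simp only: mult_1_right)
  ultimately have E: "(e1, e2, e3, e4) \<in> {(1, 1, 1, 1), (2, 1, p + 2, 1), (2, 3, 1, p - 6), (1, 3, p + 2, p - 6)}"
    using 1(1) 2(1) 3(1) 4(1) by (elim insertE emptyE; hypsubst) (simp_all add: vals)
  have six: "2 * 3 * x = 6 * x" for x :: int by simp
  have D: "d \<in> {1, -1, 2 * (p + 2), - 2 * (p + 2), 6 * (p - 6), - 6 * (p - 6), 3 * (p + 2) * (p - 6), - 3 * (p + 2) * (p - 6)}"
    using E d4 unfolding de
    by (elim insertE emptyE; simp only: prod.inject; elim conjE; hypsubst;
        simp only: insert_iff mult_1_left mult_1_right mult_minus_left mult_minus_right six simp_thms)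
  \<comment> \<open>For the classes -1 and 2 (p + 2), where d is prime to 3: once N and r are
    divisible by 3, the equation modulo 9 gives 3 | s.\<close>
  have N3: "3 dvd N" and r3: "3 dvd r" if "3 dvd N\<^sup>2 + (r\<^sup>2)\<^sup>2"
  proof -
    show "3 dvd N" by (rule three_dvd_sum_two_squares[OF that])
    have "3 dvd r\<^sup>2" by (rule three_dvd_sum_two_squares[OF that])
    thus "3 dvd r" by (rule prime_dvd_power[OF prime_3_int])
  qed
  have cancel: "x = y" if "c * x = c * y" "c \<noteq> 0" for c x y :: int using that by simp
  have n1: "d \<noteq> -1"
  proof
    assume d': "d = -1"
    have N2: "N\<^sup>2 = - (r ^ 4) - 4 * a * r\<^sup>2 * s\<^sup>2 + 12 * (p + 2) * (p - 6) ^ 3 * s ^ 4"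
      using N unfolding d' by (simp add: algebra_simps power2_eq_square power4_eq_xxxx)
    hence "N\<^sup>2 + (r\<^sup>2)\<^sup>2 = 3 * (4 * (p + 2) * (p - 6) ^ 3 * s ^ 4 - 4 * (12 - p\<^sup>2) * r\<^sup>2 * s\<^sup>2)"
      by (simp add: a_def algebra_simps power2_eq_square power4_eq_xxxx)
    hence "3 dvd N\<^sup>2 + (r\<^sup>2)\<^sup>2" by (rule dvdI)
    from N3[OF this] r3[OF this] obtain n m where nm: "N = 3 * n" "r = 3 * m" by (auto elim!: dvdE)
    have "3 * (2 * 2 * (p + 2) * (p - 6) ^ 3 * s ^ 4) = 3 * (3 * (n\<^sup>2 + 9 * m ^ 4 + 12 * (12 - p\<^sup>2) * m\<^sup>2 * s\<^sup>2))"
      using N2 unfolding nm a_def by (simp add: algebra_simps power2_eq_square power4_eq_xxxx)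
    hence "2 * 2 * (p + 2) * (p - 6) ^ 3 * s ^ 4 = 3 * (n\<^sup>2 + 9 * m ^ 4 + 12 * (12 - p\<^sup>2) * m\<^sup>2 * s\<^sup>2)"
      by (rule cancel) simp
    hence "3 dvd 2 * 2 * (p + 2) * (p - 6) ^ 3 * s ^ 4" by (rule dvdI)
    hence "3 dvd s" using not_3_dvd by (metis prime_dvd_mult_iff prime_dvd_power prime_3_int)
    moreover have "3 dvd d * r" unfolding nm by simp
    ultimately show False using not_3_dvd_both[OF cop] by blast
  qed
  have n2: "d \<noteq> 2 * (p + 2)"
  proof
    assume d': "d = 2 * (p + 2)"
    have "(2 * (p + 2)) * N\<^sup>2 = (2 * (p + 2)) * (2 * (p + 2) * r ^ 4 - 4 * a * r\<^sup>2 * s\<^sup>2 - 6 * (p - 6) ^ 3 * s ^ 4)"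
      unfolding N[unfolded d'] by (simp add: algebra_simps power2_eq_square power4_eq_xxxx)
    hence N2: "N\<^sup>2 = 2 * (p + 2) * r ^ 4 - 4 * a * r\<^sup>2 * s\<^sup>2 - 6 * (p - 6) ^ 3 * s ^ 4"
      by (rule cancel) (use p_gt in simp)
    hence "N\<^sup>2 + (r\<^sup>2)\<^sup>2 = 3 * (- 4 * (12 - p\<^sup>2) * r\<^sup>2 * s\<^sup>2 - 2 * (p - 6) ^ 3 * s ^ 4) + (2 * (p + 2) + 1) * r ^ 4"
      by (simp add: a_def algebra_simps power2_eq_square power4_eq_xxxx)
    hence "3 dvd N\<^sup>2 + (r\<^sup>2)\<^sup>2" by (simp only: dvd_add dvd_triv_left dvd_mult2 not_3_dvd)
    from N3[OF this] r3[OF this] obtain n m where nm: "N = 3 * n" "r = 3 * m" by (auto elim!: dvdE)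
    have "3 * (2 * (p - 6) ^ 3 * s ^ 4) = 3 * (3 * (18 * (p + 2) * m ^ 4 - n\<^sup>2 - 12 * (12 - p\<^sup>2) * m\<^sup>2 * s\<^sup>2))"
      using N2 unfolding nm a_def by (simp add: algebra_simps power2_eq_square power4_eq_xxxx)
    hence "2 * (p - 6) ^ 3 * s ^ 4 = 3 * (18 * (p + 2) * m ^ 4 - n\<^sup>2 - 12 * (12 - p\<^sup>2) * m\<^sup>2 * s\<^sup>2)"
      by (rule cancel) simp
    hence "3 dvd 2 * (p - 6) ^ 3 * s ^ 4" by (rule dvdI)
    hence "3 dvd s" using not_3_dvd by (metis prime_dvd_mult_iff prime_dvd_power prime_3_int)
    moreover have "3 dvd d * r" unfolding nm by simp
    ultimately show False using not_3_dvd_both[OF cop] by blast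
  qed
  have "odd s" if "even d"
    using that cop by (meson coprime_common_divisor dvd_mult2 odd_one)
  note odd_s = this
  have n3: "d \<noteq> - 2 * (p + 2)"
  proof
    assume d': "d = - 2 * (p + 2)"
    have "(- 2 * (p + 2)) * N\<^sup>2 = (- 2 * (p + 2)) * (2 * (- (p + 2)) * r ^ 4 - 4 * a * r\<^sup>2 * s\<^sup>2 + 2 * (3 * (p - 6) ^ 3) * s ^ 4)"
      unfolding N[unfolded d'] by (simp add: algebra_simps power2_eq_square power4_eq_xxxx)
    hence N2: "N\<^sup>2 = 2 * (- (p + 2)) * r ^ 4 - 4 * a * r\<^sup>2 * s\<^sup>2 + 2 * (3 * (p - 6) ^ 3) * s ^ 4"
      by (rule cancel) (use p_gt in simp)
    show False
    proof (rule no_two_adic_solution[OF N2])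
      have "[- (p + 2) + 3 * (p - 6) ^ 3 = - 3 + 3 * 3 ^ 3] (mod 8)"
        by (intro cong_add cong_mult cong_pow cong_refl p_mod_8 iffD2[OF cong_minus_minus_iff])
      thus "[- (p + 2) + 3 * (p - 6) ^ 3 = 6] (mod 8)" by (simp add: cong_def)
      show "odd s" by (rule odd_s) (simp add: d')
      have "odd p" using p8 by presburger
      thus "odd (3 * (p - 6) ^ 3)" by simp
    qed
  qed
  have n4: "d \<noteq> 6 * (p - 6)"
  proof
    assume d': "d = 6 * (p - 6)"
    have "(6 * (p - 6)) * N\<^sup>2 = (6 * (p - 6)) * (2 * (3 * (p - 6)) * r ^ 4 - 4 * a * r\<^sup>2 * s\<^sup>2 + 2 * (- (p + 2) * (p - 6)\<^sup>2) * s ^ 4)"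
      unfolding N[unfolded d'] by (simp add: algebra_simps power2_eq_square power3_eq_cube power4_eq_xxxx)
    hence N2: "N\<^sup>2 = 2 * (3 * (p - 6)) * r ^ 4 - 4 * a * r\<^sup>2 * s\<^sup>2 + 2 * (- (p + 2) * (p - 6)\<^sup>2) * s ^ 4"
      by (rule cancel) (use p_gt in simp)
    show False
    proof (rule no_two_adic_solution[OF N2])
      have "[3 * (p - 6) + - (p + 2) * (p - 6)\<^sup>2 = 3 * 3 + - 3 * 3\<^sup>2] (mod 8)"
        by (intro cong_add cong_mult cong_pow cong_refl p_mod_8 iffD2[OF cong_minus_minus_iff])
      thus "[3 * (p - 6) + - (p + 2) * (p - 6)\<^sup>2 = 6] (mod 8)" by (simp add: cong_def)
      show "odd s" by (rule odd_s) (simp add: d')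
      have "odd p" using p8 by presburger
      thus "odd (- (p + 2) * (p - 6)\<^sup>2)" by simp
    qed
  qed
  \<comment> \<open>For this class and the next, 3 divides d, so a contradiction is reached as soon
    as 3 | s.\<close>
  have n5: "d \<noteq> - 6 * (p - 6)"
  proof
    assume d': "d = - 6 * (p - 6)"
    have "(- 6 * (p - 6)) * N\<^sup>2 = (- 6 * (p - 6)) * (- 6 * (p - 6) * r ^ 4 - 4 * a * r\<^sup>2 * s\<^sup>2 + 2 * (p + 2) * (p - 6)\<^sup>2 * s ^ 4)"
      unfolding N[unfolded d'] by (simp add: algebra_simps power2_eq_square power3_eq_cube power4_eq_xxxx)
    hence "N\<^sup>2 = - 6 * (p - 6) * r ^ 4 - 4 * a * r\<^sup>2 * s\<^sup>2 + 2 * (p + 2) * (p - 6)\<^sup>2 * s ^ 4"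
      by (rule cancel) (use p_gt in simp)
    hence "N\<^sup>2 + ((p - 6) * s\<^sup>2)\<^sup>2 = 3 * (- 2 * (p - 6) * r ^ 4 - 4 * (12 - p\<^sup>2) * r\<^sup>2 * s\<^sup>2) + (2 * (p + 2) + 1) * ((p - 6)\<^sup>2 * s ^ 4)"
      by (simp add: a_def algebra_simps power2_eq_square power4_eq_xxxx)
    hence "3 dvd N\<^sup>2 + ((p - 6) * s\<^sup>2)\<^sup>2" by (simp only: dvd_add dvd_triv_left dvd_mult2 not_3_dvd)
    hence "3 dvd (p - 6) * s\<^sup>2" by (rule three_dvd_sum_two_squares)
    hence "3 dvd s" using not_3_dvd by (metis prime_dvd_mult_iff prime_dvd_power prime_3_int)
    moreover have "3 dvd d * r" unfolding d' by simp
    ultimately show False using not_3_dvd_both[OF cop] by blast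
  qed
  have n6: "d \<noteq> 3 * (p + 2) * (p - 6)"
  proof
    assume d': "d = 3 * (p + 2) * (p - 6)"
    have "(3 * (p + 2) * (p - 6)) * N\<^sup>2 = (3 * (p + 2) * (p - 6)) * (3 * (p + 2) * (p - 6) * r ^ 4 - 4 * a * r\<^sup>2 * s\<^sup>2 - 4 * (p - 6)\<^sup>2 * s ^ 4)"
      unfolding N[unfolded d'] by (simp add: algebra_simps power2_eq_square power3_eq_cube power4_eq_xxxx)
    hence "N\<^sup>2 = 3 * (p + 2) * (p - 6) * r ^ 4 - 4 * a * r\<^sup>2 * s\<^sup>2 - 4 * (p - 6)\<^sup>2 * s ^ 4"
      by (rule cancel) (use p_gt in simp)
    hence "N\<^sup>2 + (2 * (p - 6) * s\<^sup>2)\<^sup>2 = 3 * ((p + 2) * (p - 6) * r ^ 4 - 4 * (12 - p\<^sup>2) * r\<^sup>2 * s\<^sup>2)"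
      by (simp add: a_def algebra_simps power2_eq_square power4_eq_xxxx)
    hence "3 dvd N\<^sup>2 + (2 * (p - 6) * s\<^sup>2)\<^sup>2" by (rule dvdI)
    hence "3 dvd 2 * (p - 6) * s\<^sup>2" by (rule three_dvd_sum_two_squares)
    hence "3 dvd s" using not_3_dvd by (metis prime_dvd_mult_iff prime_dvd_power prime_3_int)
    moreover have "3 dvd d * r" unfolding d' by simp
    ultimately show False using not_3_dvd_both[OF cop] by blast
  qed
  consider "d = 1" | "d = - 3 * (p + 2) * (p - 6)" using D n1 n2 n3 n4 n5 n6 by blast
  thus ?thesis
  proof cases
    case 1 thus ?thesis using x by auto
  next
    case 2
    have "of_int (- 12 * (p + 2) * (p - 6) ^ 3) / \<xi> = (2 * of_int (p - 6) * of_int s / of_int r)\<^sup>2"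
    proof -
      have "p - 6 \<noteq> 0" "p + 2 \<noteq> 0" using p_gt by auto
      hence "of_int (p + 2) \<noteq> (0::rat)" "of_int (p - 6) \<noteq> (0::rat)" by (simp_all only: of_int_eq_0_iff not_False_eq_True)
      moreover have "\<xi> = - (3 * of_int (p + 2) * of_int (p - 6) * (of_int r / of_int s)\<^sup>2)"
        unfolding x 2 by (simp only: of_int_mult of_int_numeral of_int_minus mult_minus_left)
      moreover have "of_int (- 12 * (p + 2) * (p - 6) ^ 3) = (- (12 * of_int (p + 2) * of_int (p - 6) ^ 3) :: rat)"
        by (simp only: of_int_mult of_int_numeral of_int_power of_int_minus mult_minus_left)
      moreover have "- (12 * P * Q ^ 3) / (- (3 * P * Q * (R / S)\<^sup>2)) = (2 * Q * S / R)\<^sup>2"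
        if "P \<noteq> 0" "Q \<noteq> 0" "R \<noteq> 0" "S \<noteq> 0" for P Q R S :: rat
        using that by (simp add: field_simps power2_eq_square power3_eq_cube)
      ultimately show ?thesis using r s by (simp only: of_int_eq_0_iff not_False_eq_True)
    qed
    thus ?thesis by blast
  qed
qed

end

section \<open>Two-adic halving\<close>

lemma padic_abs_of_int:
  assumes "prime p"
  shows "padic_abs p (of_int n) \<le> 1" "\<not> int p dvd n \<Longrightarrow> padic_abs p (of_int n) = 1"
proof -
  have pos: "real p > 1" using prime_gt_1_nat[OF assms] by simp
  have e: "padic_abs p (of_int n) = real p powi (- int (multiplicity (int p) n))" if "n \<noteq> 0"
    using padic_abs_divide[OF assms that, of 1] by simp
  show "padic_abs p (of_int n) \<le> 1"
  proof (cases "n = 0")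
    case False
    show ?thesis unfolding e[OF False] using pos one_le_power[of "real p" "multiplicity (int p) n"]
      by (simp add: power_int_minus inverse_le_1_iff)
  qed (simp add: padic_abs_def)
  assume "\<not> int p dvd n"
  moreover from this have "n \<noteq> 0" by auto
  ultimately show "padic_abs p (of_int n) = 1" by (simp add: e not_dvd_imp_multiplicity_0)
qed

lemma padic_abs_add_dominant:
  assumes p: "prime p" and lt: "padic_abs p y < padic_abs p x"
  shows "padic_abs p (x + y) = padic_abs p x"
proof (rule antisym)
  interpret v: rat_abs_value "padic_abs p" by (rule padic_abs_value[OF p])
  show "padic_abs p (x + y) \<le> padic_abs p x" using padic_abs_ultrametric[OF p, of x y] lt by simp
  show "padic_abs p x \<le> padic_abs p (x + y)"
    using padic_abs_ultrametric[OF p, of "x + y" "- y"] lt by auto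
qed

lemma padic_abs_even_quartic:
  assumes p: "prime p" and x: "padic_abs p x > 1"
  shows "padic_abs p (x ^ 4 + of_int A * x\<^sup>2 + of_int B) = padic_abs p x ^ 4"
proof -
  interpret v: rat_abs_value "padic_abs p" by (rule padic_abs_value[OF p])
  have pw: "padic_abs p (y ^ n) = padic_abs p y ^ n" for y n by (induction n) (simp_all add: v.mult)
  have lt: "padic_abs p x ^ 2 < padic_abs p x ^ 4" using x by (intro power_strict_increasing) auto
  have x2: "padic_abs p x ^ 2 \<ge> 1" using x by simp
  have "padic_abs p (of_int A * x\<^sup>2) \<le> 1 * padic_abs p x ^ 2"
    unfolding v.mult pw by (intro mult_right_mono padic_abs_of_int p) simp
  hence "padic_abs p (of_int A * x\<^sup>2 + of_int B) \<le> padic_abs p x ^ 2"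
    using padic_abs_ultrametric[OF p, of "of_int A * x\<^sup>2" "of_int B"] padic_abs_of_int(1)[OF p, of B] x2 by linarith
  hence "padic_abs p (x ^ 4 + (of_int A * x\<^sup>2 + of_int B)) = padic_abs p (x ^ 4)"
    using lt pw by (intro padic_abs_add_dominant p) simp
  thus ?thesis by (simp add: pw add.assoc)
qed

lemma rat_odd_denominator:
  assumes "padic_abs 2 x \<le> 1"
  obtains u v :: int where "x = of_int u / of_int v" "odd v"
proof -
  obtain u v where q: "quotient_of x = (u, v)" by (metis surj_pair)
  have x: "x = of_int u / of_int v" and v: "v > 0" and cop: "coprime u v"
    using quotient_of_div[OF q] quotient_of_denom_pos[OF q] quotient_of_coprime[OF q] by auto
  interpret v: rat_abs_value "padic_abs 2" by (rule padic_abs_value) simp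
  have "odd v"
  proof
    assume "even v"
    hence u: "odd u" using cop by (meson coprime_common_divisor odd_one)
    have "u \<noteq> 0" "v \<noteq> 0" using u v by auto
    hence "padic_abs 2 x = real 2 powi (int (multiplicity (int 2) v) - int (multiplicity (int 2) u))"
      unfolding x by (intro padic_abs_divide) auto
    moreover have "multiplicity (int 2) u = 0" using u by (simp add: not_dvd_imp_multiplicity_0)
    moreover have "multiplicity (int 2) v > 0" using \<open>even v\<close> v by (simp add: multiplicity_gt_zero_iff)
    ultimately have "padic_abs 2 x > 1" by (simp add: power_int_of_nat one_less_power del: of_nat_numeral)
    thus False using assms by simp
  qed
  thus ?thesis using that x by blast
qed

context prime_constellation
begin

text \<open>Otherwise \<rho> has an odd denominator v, and clearing it produces an integer solution
  of the kind excluded by \<open>no_odd_point\<close>.\<close>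

lemma padic_abs_gt_1:
  fixes \<rho> N :: rat
  assumes eq: "N\<^sup>2 = \<rho> ^ 4 + of_int (2 * a) * \<rho>\<^sup>2 + of_int (4 * b)"
  shows "padic_abs 2 \<rho> > 1"
proof (rule ccontr)
  assume "\<not> padic_abs 2 \<rho> > 1"
  then obtain u v where uv: "\<rho> = of_int u / of_int v" "odd v" using rat_odd_denominator[of \<rho>] by auto
  have v0: "of_int v \<noteq> (0::rat)" using uv(2) by auto
  have "(N * of_int v ^ 2)\<^sup>2 = (\<rho> * of_int v) ^ 4 + of_int (2 * a) * (\<rho> * of_int v)\<^sup>2 * of_int v ^ 2 + of_int (4 * b) * of_int v ^ 4"
    unfolding power_mult_distrib eq by (simp add: algebra_simps power2_eq_square power4_eq_xxxx)
  also have "\<rho> * of_int v = of_int u" using uv(1) v0 by simp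
  also have "of_int u ^ 4 + of_int (2 * a) * (of_int u)\<^sup>2 * (of_int v)\<^sup>2 + of_int (4 * b) * of_int v ^ 4
      = (of_int (u ^ 4 + 2 * a * u\<^sup>2 * v\<^sup>2 + 4 * b * v ^ 4) :: rat)"
    by (simp only: of_int_add of_int_mult of_int_power)
  finally have "(N * of_int v ^ 2)\<^sup>2 = of_int (u ^ 4 + 2 * a * u\<^sup>2 * v\<^sup>2 + 4 * b * v ^ 4)" .
  moreover from int_square_of_rat_square[OF this] obtain M where "N * of_int v ^ 2 = of_int M" by blast
  ultimately have "M\<^sup>2 = u ^ 4 + 2 * a * u\<^sup>2 * v\<^sup>2 + 4 * b * v ^ 4"
    by (metis of_int_eq_iff of_int_power)
  thus False using no_odd_point uv(2) by blast
qed

text \<open>One step is halving on the elliptic curve up to 2-torsion, and it halves the 2-adic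
  absolute value, which nevertheless always exceeds 1.\<close>

lemma halving_step:
  fixes \<rho> N :: rat
  assumes eq: "N\<^sup>2 = \<rho> ^ 4 + of_int (2 * a) * \<rho>\<^sup>2 + of_int (4 * b)"
  obtains \<sigma> M :: rat where "M\<^sup>2 = \<sigma> ^ 4 + of_int (2 * a) * \<sigma>\<^sup>2 + of_int (4 * b)"
    "padic_abs 2 \<sigma> = padic_abs 2 \<rho> / 2"
proof -
  interpret v: rat_abs_value "padic_abs 2" by (rule padic_abs_value) simp
  have pw: "padic_abs 2 (y ^ n) = padic_abs 2 y ^ n" for y n by (induction n) (simp_all add: v.mult)
  define \<alpha> \<beta> c :: rat where "\<alpha> = of_int a" and "\<beta> = of_int b" and "c = of_int (3 * (p + 2) * (p - 6) ^ 3)"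
  have disc': "4 * \<beta> = \<alpha>\<^sup>2 + c"
  proof -
    have "(of_int (4 * b) :: rat) = of_int (a\<^sup>2 + 3 * (p + 2) * (p - 6) ^ 3)" using disc by simp
    thus ?thesis unfolding \<alpha>_def \<beta>_def c_def by (simp only: of_int_mult of_int_add of_int_power of_int_numeral)
  qed
  have c0: "c \<noteq> 0" unfolding c_def of_int_eq_0_iff using p_gt by simp
  have b0: "\<beta> \<noteq> 0" using b_pos by (simp add: \<beta>_def)
  have eq': "N\<^sup>2 = \<rho> ^ 4 + 2 * \<alpha> * \<rho>\<^sup>2 + 4 * \<beta>" using eq by (simp add: \<alpha>_def \<beta>_def)
  have \<rho>0: "\<rho> \<noteq> 0" using padic_abs_gt_1[OF eq] by auto
  \<comment> \<open>\<open>\<xi> N\<close> and \<open>\<xi> (- N)\<close> are the roots X of X^2 - 4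
    \<alpha> X - 4 c = 4 \<rho>^2 X: the first coordinates of the two preimages, under the dual
    isogeny, of the point with first coordinate \<rho>^2.\<close>
  define \<xi> where "\<xi> = (\<lambda>n. 2 * (n + \<rho>\<^sup>2 + \<alpha>))"
  have prod: "\<xi> n * (- \<xi> (- n)) = 4 * c" if "n\<^sup>2 = N\<^sup>2" for n
  proof -
    have "\<xi> n * (- \<xi> (- n)) = 4 * (n\<^sup>2 - (\<rho>\<^sup>2 + \<alpha>)\<^sup>2)" by (simp add: \<xi>_def algebra_simps power2_eq_square)
    also have "\<dots> = 4 * c" unfolding that eq' disc' by (simp add: algebra_simps power2_eq_square power4_eq_xxxx)
    finally show ?thesis .
  qed
  have \<xi>0: "\<xi> N \<noteq> 0" using prod[of N] c0 by auto
  have "\<xi> N - 4 * c / \<xi> N = 4 * (\<rho>\<^sup>2 + \<alpha>)"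
  proof -
    have "4 * c / \<xi> N = - \<xi> (- N)" using prod[of N] \<xi>0 by (simp add: field_simps)
    thus ?thesis by (simp add: \<xi>_def algebra_simps)
  qed
  hence "(\<xi> N)\<^sup>2 - 4 * \<alpha> * \<xi> N - 4 * c = 4 * \<rho>\<^sup>2 * \<xi> N"
    using \<xi>0 by (simp add: field_simps power2_eq_square)
  hence "(2 * \<rho> * \<xi> N)\<^sup>2 = \<xi> N * ((\<xi> N)\<^sup>2 - 4 * \<alpha> * \<xi> N - 4 * c)"
    by (simp add: power2_eq_square mult_ac)
  also have "(\<xi> N)\<^sup>2 - 4 * \<alpha> * \<xi> N - 4 * c = (\<xi> N)\<^sup>2 + of_int (- 4 * a) * \<xi> N + of_int (- 12 * (p + 2) * (p - 6) ^ 3)"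
  proof -
    have "- 12 * (p + 2) * (p - 6) ^ 3 = - 4 * (3 * (p + 2) * (p - 6) ^ 3)"
      by (simp only: mult.assoc[symmetric])
    hence "of_int (- 12 * (p + 2) * (p - 6) ^ 3) = - 4 * c"
      unfolding c_def by (simp only: of_int_mult of_int_numeral of_int_minus)
    thus ?thesis unfolding \<alpha>_def by simp
  qed
  finally have "\<exists>\<tau>. \<xi> N = \<tau>\<^sup>2 \<or> of_int (- 12 * (p + 2) * (p - 6) ^ 3) / \<xi> N = \<tau>\<^sup>2"
    by (rule dual_two_isogeny_image) (use \<rho>0 \<xi>0 in auto)
  moreover have "of_int (- 12 * (p + 2) * (p - 6) ^ 3) / \<xi> N = \<xi> (- N)"
  proof -
    have "- 12 * (p + 2) * (p - 6) ^ 3 = - 4 * (3 * (p + 2) * (p - 6) ^ 3)"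
      by (simp only: mult.assoc[symmetric])
    hence "of_int (- 12 * (p + 2) * (p - 6) ^ 3) = - 4 * c"
      unfolding c_def by (simp only: of_int_mult of_int_numeral of_int_minus)
    thus ?thesis using prod[of N] \<xi>0 by (simp add: field_simps)
  qed
  \<comment> \<open>The product of the two roots is the constant term -4 c of the dual curve, so the
    second alternative of the dual descent just selects the other root.\<close>
  ultimately obtain n \<tau> where n: "n\<^sup>2 = N\<^sup>2" and \<tau>: "\<xi> n = \<tau>\<^sup>2" by (metis power2_minus)
  have \<tau>0: "\<tau> \<noteq> 0" using prod[OF n] \<tau> c0 by auto
  have "\<tau>\<^sup>2 * (\<tau>\<^sup>2 - 4 * (\<rho>\<^sup>2 + \<alpha>)) = \<xi> n * (- \<xi> (- n))" unfolding \<tau>[symmetric] by (simp add: \<xi>_def algebra_simps)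
  hence rt: "4 * \<rho>\<^sup>2 * \<tau>\<^sup>2 = \<tau> ^ 4 - 4 * \<alpha> * \<tau>\<^sup>2 - 4 * c"
    unfolding prod[OF n] by (simp add: algebra_simps power2_eq_square power4_eq_xxxx)
  \<comment> \<open>\<open>\<zeta> 1\<close> and \<open>\<zeta> (-1)\<close> are the roots x of x^2
    + 2 \<alpha> x + 4 \<beta> = \<tau>^2 x: the first coordinates of the preimages in
    \<open>E\<close> of the point with first coordinate \<tau>^2 on the dual curve. Their product is
    4 \<beta>, so again one of them is a square.\<close>
  define \<zeta> where "\<zeta> = (\<lambda>s::rat. (\<tau>\<^sup>2 - 2 * \<alpha> + 2 * s * \<rho> * \<tau>) / 2)"
  have "\<zeta> 1 * \<zeta> (-1) = ((\<tau>\<^sup>2 - 2 * \<alpha>)\<^sup>2 - 4 * \<rho>\<^sup>2 * \<tau>\<^sup>2) / 4"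
    by (simp add: \<zeta>_def field_simps power2_eq_square)
  also have "\<dots> = 4 * \<beta>" unfolding rt disc' by (simp add: field_simps power2_eq_square power4_eq_xxxx)
  finally have zz: "\<zeta> 1 * \<zeta> (-1) = 4 * \<beta>" .
  have z0: "\<zeta> 1 \<noteq> 0" using zz b0 by auto
  have sum: "\<zeta> 1 + \<zeta> (-1) = \<tau>\<^sup>2 - 2 * \<alpha>" by (simp add: \<zeta>_def field_simps)
  have z: "x\<^sup>2 + 2 * \<alpha> * x + 4 * \<beta> = \<tau>\<^sup>2 * x" if "x = \<zeta> 1 \<or> x = \<zeta> (-1)" for x
  proof -
    have "(x - \<zeta> 1) * (x - \<zeta> (-1)) = x\<^sup>2 - (\<zeta> 1 + \<zeta> (-1)) * x + \<zeta> 1 * \<zeta> (-1)"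
      by (simp add: algebra_simps power2_eq_square)
    moreover have "(x - \<zeta> 1) * (x - \<zeta> (-1)) = 0" using that by auto
    ultimately show ?thesis unfolding sum zz by (simp add: algebra_simps)
  qed
  have "(\<tau> * \<zeta> 1)\<^sup>2 = \<zeta> 1 * ((\<zeta> 1)\<^sup>2 + of_int (2 * a) * \<zeta> 1 + of_int (4 * b))"
    using z[of "\<zeta> 1"] unfolding \<alpha>_def \<beta>_def by (simp add: power2_eq_square mult_ac)
  from two_isogeny_image[OF this z0] obtain \<sigma> where "\<zeta> 1 = \<sigma>\<^sup>2 \<or> of_int (4 * b) / \<zeta> 1 = \<sigma>\<^sup>2" by blast
  moreover have "of_int (4 * b) / \<zeta> 1 = \<zeta> (-1)" using zz z0 unfolding \<beta>_def by (simp add: field_simps)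
  ultimately have s: "\<sigma>\<^sup>2 = \<zeta> 1 \<or> \<sigma>\<^sup>2 = \<zeta> (-1)" by auto
  have M: "(\<tau> * \<sigma>)\<^sup>2 = \<sigma> ^ 4 + of_int (2 * a) * \<sigma>\<^sup>2 + of_int (4 * b)"
    using z[OF s] unfolding \<alpha>_def \<beta>_def by (simp add: power2_eq_square power4_eq_xxxx mult_ac)
  have s1: "padic_abs 2 \<sigma> > 1" by (rule padic_abs_gt_1[OF M])
  \<comment> \<open>In both quartics the leading term dominates 2-adically. The one in \<sigma>
    gives |\<tau>| = |\<sigma>|, the one in \<tau> gives |2 \<rho>| = |\<tau>|, and |2| =
    1/2.\<close>
  have "padic_abs 2 ((\<tau> * \<sigma>)\<^sup>2) = padic_abs 2 \<sigma> ^ 4"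
    unfolding M by (rule padic_abs_even_quartic[OF two_is_prime_nat s1])
  hence "(padic_abs 2 \<tau> * padic_abs 2 \<sigma>)\<^sup>2 = padic_abs 2 \<sigma> ^ 4"
    by (simp only: v.mult pw)
  hence "(padic_abs 2 \<tau>)\<^sup>2 = (padic_abs 2 \<sigma>)\<^sup>2"
    using s1 by (simp add: power_mult_distrib power4_eq_xxxx power2_eq_square)
  hence ts: "padic_abs 2 \<tau> = padic_abs 2 \<sigma>" using v.nonneg by (simp add: power2_eq_iff_nonneg)
  have two: "padic_abs 2 2 = 1 / 2"
    using padic_abs_divide[of 2 2 1] by simp
  have Q: "(2 * \<rho> * \<tau>)\<^sup>2 = \<tau> ^ 4 + of_int (- 4 * a) * \<tau>\<^sup>2 + of_int (- 4 * (3 * (p + 2) * (p - 6) ^ 3))"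
  proof -
    have "of_int (- 4 * (3 * (p + 2) * (p - 6) ^ 3)) = - 4 * c"
      unfolding c_def by (simp only: of_int_mult of_int_numeral of_int_minus)
    thus ?thesis using rt by (simp add: power_mult_distrib \<alpha>_def)
  qed
  have "padic_abs 2 ((2 * \<rho> * \<tau>)\<^sup>2) = padic_abs 2 \<tau> ^ 4"
    unfolding Q by (rule padic_abs_even_quartic) (use s1 ts in simp_all)
  hence "(padic_abs 2 \<rho> / 2 * padic_abs 2 \<sigma>)\<^sup>2 = (padic_abs 2 \<sigma>)\<^sup>2 * (padic_abs 2 \<sigma>)\<^sup>2"
    unfolding pw v.mult two ts by (simp add: power4_eq_xxxx power2_eq_square)
  hence "(padic_abs 2 \<rho> / 2)\<^sup>2 = (padic_abs 2 \<sigma>)\<^sup>2"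
    using s1 by (subst (asm) power_mult_distrib, subst (asm) mult_right_cancel) auto
  hence "padic_abs 2 \<sigma> = padic_abs 2 \<rho> / 2" using v.nonneg by (simp add: power2_eq_iff_nonneg)
  thus ?thesis using that M by blast
qed

text \<open>Halving can be repeated forever and always ends above 1, so |\<rho>| would exceed every
  power of 2.\<close>

lemma no_square_point:
  fixes \<rho> N :: rat
  shows "N\<^sup>2 \<noteq> \<rho> ^ 4 + of_int (2 * a) * \<rho>\<^sup>2 + of_int (4 * b)"
proof
  assume "N\<^sup>2 = \<rho> ^ 4 + of_int (2 * a) * \<rho>\<^sup>2 + of_int (4 * b)"
  hence "padic_abs 2 \<rho> \<ge> 2 ^ n" for n
  proof (induction n arbitrary: \<rho> N)
    case 0
    thus ?case using padic_abs_gt_1[OF 0] by simp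
  next
    case (Suc n)
    obtain \<sigma> M where "M\<^sup>2 = \<sigma> ^ 4 + of_int (2 * a) * \<sigma>\<^sup>2 + of_int (4 * b)"
      "padic_abs 2 \<sigma> = padic_abs 2 \<rho> / 2" by (rule halving_step[OF Suc.prems])
    thus ?case using Suc.IH[of M \<sigma>] by simp
  qed
  moreover obtain n where "padic_abs 2 \<rho> < 2 ^ n" using real_arch_pow[of 2 "padic_abs 2 \<rho>"] by auto
  ultimately show False by (meson not_less)
qed

lemma elliptic_points:
  fixes \<xi> \<eta> :: rat
  assumes eq: "\<eta>\<^sup>2 = \<xi> * (\<xi>\<^sup>2 + of_int (2 * a) * \<xi> + of_int (4 * b))"
  shows "\<xi> = 0"
proof (rule ccontr)
  assume \<xi>: "\<xi> \<noteq> 0"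
  from two_isogeny_image[OF eq \<xi>] obtain \<rho> where "\<xi> = \<rho>\<^sup>2 \<or> of_int (4 * b) / \<xi> = \<rho>\<^sup>2" by blast
  thus False
  proof
    assume r: "\<xi> = \<rho>\<^sup>2"
    hence r0: "\<rho> \<noteq> 0" using \<xi> by auto
    have "(\<eta> / \<rho>)\<^sup>2 = \<rho> ^ 4 + of_int (2 * a) * \<rho>\<^sup>2 + of_int (4 * b)"
      unfolding power_divide eq r using r0 by simp
    thus False by (rule no_square_point[THEN notE])
  next
    \<comment> \<open>4 b / \<xi> is the first coordinate after adding the torsion point (0, 0), and
      \<rho> \<eta> / \<xi> is the corresponding square root.\<close>
    assume r: "of_int (4 * b) / \<xi> = \<rho>\<^sup>2"
    have id: "\<rho>\<^sup>2 * (\<xi> * (\<xi>\<^sup>2 + A * \<xi> + B)) / \<xi>\<^sup>2 = \<rho> ^ 4 + A * \<rho>\<^sup>2 + B"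
      if B: "B / \<xi> = \<rho>\<^sup>2" for A B
    proof -
      have B': "B = \<rho>\<^sup>2 * \<xi>" using B \<xi> by (simp add: field_simps)
      have "\<rho>\<^sup>2 * (\<xi> * (\<xi>\<^sup>2 + A * \<xi> + B)) = (\<rho>\<^sup>2 * (\<xi> + A + \<rho>\<^sup>2)) * \<xi>\<^sup>2"
        unfolding B' by (simp add: algebra_simps power2_eq_square)
      thus ?thesis using \<xi> by (simp add: B' algebra_simps power2_eq_square power4_eq_xxxx)
    qed
    have "(\<rho> * \<eta> / \<xi>)\<^sup>2 = \<rho> ^ 4 + of_int (2 * a) * \<rho>\<^sup>2 + of_int (4 * b)"
      unfolding power_divide power_mult_distrib eq by (rule id[OF r])
    thus False by (rule no_square_point[THEN notE])
  qed
qed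

end

section \<open>Rational points of the cubic\<close>

lemma rat_binary_cubic_zero:
  fixes w z :: rat and k1 k2 k3 :: int
  assumes no: "\<And>u v :: int. coprime u v \<Longrightarrow> u ^ 3 + k1 * u\<^sup>2 * v + k2 * u * v\<^sup>2 + k3 * v ^ 3 \<noteq> 0"
    and eq: "w ^ 3 + of_int k1 * w\<^sup>2 * z + of_int k2 * w * z\<^sup>2 + of_int k3 * z ^ 3 = 0"
  shows "w = 0 \<and> z = 0"
proof -
  have "z = 0"
  proof (rule ccontr)
    assume z: "z \<noteq> 0"
    obtain u v where q: "quotient_of (w / z) = (u, v)" by (metis surj_pair)
    have x: "w / z = of_int u / of_int v" and v: "v > 0" and cop: "coprime u v"
      using quotient_of_div[OF q] quotient_of_denom_pos[OF q] quotient_of_coprime[OF q] by auto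
    have v0: "of_int v \<noteq> (0::rat)" using v by simp
    define y where "y = w / z"
    have Y: "of_int u = y * of_int v" "w = y * z" 
    proof -
      show "of_int u = y * of_int v" unfolding y_def x using v0 by simp
      show "w = y * z" unfolding y_def using z by simp
    qed
    have "(y ^ 3 + of_int k1 * y\<^sup>2 + of_int k2 * y + of_int k3) * z ^ 3 = 0"
      using eq unfolding Y(2) by (simp add: algebra_simps power2_eq_square power3_eq_cube)
    hence "y ^ 3 + of_int k1 * y\<^sup>2 + of_int k2 * y + of_int k3 = 0" using z by simp
    moreover have "of_int (u ^ 3 + k1 * u\<^sup>2 * v + k2 * u * v\<^sup>2 + k3 * v ^ 3) =
        (y ^ 3 + of_int k1 * y\<^sup>2 + of_int k2 * y + of_int k3) * of_int v ^ 3"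
      by (simp add: Y(1) algebra_simps power2_eq_square power3_eq_cube)
    ultimately have "(of_int (u ^ 3 + k1 * u\<^sup>2 * v + k2 * u * v\<^sup>2 + k3 * v ^ 3) :: rat) = 0"
      by simp
    hence "u ^ 3 + k1 * u\<^sup>2 * v + k2 * u * v\<^sup>2 + k3 * v ^ 3 = 0" unfolding of_int_eq_0_iff .
    thus False using no[OF cop] by simp
  qed
  thus ?thesis using eq by simp
qed

text \<open>With A + B sqrt 2 = (u + v sqrt 2)^3 the two forms are A + B and A + 2 B. The prime 7 is
  one at which neither has a nontrivial zero, as running through all residue pairs shows.\<close>

lemma seven_dvd_cubic_form:
  fixes u v k1 k2 k3 :: int
  assumes k: "(k1, k2, k3) \<in> {(3, 6, 2), (6, 6, 4)}"
    and eq: "u ^ 3 + k1 * u\<^sup>2 * v + k2 * u * v\<^sup>2 + k3 * v ^ 3 = 0"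
  shows "7 dvd u \<and> 7 dvd v"
proof -
  define r s where "r = u mod 7" and "s = v mod 7"
  have "(r ^ 3 + k1 * r\<^sup>2 * s + k2 * r * s\<^sup>2 + k3 * s ^ 3) mod 7 = (u ^ 3 + k1 * u\<^sup>2 * v + k2 * u * v\<^sup>2 + k3 * v ^ 3) mod 7"
    unfolding r_def s_def cong_def[symmetric]
    by (intro cong_add cong_mult cong_pow cong_refl) (simp_all add: cong_def)
  hence *: "(r ^ 3 + k1 * r\<^sup>2 * s + k2 * r * s\<^sup>2 + k3 * s ^ 3) mod 7 = 0" using eq by simp
  have "0 \<le> r" "r < 7" "0 \<le> s" "s < 7" by (simp_all add: r_def s_def)
  hence "r \<in> {0, 1, 2, 3, 4, 5, 6}" "s \<in> {0, 1, 2, 3, 4, 5, 6}" by auto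
  hence "r = 0 \<and> s = 0" using * k by (elim insertE emptyE; simp only: prod.inject; elim conjE; hypsubst; simp)
  thus ?thesis by (simp add: r_def s_def dvd_eq_mod_eq_0)
qed

lemma binary_cubic_no_rational_zero:
  fixes w z :: rat and k1 k2 k3 :: int
  assumes k: "(k1, k2, k3) \<in> {(3, 6, 2), (6, 6, 4)}"
    and eq: "w ^ 3 + of_int k1 * w\<^sup>2 * z + of_int k2 * w * z\<^sup>2 + of_int k3 * z ^ 3 = 0"
  shows "w = 0 \<and> z = 0"
  using eq
proof (rule rat_binary_cubic_zero[rotated])
  fix u v :: int assume "coprime u v"
  show "u ^ 3 + k1 * u\<^sup>2 * v + k2 * u * v\<^sup>2 + k3 * v ^ 3 \<noteq> 0"
  proof
    assume "u ^ 3 + k1 * u\<^sup>2 * v + k2 * u * v\<^sup>2 + k3 * v ^ 3 = 0"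
    from seven_dvd_cubic_form[OF k this] have "is_unit (7::int)"
      using coprime_common_divisor[OF \<open>coprime u v\<close>] by blast
    thus False by simp
  qed
qed

text \<open>At t = 0 the equation is A + B = 0, which is anisotropic. On the chart t = 1 the map to
  \<open>E\<close> leaves only \<xi> = 0 and A + 2 B = 0; the latter forces W = Z = 0, where \<xi>
  is 2 p^2.\<close>

lemma (in prime_constellation) cubic_no_rational_point:
  fixes w z t :: rat
  assumes eq: "3 * w\<^sup>2 * z + 2 * z ^ 3 + w ^ 3 + 6 * w * z\<^sup>2 + of_int (2 * p\<^sup>2 * (p - 6)) * t ^ 3
      - (12 * z\<^sup>2 * t - 6 * w\<^sup>2 * t) = 0"
  shows "w = 0 \<and> z = 0 \<and> t = 0"
proof -
  have "t = 0"
  proof (rule ccontr)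
    assume t: "t \<noteq> 0"
    define W Z P where "W = w / t" and "Z = z / t" and "P = (of_int p :: rat)"
    define A B n where "A = W ^ 3 + 6 * W * Z\<^sup>2" and "B = 3 * W\<^sup>2 * Z + 2 * Z ^ 3" and "n = W\<^sup>2 - 2 * Z\<^sup>2"
    have wz: "w = W * t" "z = Z * t" using t by (simp_all add: W_def Z_def)
    have C: "of_int (2 * p\<^sup>2 * (p - 6)) = 2 * P\<^sup>2 * (P - 6)" by (simp add: P_def)
    have "t ^ 3 * (A + B + 6 * n + 2 * P\<^sup>2 * (P - 6)) = 0"
      using eq[unfolded wz C] unfolding A_def B_def n_def by (simp add: algebra_simps power2_eq_square power3_eq_cube)
    hence "A + B + 6 * n + 2 * P\<^sup>2 * (P - 6) = 0" using t by (subst (asm) mult_eq_0_iff) auto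
    hence AB: "A + B = - (6 * n + 2 * P\<^sup>2 * (P - 6))" by linarith
    \<comment> \<open>A^2 - 2 B^2 = n^3 is the norm of (W + Z sqrt 2)^3. The combinations A + B and
      A + 2 B appear because (2 + sqrt 2)(A + B sqrt 2) = 2 (A + B) + (A + 2 B) sqrt 2.\<close>
    have norm: "(A + 2 * B)\<^sup>2 = 2 * (A + B)\<^sup>2 - n ^ 3"
      unfolding A_def B_def n_def by (simp add: algebra_simps power2_eq_square power3_eq_cube)
    define \<xi> where "\<xi> = 2 * P\<^sup>2 - n"
    have ab: "of_int (2 * a) = 6 * (12 - P\<^sup>2)" "of_int (4 * b) = 12 * P ^ 3 * (P - 4)"
      unfolding a_def b_def P_def by simp_all
    have E: "(A + 2 * B)\<^sup>2 = \<xi> * (\<xi>\<^sup>2 + of_int (2 * a) * \<xi> + of_int (4 * b))"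
      unfolding norm AB ab \<xi>_def by (simp add: algebra_simps power2_eq_square power3_eq_cube)
    have "\<xi> = 0" by (rule elliptic_points[OF E])
    with E have "A + 2 * B = 0" by simp
    hence "W ^ 3 + of_int 6 * W\<^sup>2 * Z + of_int 6 * W * Z\<^sup>2 + of_int 4 * Z ^ 3 = 0"
      unfolding A_def B_def by (simp add: algebra_simps)
    hence "W = 0 \<and> Z = 0" by (rule binary_cubic_no_rational_zero[rotated]) simp
    hence "P\<^sup>2 = 0" using \<open>\<xi> = 0\<close> by (simp add: \<xi>_def n_def)
    thus False using p_gt by (simp add: P_def)
  qed
  moreover from this have "w ^ 3 + of_int 3 * w\<^sup>2 * z + of_int 6 * w * z\<^sup>2 + of_int 2 * z ^ 3 = 0"
    using eq by simp
  hence "w = 0 \<and> z = 0" by (rule binary_cubic_no_rational_zero[rotated]) simp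
  ultimately show ?thesis by blast
qed

section \<open>Power sums in \<open>\<int>[\<surd>2]\<close> modulo a prime\<close>

text \<open>Realised inside the reals, so that \<open>sqrt 2\<close> and its conjugate are at hand
  and ring identities are those of \<open>real\<close>. Divisibility by a prime in this ring is
  \<open>zdvd\<close>.\<close>

definition Zsqrt2 :: "real set" where
  "Zsqrt2 = {x. \<exists>m n :: int. x = of_int m + of_int n * sqrt 2}"

lemma Zsqrt2_of_int [simp]: "of_int m \<in> Zsqrt2"
  unfolding Zsqrt2_def by (rule CollectI, rule exI[of _ m], rule exI[of _ 0]) simp

lemma Zsqrt2_of_nat [simp]: "of_nat m \<in> Zsqrt2"
  using Zsqrt2_of_int[of "int m"] by simp

lemma Zsqrt2_numeral [simp]: "0 \<in> Zsqrt2" "1 \<in> Zsqrt2" "numeral k \<in> Zsqrt2"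
  using Zsqrt2_of_int[of 0] Zsqrt2_of_int[of 1] Zsqrt2_of_int[of "numeral k"] by simp_all

lemma Zsqrt2_sqrt2 [simp]: "sqrt 2 \<in> Zsqrt2"
  unfolding Zsqrt2_def by (rule CollectI, rule exI[of _ 0], rule exI[of _ 1]) simp

lemma Zsqrt2_add: assumes "x \<in> Zsqrt2" "y \<in> Zsqrt2" shows "x + y \<in> Zsqrt2"
proof -
  obtain m n k j where "x = of_int m + of_int n * sqrt 2" "y = of_int k + of_int j * sqrt 2"
    using assms unfolding Zsqrt2_def by blast
  hence "x + y = of_int (m + k) + of_int (n + j) * sqrt 2" by (simp add: algebra_simps)
  thus ?thesis unfolding Zsqrt2_def by blast
qed

lemma Zsqrt2_mult: assumes "x \<in> Zsqrt2" "y \<in> Zsqrt2" shows "x * y \<in> Zsqrt2"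
proof -
  obtain m n k j where "x = of_int m + of_int n * sqrt 2" "y = of_int k + of_int j * sqrt 2"
    using assms unfolding Zsqrt2_def by blast
  hence "x * y = of_int (m * k + 2 * n * j) + of_int (m * j + n * k) * sqrt 2" by (simp add: algebra_simps)
  thus ?thesis unfolding Zsqrt2_def by blast
qed

lemma Zsqrt2_minus: "x \<in> Zsqrt2 \<Longrightarrow> - x \<in> Zsqrt2"
  using Zsqrt2_mult[OF Zsqrt2_of_int[of "-1"], of x] by simp

lemma Zsqrt2_diff: "x \<in> Zsqrt2 \<Longrightarrow> y \<in> Zsqrt2 \<Longrightarrow> x - y \<in> Zsqrt2"
  using Zsqrt2_add[of x "- y"] Zsqrt2_minus[of y] by simp

lemma Zsqrt2_power: "x \<in> Zsqrt2 \<Longrightarrow> x ^ n \<in> Zsqrt2"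
  by (induction n) (simp_all add: Zsqrt2_mult)

lemma Zsqrt2_sum: "(\<And>i. i \<in> A \<Longrightarrow> f i \<in> Zsqrt2) \<Longrightarrow> sum f A \<in> Zsqrt2"
  by (induction A rule: infinite_finite_induct) (simp_all add: Zsqrt2_add)

lemmas Zsqrt2_intros = Zsqrt2_add Zsqrt2_mult Zsqrt2_minus Zsqrt2_diff Zsqrt2_power Zsqrt2_sum

lemma sqrt2_coords_unique:
  fixes m n :: int
  assumes "of_int m + of_int n * sqrt 2 = 0" shows "m = 0 \<and> n = 0"
proof -
  have "of_int m = - (of_int n * sqrt 2)" using assms by linarith
  hence "(of_int m)\<^sup>2 = (of_int n * sqrt 2)\<^sup>2" by simp
  hence "of_int (m\<^sup>2) = (of_int (2 * n\<^sup>2) :: real)" by (simp add: power_mult_distrib)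
  hence eq: "m\<^sup>2 = 2 * n\<^sup>2" using of_int_eq_iff by blast
  have "n = 0"
  proof (rule ccontr)
    assume n: "n \<noteq> 0"
    hence "m \<noteq> 0" using eq by auto
    have "multiplicity 2 (m\<^sup>2) = multiplicity 2 (2 * n\<^sup>2)" using eq by simp
    moreover have "multiplicity 2 (m\<^sup>2) = 2 * multiplicity 2 m"
      using \<open>m \<noteq> 0\<close> by (intro prime_elem_multiplicity_power_distrib) auto
    moreover have "multiplicity 2 (n\<^sup>2) = 2 * multiplicity 2 n"
      using n by (intro prime_elem_multiplicity_power_distrib) auto
    moreover have "multiplicity 2 (2 * n\<^sup>2) = Suc (multiplicity 2 (n\<^sup>2))"
      using n by (intro multiplicity_times_same) auto
    ultimately show False by presburger
  qed
  thus ?thesis using eq by simp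
qed

definition zdvd :: "nat \<Rightarrow> real \<Rightarrow> bool" where
  "zdvd l x \<longleftrightarrow> (\<exists>y\<in>Zsqrt2. x = of_nat l * y)"

lemma zdvd_0 [simp]: "zdvd l 0"
  unfolding zdvd_def by (intro bexI[of _ 0]) auto

lemma zdvd_add: "zdvd l x \<Longrightarrow> zdvd l y \<Longrightarrow> zdvd l (x + y)"
  unfolding zdvd_def by (metis Zsqrt2_add distrib_left)

lemma zdvd_mult: "zdvd l x \<Longrightarrow> c \<in> Zsqrt2 \<Longrightarrow> zdvd l (c * x)"
  unfolding zdvd_def by (metis Zsqrt2_mult mult.left_commute)

lemma zdvd_mult2: "zdvd l x \<Longrightarrow> c \<in> Zsqrt2 \<Longrightarrow> zdvd l (x * c)"
  using zdvd_mult[of l x c] by (simp add: mult.commute)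

lemma zdvd_diff: "zdvd l x \<Longrightarrow> zdvd l y \<Longrightarrow> zdvd l (x - y)"
  using zdvd_add[of l x "- y"] zdvd_mult[of l y "of_int (-1)"] Zsqrt2_of_int[of "-1"] by simp

lemma zdvd_diff_trans: "zdvd l (x - y) \<Longrightarrow> zdvd l (y - z) \<Longrightarrow> zdvd l (x - z)"
  using zdvd_add[of l "x - y" "y - z"] by simp

lemma zdvd_of_diff: "zdvd l (x - y) \<Longrightarrow> zdvd l y \<Longrightarrow> zdvd l x"
  using zdvd_add[of l "x - y" y] by simp

lemma zdvd_sum: "(\<And>i. i \<in> A \<Longrightarrow> zdvd l (f i)) \<Longrightarrow> zdvd l (sum f A)"
  by (induction A rule: infinite_finite_induct) (simp_all add: zdvd_add)

lemma zdvd_of_int_iff: "zdvd l (of_int n) \<longleftrightarrow> int l dvd n"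
proof
  assume "zdvd l (of_int n)"
  then obtain m k where "of_int n = of_nat l * (of_int m + of_int k * sqrt 2)"
    unfolding zdvd_def Zsqrt2_def by blast
  hence "of_int (n - int l * m) + of_int (- int l * k) * sqrt 2 = 0" by (simp add: algebra_simps)
  from sqrt2_coords_unique[OF this] show "int l dvd n" by (metis dvd_triv_left eq_iff_diff_eq_0)
next
  assume "int l dvd n"
  then obtain k where "n = int l * k" by (elim dvdE)
  thus "zdvd l (of_int n)" unfolding zdvd_def by (intro bexI[of _ "of_int k"]) auto
qed

lemma zdvd_freshman:
  assumes l: "prime l" and "x \<in> Zsqrt2" "y \<in> Zsqrt2"
  shows "zdvd l ((x + y) ^ l - (x ^ l + y ^ l))"
proof -
  have l0: "l > 0" using l prime_gt_0_nat by blast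
  have "(x + y) ^ l = (\<Sum>k\<le>l. of_nat (l choose k) * x ^ k * y ^ (l - k))" by (rule binomial_ring)
  also have "{..l} = insert 0 (insert l {0<..<l})" using l0 by auto
  also have "(\<Sum>k\<in>\<dots>. of_nat (l choose k) * x ^ k * y ^ (l - k)) =
      y ^ l + (x ^ l + (\<Sum>k\<in>{0<..<l}. of_nat (l choose k) * x ^ k * y ^ (l - k)))"
    using l0 by simp
  finally have "(x + y) ^ l - (x ^ l + y ^ l) = (\<Sum>k\<in>{0<..<l}. of_nat (l choose k) * x ^ k * y ^ (l - k))"
    by simp
  moreover have "zdvd l (of_nat (l choose k) * x ^ k * y ^ (l - k))" if "k \<in> {0<..<l}" for k
  proof -
    have "l dvd (l choose k)" using that l by (intro dvd_choose_prime) auto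
    hence "zdvd l (of_int (int (l choose k)))" unfolding zdvd_of_int_iff by simp
    thus ?thesis using assms by (auto intro!: zdvd_mult2 Zsqrt2_power)
  qed
  ultimately show ?thesis by (auto intro: zdvd_sum)
qed

lemma zdvd_fermat:
  assumes l: "prime l" shows "zdvd l (of_int w ^ l - of_int w)"
proof -
  have "[w ^ l = w] (mod int l)"
  proof (cases "int l dvd w")
    case True
    hence "[w ^ l = 0] (mod int l)" "[w = 0] (mod int l)"
      using prime_gt_0_nat[OF l] by (auto simp: cong_0_iff dvd_power_iff intro: dvd_trans[OF True dvd_power])
    thus ?thesis by (meson cong_sym cong_trans)
  next
    case False
    have "[w ^ (l - 1) = 1] (mod int l)"
    proof -
      define v where "v = nat (w mod int l)"
      have v: "[int v = w] (mod int l)" using prime_gt_0_nat[OF l] by (simp add: v_def cong_def)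
      have "\<not> l dvd v" using False v by (metis cong_dvd_iff int_dvd_int_iff)
      hence "[v ^ (l - 1) = 1] (mod l)" by (rule fermat_theorem[OF l])
      hence "[int v ^ (l - 1) = 1] (mod int l)" by (metis cong_int_iff of_nat_1 of_nat_power)
      thus ?thesis using cong_pow[OF v, of "l - 1"] by (meson cong_sym cong_trans)
    qed
    hence "[w * w ^ (l - 1) = w * 1] (mod int l)" by (intro cong_mult cong_refl)
    thus ?thesis using prime_gt_0_nat[OF l] by (metis Suc_diff_1 mult.right_neutral power_Suc)
  qed
  hence "int l dvd w ^ l - w" by (simp add: cong_iff_dvd_diff)
  hence "zdvd l (of_int (w ^ l - w))" unfolding zdvd_of_int_iff .
  thus ?thesis by simp
qed

text \<open>Telescoping (t + 1)^(C+1) - t^(C+1) writes l^(C+1) through the power sums of exponent at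
  most C, the last with coefficient C + 1, which is prime to l. For C = 0 the convention 0^0 = 1
  makes the sum equal to l.\<close>

lemma dvd_power_sum:
  assumes l: "prime l" and C: "C < l - 1"
  shows "int l dvd (\<Sum>t\<in>{0..<int l}. t ^ C)"
proof -
  have "(\<Sum>t\<in>{0..<int l}. t ^ k) = (\<Sum>t<l. int t ^ k)" for k
  proof -
    have "{0..<int l} = int ` {..<l}" by (simp add: image_int_atLeastLessThan flip: atLeast0LessThan)
    thus ?thesis by (simp add: sum.reindex)
  qed
  moreover have "int l dvd (\<Sum>t<l. int t ^ C)"
    using C
  proof (induction C rule: less_induct)
    case (less C)
    define S where "S = (\<lambda>j. \<Sum>t<l. int t ^ j)"
    have "int l ^ Suc C = (\<Sum>t<l. int (Suc t) ^ Suc C - int t ^ Suc C)"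
      by (subst sum_lessThan_telescope) simp
    also have "\<dots> = (\<Sum>t<l. \<Sum>j\<le>C. of_nat (Suc C choose j) * int t ^ j)"
    proof (rule sum.cong[OF refl])
      fix t
      have "int (Suc t) ^ Suc C = (\<Sum>j\<le>Suc C. of_nat (Suc C choose j) * int t ^ j)"
        using binomial_ring[of "int t" 1 "Suc C"] by (simp only: of_nat_Suc power_one mult_1_right add.commute)
      thus "int (Suc t) ^ Suc C - int t ^ Suc C = (\<Sum>j\<le>C. of_nat (Suc C choose j) * int t ^ j)"
        by simp
    qed
    also have "\<dots> = (\<Sum>j\<le>C. of_nat (Suc C choose j) * S j)"
      by (subst sum.swap) (simp add: S_def sum_distrib_left)
    also have "\<dots> = (\<Sum>j<C. of_nat (Suc C choose j) * S j) + of_nat (Suc C) * S C"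
      by (simp add: lessThan_Suc_atMost[symmetric] binomial_Suc_n)
    finally have eq: "int l ^ Suc C = (\<Sum>j<C. of_nat (Suc C choose j) * S j) + of_nat (Suc C) * S C" .
    have "int l dvd (\<Sum>j<C. of_nat (Suc C choose j) * S j)"
    proof (intro dvd_sum dvd_mult)
      fix j assume "j \<in> {..<C}"
      thus "int l dvd S j" unfolding S_def using less by simp
    qed
    moreover have "int l dvd int l ^ Suc C" by simp
    ultimately have "int l dvd of_nat (Suc C) * S C"
      unfolding eq by (simp only: dvd_add_right_iff)
    moreover have "\<not> l dvd Suc C" using less.prems by (auto dest: dvd_imp_le)
    hence "\<not> int l dvd int (Suc C)" by (simp only: int_dvd_int_iff not_False_eq_True)
    ultimately show ?case using l unfolding S_def[symmetric]
      by (metis prime_dvd_mult_iff prime_nat_int_transfer S_def)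
  qed
  ultimately show ?thesis by simp
qed

text \<open>Expanding one linear factor at a time ends in monomials w^i z^j of total degree below 2
  (l - 1), where one exponent is below l - 1 and its power sum vanishes. The factors w^i z^j are in
  the statement to carry this induction.\<close>

lemma zdvd_double_sum_low_degree:
  assumes l: "prime l" and r: "r \<in> Zsqrt2" and deg: "i + j + A + B < 2 * (l - 1)"
  shows "zdvd l (\<Sum>w\<in>{0..<int l}. \<Sum>z\<in>{0..<int l}. of_int w ^ i * of_int z ^ j *
      ((of_int w + r * of_int z) ^ A * (of_int w - r * of_int z) ^ B))"
  using deg
proof (induction A arbitrary: i j)
  case (Suc A)
  let ?f = "\<lambda>i j w z. of_int w ^ i * of_int z ^ j * ((of_int w + r * of_int z) ^ A * (of_int w - r * of_int z) ^ B)"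
  have "of_int w ^ i * of_int z ^ j * ((of_int w + r * of_int z) ^ Suc A * (of_int w - r * of_int z) ^ B)
      = ?f (Suc i) j w z + r * ?f i (Suc j) w z" for w z :: int
    by (simp add: algebra_simps)
  moreover have "zdvd l ((\<Sum>w\<in>{0..<int l}. \<Sum>z\<in>{0..<int l}. ?f (Suc i) j w z) + r * (\<Sum>w\<in>{0..<int l}. \<Sum>z\<in>{0..<int l}. ?f i (Suc j) w z))"
    using Suc.prems by (intro zdvd_add zdvd_mult r Suc.IH) auto
  ultimately show ?case by (simp only: sum.distrib sum_distrib_left)
next
  case 0
  thus ?case
  proof (induction B arbitrary: i j)
    case (Suc B)
    let ?f = "\<lambda>i j w z. of_int w ^ i * of_int z ^ j * ((of_int w + r * of_int z) ^ 0 * (of_int w - r * of_int z) ^ B)"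
    have "of_int w ^ i * of_int z ^ j * ((of_int w + r * of_int z) ^ 0 * (of_int w - r * of_int z) ^ Suc B)
        = ?f (Suc i) j w z - r * ?f i (Suc j) w z" for w z :: int
      by (simp add: algebra_simps)
    moreover have "zdvd l ((\<Sum>w\<in>{0..<int l}. \<Sum>z\<in>{0..<int l}. ?f (Suc i) j w z) - r * (\<Sum>w\<in>{0..<int l}. \<Sum>z\<in>{0..<int l}. ?f i (Suc j) w z))"
      using Suc.prems by (intro zdvd_diff zdvd_mult r Suc.IH) auto
    ultimately show ?case by (simp only: sum_subtractf sum_distrib_left)
  next
    case 0
    have "(\<Sum>w\<in>{0..<int l}. \<Sum>z\<in>{0..<int l}. of_int w ^ i * of_int z ^ j) =
        (of_int ((\<Sum>w\<in>{0..<int l}. w ^ i) * (\<Sum>z\<in>{0..<int l}. z ^ j)) :: real)"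
      by (simp add: sum_product)
    moreover have "i < l - 1 \<or> j < l - 1" using 0 by linarith
    hence "int l dvd (\<Sum>w\<in>{0..<int l}. w ^ i) * (\<Sum>z\<in>{0..<int l}. z ^ j)"
      using dvd_power_sum[OF l, of i] dvd_power_sum[OF l, of j] by auto
    ultimately have "zdvd l (\<Sum>w\<in>{0..<int l}. \<Sum>z\<in>{0..<int l}. of_int w ^ i * of_int z ^ j)"
      by (simp only: zdvd_of_int_iff)
    thus ?case by simp
  qed
qed

text \<open>In total degree exactly 2 (l - 1) a monomial with both exponents l - 1 could survive.
  But for A >= l Frobenius replaces the l-th power of w + r z by the linear form w + r^l z, and the
  degree drops to l - 1.\<close>

lemma zdvd_double_sum_high_power:
  assumes l: "prime l" "l > 2" and r: "r \<in> Zsqrt2" and deg: "A + B = 2 * (l - 1)" "A \<ge> l"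
  shows "zdvd l (\<Sum>w\<in>{0..<int l}. \<Sum>z\<in>{0..<int l}. (of_int w + r * of_int z) ^ A * (of_int w - r * of_int z) ^ B)"
proof -
  define x y where "x = (\<lambda>w z. of_int w + r * of_int z)" and "y = (\<lambda>w z. of_int w - r * of_int z)"
  have xy: "x w z \<in> Zsqrt2" "y w z \<in> Zsqrt2" for w z
    unfolding x_def y_def by (intro Zsqrt2_intros r Zsqrt2_of_int)+
  define g where "g = (\<lambda>w z. (of_int w + r ^ l * of_int z) * (x w z ^ (A - l) * y w z ^ B))"
  have "zdvd l (x w z ^ A * y w z ^ B - g w z)" for w z
  proof -
    have 1: "zdvd l (x w z ^ l - (of_int w ^ l + (r * of_int z) ^ l))"
      unfolding x_def by (intro zdvd_freshman l Zsqrt2_intros r Zsqrt2_of_int)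
    have "zdvd l ((of_int w ^ l - of_int w) + r ^ l * (of_int z ^ l - of_int z))"
      by (intro zdvd_add zdvd_mult zdvd_fermat l Zsqrt2_intros r)
    hence 2: "zdvd l ((of_int w ^ l + (r * of_int z) ^ l) - (of_int w + r ^ l * of_int z))"
      by (simp add: power_mult_distrib algebra_simps)
    have "zdvd l ((x w z ^ l - (of_int w + r ^ l * of_int z)) * (x w z ^ (A - l) * y w z ^ B))"
      by (intro zdvd_mult2 zdvd_diff_trans[OF 1 2] Zsqrt2_intros xy)
    moreover have "x w z ^ A = x w z ^ l * x w z ^ (A - l)" using deg by (simp flip: power_add)
    ultimately show ?thesis by (simp add: g_def algebra_simps)
  qed
  hence "zdvd l (\<Sum>w\<in>{0..<int l}. \<Sum>z\<in>{0..<int l}. x w z ^ A * y w z ^ B - g w z)"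
    by (intro zdvd_sum)
  hence "zdvd l ((\<Sum>w\<in>{0..<int l}. \<Sum>z\<in>{0..<int l}. x w z ^ A * y w z ^ B) - (\<Sum>w\<in>{0..<int l}. \<Sum>z\<in>{0..<int l}. g w z))"
    by (simp only: sum_subtractf)
  moreover have "zdvd l (\<Sum>w\<in>{0..<int l}. \<Sum>z\<in>{0..<int l}. g w z)"
  proof -
    let ?h = "\<lambda>i j w z. of_int w ^ i * of_int z ^ j * (x w z ^ (A - l) * y w z ^ B)"
    have "g w z = ?h 1 0 w z + r ^ l * ?h 0 1 w z" for w z
      by (simp add: g_def algebra_simps)
    moreover have "zdvd l ((\<Sum>w\<in>{0..<int l}. \<Sum>z\<in>{0..<int l}. ?h 1 0 w z) + r ^ l * (\<Sum>w\<in>{0..<int l}. \<Sum>z\<in>{0..<int l}. ?h 0 1 w z))"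
      unfolding x_def y_def using deg l(2)
      by (intro zdvd_add zdvd_mult zdvd_double_sum_low_degree l(1) r Zsqrt2_intros) auto
    ultimately show ?thesis by (simp only: sum.distrib sum_distrib_left)
  qed
  ultimately show ?thesis unfolding x_def y_def by (rule zdvd_of_diff)
qed

definition triple_moment :: "nat \<Rightarrow> nat \<Rightarrow> nat \<Rightarrow> nat \<Rightarrow> real" where
  "triple_moment l A B C = (\<Sum>w\<in>{0..<int l}. \<Sum>z\<in>{0..<int l}. \<Sum>t\<in>{0..<int l}.
     (of_int w + sqrt 2 * of_int z) ^ A * (of_int w - sqrt 2 * of_int z) ^ B * of_int t ^ C)"

text \<open>The moment is a sum over (w, z) times a sum over t. If C >= l - 1, then A + B is at most
  2 (l - 1); in the case of equality C = l - 1, so A and B differ and one of them is at least l. The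
  conjugation of \<open>sqrt 2\<close> exchanges A and B.\<close>

lemma zdvd_triple_moment:
  assumes l: "prime l" "l > 2" and deg: "A + B + C = 3 * (l - 1)" and ne: "\<not> (A = B \<and> B = C)"
  shows "zdvd l (triple_moment l A B C)"
proof -
  define D where "D = (\<Sum>w\<in>{0..<int l}. \<Sum>z\<in>{0..<int l}. (of_int w + sqrt 2 * of_int z) ^ A * (of_int w - sqrt 2 * of_int z) ^ B)"
  define E where "E = (\<Sum>t\<in>{0..<int l}. of_int t ^ C :: real)"
  have DE: "triple_moment l A B C = D * E"
  proof -
    have "triple_moment l A B C = (\<Sum>w\<in>{0..<int l}. \<Sum>z\<in>{0..<int l}.
        (of_int w + sqrt 2 * of_int z) ^ A * (of_int w - sqrt 2 * of_int z) ^ B * E)"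
      unfolding triple_moment_def E_def sum_distrib_left ..
    thus ?thesis unfolding D_def sum_distrib_right .
  qed
  have mem: "D \<in> Zsqrt2" "E \<in> Zsqrt2"
    unfolding D_def E_def by (intro Zsqrt2_intros Zsqrt2_of_int Zsqrt2_sqrt2)+
  consider "C < l - 1" | "A + B < 2 * (l - 1)" | "A + B = 2 * (l - 1)" "A \<ge> l" | "A + B = 2 * (l - 1)" "B \<ge> l"
    using deg ne l(2) by linarith
  thus ?thesis
  proof cases
    case 1
    have "int l dvd (\<Sum>t\<in>{0..<int l}. t ^ C)" by (rule dvd_power_sum[OF l(1) 1])
    hence "zdvd l E" unfolding zdvd_of_int_iff[symmetric] E_def by simp
    thus ?thesis unfolding DE by (intro zdvd_mult mem)
  next
    case 2
    have "zdvd l D" unfolding D_def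
      using zdvd_double_sum_low_degree[OF l(1) Zsqrt2_sqrt2, of 0 0 A B] 2 by simp
    thus ?thesis unfolding DE by (intro zdvd_mult2 mem)
  next
    case 3
    have "zdvd l D" unfolding D_def by (rule zdvd_double_sum_high_power[OF l Zsqrt2_sqrt2 3])
    thus ?thesis unfolding DE by (intro zdvd_mult2 mem)
  next
    case 4
    have "zdvd l (\<Sum>w\<in>{0..<int l}. \<Sum>z\<in>{0..<int l}. (of_int w + (- sqrt 2) * of_int z) ^ B * (of_int w - (- sqrt 2) * of_int z) ^ A)"
      by (rule zdvd_double_sum_high_power[OF l Zsqrt2_minus[OF Zsqrt2_sqrt2]]) (use 4 in auto)
    hence "zdvd l D" unfolding D_def by (simp add: mult.commute)
    thus ?thesis unfolding DE by (intro zdvd_mult2 mem)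
  qed
qed

lemma quadrinomial:
  fixes P Q R S :: real
  shows "(P + Q + R + S) ^ n = (\<Sum>i\<le>n. \<Sum>j\<le>n - i. \<Sum>k\<le>n - i - j.
     of_nat ((n choose i) * (n - i choose j) * (n - i - j choose k)) * (P ^ i * Q ^ j * R ^ k * S ^ (n - i - j - k)))"
proof -
  have "(P + Q + R + S) ^ n = (P + (Q + (R + S))) ^ n" by (simp add: add.assoc)
  also have "\<dots> = (\<Sum>i\<le>n. of_nat (n choose i) * P ^ i * (\<Sum>j\<le>n - i. of_nat (n - i choose j) * Q ^ j *
      (\<Sum>k\<le>n - i - j. of_nat (n - i - j choose k) * R ^ k * S ^ (n - i - j - k))))"
    by (simp only: binomial_ring)
  finally show ?thesis by (simp add: sum_distrib_left mult_ac)
qed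

definition form_moment :: "nat \<Rightarrow> real \<Rightarrow> real \<Rightarrow> real \<Rightarrow> real \<Rightarrow> real" where
  "form_moment l \<alpha> \<beta> \<gamma> \<kappa> = (\<Sum>w\<in>{0..<int l}. \<Sum>z\<in>{0..<int l}. \<Sum>t\<in>{0..<int l}.
     (\<alpha> * (of_int w + sqrt 2 * of_int z) ^ 3 + \<beta> * (of_int w - sqrt 2 * of_int z) ^ 3 + \<gamma> * of_int t ^ 3
       + \<kappa> * ((of_int w + sqrt 2 * of_int z) * (of_int w - sqrt 2 * of_int z) * of_int t)) ^ (l - 1))"

lemma form_moment_expand:
  "form_moment l \<alpha> \<beta> \<gamma> \<kappa> = (\<Sum>i\<le>l - 1. \<Sum>j\<le>l - 1 - i. \<Sum>k\<le>l - 1 - i - j.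
     of_nat ((l - 1 choose i) * (l - 1 - i choose j) * (l - 1 - i - j choose k)) *
     (\<alpha> ^ i * \<beta> ^ j * \<gamma> ^ k * \<kappa> ^ (l - 1 - i - j - k)) *
     triple_moment l (3 * i + (l - 1 - i - j - k)) (3 * j + (l - 1 - i - j - k)) (3 * k + (l - 1 - i - j - k)))"
  (is "_ = (\<Sum>i\<le>l - 1. \<Sum>j\<le>l - 1 - i. \<Sum>k\<le>l - 1 - i - j. ?c i j k * triple_moment l (?A i j k) (?B i j k) (?C i j k))")
proof -
  define x y :: "int \<Rightarrow> int \<Rightarrow> real" where "x = (\<lambda>w z. of_int w + sqrt 2 * of_int z)" and "y = (\<lambda>w z. of_int w - sqrt 2 * of_int z)"
  have mono: "(\<alpha> * u ^ 3) ^ i * (\<beta> * v ^ 3) ^ j * (\<gamma> * s ^ 3) ^ k * (\<kappa> * (u * v * s)) ^ e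
      = \<alpha> ^ i * \<beta> ^ j * \<gamma> ^ k * \<kappa> ^ e * (u ^ (3 * i + e) * v ^ (3 * j + e) * s ^ (3 * k + e))" for u v s i j k e
    by (simp add: power_mult_distrib power_add power_mult)
  have "form_moment l \<alpha> \<beta> \<gamma> \<kappa> = (\<Sum>w\<in>{0..<int l}. \<Sum>z\<in>{0..<int l}. \<Sum>t\<in>{0..<int l}.
      \<Sum>i\<le>l - 1. \<Sum>j\<le>l - 1 - i. \<Sum>k\<le>l - 1 - i - j. ?c i j k * (x w z ^ ?A i j k * y w z ^ ?B i j k * of_int t ^ ?C i j k))"
    unfolding form_moment_def quadrinomial
    by (intro sum.cong refl) (unfold mono, simp only: mult.assoc x_def y_def)
  also have "\<dots> = (\<Sum>i\<le>l - 1. \<Sum>w\<in>{0..<int l}. \<Sum>z\<in>{0..<int l}. \<Sum>t\<in>{0..<int l}.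
      \<Sum>j\<le>l - 1 - i. \<Sum>k\<le>l - 1 - i - j. ?c i j k * (x w z ^ ?A i j k * y w z ^ ?B i j k * of_int t ^ ?C i j k))"
    by (simp only: sum.swap[of _ "{..l - 1}"])
  also have "\<dots> = (\<Sum>i\<le>l - 1. \<Sum>j\<le>l - 1 - i. \<Sum>w\<in>{0..<int l}. \<Sum>z\<in>{0..<int l}. \<Sum>t\<in>{0..<int l}.
      \<Sum>k\<le>l - 1 - i - j. ?c i j k * (x w z ^ ?A i j k * y w z ^ ?B i j k * of_int t ^ ?C i j k))"
    by (intro sum.cong refl) (simp only: sum.swap[of _ "{..l - 1 - _}"])
  also have "\<dots> = (\<Sum>i\<le>l - 1. \<Sum>j\<le>l - 1 - i. \<Sum>k\<le>l - 1 - i - j. \<Sum>w\<in>{0..<int l}. \<Sum>z\<in>{0..<int l}. \<Sum>t\<in>{0..<int l}.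
      ?c i j k * (x w z ^ ?A i j k * y w z ^ ?B i j k * of_int t ^ ?C i j k))"
    by (intro sum.cong refl) (simp only: sum.swap[of _ "{..l - 1 - _ - _}"])
  finally show ?thesis
    unfolding triple_moment_def x_def y_def by (simp only: sum_distrib_left)
qed

text \<open>Modulo \<open>l\<close> the sum only sees the product of the three cubic coefficients, so it does not
  distinguish the curve from the twist with a rational flex.\<close>

lemma form_moment_twist:
  assumes l: "prime l" "l > 2" and mem: "\<alpha> \<in> Zsqrt2" "\<beta> \<in> Zsqrt2" "\<gamma> \<in> Zsqrt2" "\<kappa> \<in> Zsqrt2"
    "\<alpha>' \<in> Zsqrt2" "\<beta>' \<in> Zsqrt2" "\<gamma>' \<in> Zsqrt2"
    and prod: "\<alpha> * \<beta> * \<gamma> = \<alpha>' * \<beta>' * \<gamma>'"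
  shows "zdvd l (form_moment l \<alpha> \<beta> \<gamma> \<kappa> - form_moment l \<alpha>' \<beta>' \<gamma>' \<kappa>)"
proof -
  have "zdvd l (of_nat c * (\<alpha> ^ i * \<beta> ^ j * \<gamma> ^ k * \<kappa> ^ e) * triple_moment l (3 * i + e) (3 * j + e) (3 * k + e)
      - of_nat c * (\<alpha>' ^ i * \<beta>' ^ j * \<gamma>' ^ k * \<kappa> ^ e) * triple_moment l (3 * i + e) (3 * j + e) (3 * k + e))"
    if e: "i + j + k + e = l - 1" for i j k e c
  \<comment> \<open>The three exponents agree exactly for i = j = k, and then the term depends on
    the cubic coefficients only through their product.\<close>
  proof (cases "i = j \<and> j = k")
    case True
    have "\<alpha> ^ i * \<beta> ^ i * \<gamma> ^ i = \<alpha>' ^ i * \<beta>' ^ i * \<gamma>' ^ i"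
      unfolding power_mult_distrib[symmetric] prod ..
    thus ?thesis using True by simp
  next
    case False
    have "zdvd l (triple_moment l (3 * i + e) (3 * j + e) (3 * k + e))"
      by (rule zdvd_triple_moment[OF l]) (use e False in auto)
    thus ?thesis by (intro zdvd_diff zdvd_mult Zsqrt2_intros mem Zsqrt2_of_nat)
  qed
  thus ?thesis unfolding form_moment_expand sum_subtractf[symmetric]
    by (intro zdvd_sum) (auto simp del: of_nat_mult)
qed

section \<open>Counting zeros modulo a prime\<close>

definition cubic_form :: "int \<Rightarrow> int \<Rightarrow> int \<Rightarrow> int \<Rightarrow> int" where
  "cubic_form c w z t = w ^ 3 + 3 * w\<^sup>2 * z + 6 * w * z\<^sup>2 + 2 * z ^ 3 + 6 * (w\<^sup>2 - 2 * z\<^sup>2) * t + 2 * c * t ^ 3"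

text \<open>Half of x^3 + x'^3 + 16 c t^3 + 24 x x' t for x = w + z sqrt 2. The point (0 : 1 : 0) is
  the flex: its tangent is w = 4 t, on which the form becomes 8 (c + 32) t^3.\<close>

definition flex_form :: "int \<Rightarrow> int \<Rightarrow> int \<Rightarrow> int \<Rightarrow> int" where
  "flex_form c w z t = w ^ 3 + 6 * w * z\<^sup>2 + 12 * (w\<^sup>2 - 2 * z\<^sup>2) * t + 8 * c * t ^ 3"

lemma triple_sum_of_int:
  "(\<Sum>w\<in>A. \<Sum>z\<in>A. \<Sum>t\<in>A. of_int (f w z t)) = (of_int (\<Sum>w\<in>A. \<Sum>z\<in>A. \<Sum>t\<in>A. f w z t) :: real)"
  by simp

lemma form_moment_cubic_form:
  "form_moment l (2 + sqrt 2) (2 - sqrt 2) (of_int (8 * c)) 24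
     = of_int (\<Sum>w\<in>{0..<int l}. \<Sum>z\<in>{0..<int l}. \<Sum>t\<in>{0..<int l}. (4 * cubic_form c w z t) ^ (l - 1))"
proof -
  have s: "sqrt 2 * (sqrt 2 * x) = 2 * x" for x :: real
    by (simp flip: mult.assoc)
  have "(2 + sqrt 2) * (of_int w + sqrt 2 * of_int z) ^ 3 + (2 - sqrt 2) * (of_int w - sqrt 2 * of_int z) ^ 3
      + of_int (8 * c) * of_int t ^ 3 + 24 * ((of_int w + sqrt 2 * of_int z) * (of_int w - sqrt 2 * of_int z) * of_int t)
      = of_int (4 * cubic_form c w z t)" for w z t
    unfolding cubic_form_def by (simp add: algebra_simps power2_eq_square power3_eq_cube s)
  thus ?thesis unfolding form_moment_def triple_sum_of_int[symmetric] of_int_power by simp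
qed

lemma form_moment_flex_form:
  "form_moment l 1 1 (of_int (16 * c)) 24
     = of_int (\<Sum>w\<in>{0..<int l}. \<Sum>z\<in>{0..<int l}. \<Sum>t\<in>{0..<int l}. (2 * flex_form c w z t) ^ (l - 1))"
proof -
  have s: "sqrt 2 * (sqrt 2 * x) = 2 * x" for x :: real
    by (simp flip: mult.assoc)
  have "1 * (of_int w + sqrt 2 * of_int z) ^ 3 + 1 * (of_int w - sqrt 2 * of_int z) ^ 3
      + of_int (16 * c) * of_int t ^ 3 + 24 * ((of_int w + sqrt 2 * of_int z) * (of_int w - sqrt 2 * of_int z) * of_int t)
      = of_int (2 * flex_form c w z t)" for w z t
    unfolding flex_form_def by (simp add: algebra_simps power2_eq_square power3_eq_cube s)
  thus ?thesis unfolding form_moment_def triple_sum_of_int[symmetric] of_int_power by simp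
qed

lemma triple_sum_product:
  "(\<Sum>w\<in>A. \<Sum>z\<in>A. \<Sum>t\<in>A. f w z t) = (\<Sum>(w, z, t)\<in>A \<times> A \<times> A. f w z t)"
  by (simp add: sum.cartesian_product)

lemma sum_fermat_power:
  assumes l: "prime l" and S: "finite S"
  shows "[(\<Sum>v\<in>S. f v ^ (l - 1)) = int (card {v \<in> S. \<not> int l dvd f v})] (mod int l)"
proof -
  have l1: "l - 1 > 0" using prime_gt_1_nat[OF l] by simp
  have "[f v ^ (l - 1) = (if int l dvd f v then 0 else 1)] (mod int l)" for v
  proof (cases "int l dvd f v")
    case True
    thus ?thesis using l1 by (simp add: cong_0_iff dvd_trans[OF _ dvd_power])
  next
    case False
    define u where "u = nat (f v mod int l)"
    have u: "[int u = f v] (mod int l)" using prime_gt_0_nat[OF l] by (simp add: u_def cong_def)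
    have "\<not> l dvd u" using False u by (metis cong_dvd_iff int_dvd_int_iff)
    hence "[u ^ (l - 1) = 1] (mod l)" by (rule fermat_theorem[OF l])
    hence "[int u ^ (l - 1) = 1] (mod int l)" by (metis cong_int_iff of_nat_1 of_nat_power)
    thus ?thesis using cong_pow[OF u, of "l - 1"] False by (simp, meson cong_sym cong_trans)
  qed
  hence "[(\<Sum>v\<in>S. f v ^ (l - 1)) = (\<Sum>v\<in>S. if int l dvd f v then 0 else 1)] (mod int l)"
    by (intro cong_sum)
  moreover have "(\<Sum>v\<in>S. if int l dvd f v then 0 else 1) = int (card {v \<in> S. \<not> int l dvd f v})"
  proof -
    have "int (card {v \<in> S. \<not> int l dvd f v}) = (\<Sum>v\<in>{v \<in> S. \<not> int l dvd f v}. 1)" by simp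
    also have "\<dots> = (\<Sum>v\<in>S. if \<not> int l dvd f v then 1 else 0)" by (rule sum.inter_filter[OF S])
    also have "\<dots> = (\<Sum>v\<in>S. if int l dvd f v then 0 else 1)" by (intro sum.cong) auto
    finally show ?thesis by (rule sym)
  qed
  ultimately show ?thesis by (simp only:)
qed

definition zero_set :: "nat \<Rightarrow> (int \<Rightarrow> int \<Rightarrow> int \<Rightarrow> int) \<Rightarrow> (int \<times> int \<times> int) set" where
  "zero_set l f = {(w, z, t) \<in> {0..<int l} \<times> {0..<int l} \<times> {0..<int l}. int l dvd f w z t}"

text \<open>The count behind Chevalley-Warning: by Fermat each summand is 1 off the zero set and 0
  on it, and the total number l^3 of triples vanishes modulo l. The unit k absorbs the scalings 4
  and 2 of the two forms.\<close>

lemma triple_sum_zero_set: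
  assumes l: "prime l" and k: "\<not> int l dvd k"
  shows "[(\<Sum>w\<in>{0..<int l}. \<Sum>z\<in>{0..<int l}. \<Sum>t\<in>{0..<int l}. (k * f w z t) ^ (l - 1)) = - int (card (zero_set l f))] (mod int l)"
proof -
  define B where "B = {0..<int l} \<times> {0..<int l} \<times> {0..<int l}"
  have B: "finite B" by (simp add: B_def)
  have Z: "zero_set l f \<subseteq> B" by (auto simp: zero_set_def B_def)
  have "(\<Sum>w\<in>{0..<int l}. \<Sum>z\<in>{0..<int l}. \<Sum>t\<in>{0..<int l}. (k * f w z t) ^ (l - 1))
      = (\<Sum>v\<in>B. (case v of (w, z, t) \<Rightarrow> k * f w z t) ^ (l - 1))"
    unfolding triple_sum_product B_def by (intro sum.cong) auto
  also have "[\<dots> = int (card {v \<in> B. \<not> int l dvd (case v of (w, z, t) \<Rightarrow> k * f w z t)})] (mod int l)"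
    by (rule sum_fermat_power[OF l B])
  also have "{v \<in> B. \<not> int l dvd (case v of (w, z, t) \<Rightarrow> k * f w z t)} = B - zero_set l f"
    using l k unfolding zero_set_def B_def by (auto simp: prime_dvd_mult_iff)
  also have "card (B - zero_set l f) = card B - card (zero_set l f)"
    using Z B finite_subset by (intro card_Diff_subset) auto
  also have "int \<dots> = int (card B) - int (card (zero_set l f))"
    by (intro of_nat_diff card_mono B Z)
  also have "[\<dots> = 0 - int (card (zero_set l f))] (mod int l)"
    by (intro cong_diff cong_refl) (simp add: B_def cong_0_iff)
  finally show ?thesis by simp
qed

lemma card_zero_set_twist:
  assumes l: "prime l" "l > 2"
  shows "[int (card (zero_set l (cubic_form c))) = int (card (zero_set l (flex_form c)))] (mod int l)"
proof -
  define S1 where "S1 = (\<Sum>w\<in>{0..<int l}. \<Sum>z\<in>{0..<int l}. \<Sum>t\<in>{0..<int l}. (4 * cubic_form c w z t) ^ (l - 1))"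
  define S2 where "S2 = (\<Sum>w\<in>{0..<int l}. \<Sum>z\<in>{0..<int l}. \<Sum>t\<in>{0..<int l}. (2 * flex_form c w z t) ^ (l - 1))"
  \<comment> \<open>Hence both triples of cubic coefficients have product 16 c.\<close>
  have "(2 + sqrt 2) * (2 - sqrt 2) = 2" by (simp add: algebra_simps)
  hence "zdvd l (form_moment l (2 + sqrt 2) (2 - sqrt 2) (of_int (8 * c)) 24 - form_moment l 1 1 (of_int (16 * c)) 24)"
    by (intro form_moment_twist l Zsqrt2_of_int Zsqrt2_add Zsqrt2_diff Zsqrt2_numeral Zsqrt2_sqrt2) simp
  hence "zdvd l (of_int (S1 - S2))"
    unfolding form_moment_cubic_form form_moment_flex_form S1_def S2_def by simp
  hence S: "[S1 = S2] (mod int l)" unfolding zdvd_of_int_iff cong_iff_dvd_diff .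
  have n2: "\<not> int l dvd 2" using l(2) zdvd_not_zless[of 2 "int l"] by auto
  have n4: "\<not> int l dvd 4"
  proof
    assume "int l dvd 4"
    hence "int l dvd 2 * 2" by simp
    thus False using n2 l(1) prime_dvd_mult_iff[of "int l" 2 2] by auto
  qed
  have "[S1 = - int (card (zero_set l (cubic_form c)))] (mod int l)"
    unfolding S1_def by (rule triple_sum_zero_set[OF l(1) n4])
  moreover have "[S2 = - int (card (zero_set l (flex_form c)))] (mod int l)"
    unfolding S2_def by (rule triple_sum_zero_set[OF l(1) n2])
  ultimately have "[- int (card (zero_set l (cubic_form c))) = - int (card (zero_set l (flex_form c)))] (mod int l)"
    using S by (meson cong_sym cong_trans)
  thus ?thesis by (simp add: cong_minus_minus_iff)
qed

lemma cong_flex_form: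
  assumes "[w = w'] (mod m)" "[z = z'] (mod m)" "[t = t'] (mod m)"
  shows "[flex_form c w z t = flex_form c w' z' t'] (mod m)"
  unfolding flex_form_def by (intro cong_add cong_mult cong_diff cong_pow cong_refl assms)

definition flex_slice :: "nat \<Rightarrow> int \<Rightarrow> int \<Rightarrow> (int \<times> int) set" where
  "flex_slice l c t = {(w, z) \<in> {0..<int l} \<times> {0..<int l}. int l dvd flex_form c w z t}"

lemma finite_flex_slice [simp]: "finite (flex_slice l c t)"
  unfolding flex_slice_def by (rule finite_subset[of _ "{0..<int l} \<times> {0..<int l}"]) auto

lemma int_eq_if_dvd_diff:
  fixes x y m :: int
  assumes "m dvd x - y" "x \<in> {0..<m}" "y \<in> {0..<m}"
  shows "x = y"
proof -
  have "x mod m = y mod m" using assms(1) by (simp add: mod_eq_dvd_iff)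
  thus ?thesis using assms(2,3) by simp
qed

text \<open>Since the form is homogeneous, multiplication by a unit u embeds the slice at s into the
  slice at u s; t and its inverse give the two inequalities.\<close>

lemma card_flex_slice_scale:
  assumes l: "prime l" and t: "t \<in> {1..<int l}"
  shows "card (flex_slice l c 1) \<le> card (flex_slice l c t)" "card (flex_slice l c t) \<le> card (flex_slice l c 1)"
proof -
  have scale: "card (flex_slice l c s) \<le> card (flex_slice l c s')"
    if u: "\<not> int l dvd u" and us: "[u * s = s'] (mod int l)" for u s s'
  proof (rule card_inj_on_le)
    let ?f = "\<lambda>(w, z). ((u * w) mod int l, (u * z) mod int l)"
    have eq: "x = y" if "(u * x) mod int l = (u * y) mod int l" "x \<in> {0..<int l}" "y \<in> {0..<int l}" for x y
    proof -
      have "int l dvd u * (x - y)" using that(1) by (simp add: mod_eq_dvd_iff algebra_simps)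
      hence "int l dvd x - y" using u l by (simp add: prime_dvd_mult_iff)
      thus ?thesis using that(2,3) by (rule int_eq_if_dvd_diff)
    qed
    show "inj_on ?f (flex_slice l c s)"
      by (rule inj_onI) (auto simp: flex_slice_def intro!: eq)
    show "?f ` flex_slice l c s \<subseteq> flex_slice l c s'"
    proof (rule image_subsetI)
      fix v assume "v \<in> flex_slice l c s"
      then obtain w z where v: "v = (w, z)" and d: "int l dvd flex_form c w z s"
        by (auto simp: flex_slice_def)
      have "[flex_form c ((u * w) mod int l) ((u * z) mod int l) s' = flex_form c (u * w) (u * z) (u * s)] (mod int l)"
        by (intro cong_flex_form cong_sym[OF us]) (simp_all add: cong_def)
      moreover have "flex_form c (u * w) (u * z) (u * s) = u ^ 3 * flex_form c w z s"
        unfolding flex_form_def by (simp add: algebra_simps power2_eq_square power3_eq_cube)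
      ultimately have "int l dvd flex_form c ((u * w) mod int l) ((u * z) mod int l) s'"
        using d by (metis cong_dvd_iff dvd_mult)
      thus "?f v \<in> flex_slice l c s'"
        unfolding v flex_slice_def using prime_gt_0_nat[OF l] by simp
    qed
  qed simp
  have nt: "\<not> int l dvd t" using t zdvd_not_zless[of t "int l"] by auto
  show "card (flex_slice l c 1) \<le> card (flex_slice l c t)" by (rule scale[OF nt]) simp
  have "coprime t (int l)" using nt l by (metis coprime_commute prime_imp_coprime prime_nat_int_transfer)
  then obtain u where u: "[t * u = 1] (mod int l)" using cong_solve_coprime_int by blast
  hence "\<not> int l dvd u"
    using l by (metis cong_dvd_iff dvd_mult not_prime_unit prime_nat_int_transfer)
  thus "card (flex_slice l c t) \<le> card (flex_slice l c 1)" by (rule scale) (use u in \<open>simp add: mult.commute\<close>)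
qed

lemma card_zero_set_flex_form:
  assumes l: "prime l"
  shows "card (zero_set l (flex_form c)) = card (flex_slice l c 0) + (l - 1) * card (flex_slice l c 1)"
proof -
  have l0: "l > 0" using l prime_gt_0_nat by blast
  have "bij_betw (\<lambda>(t, w, z). (w, z, t)) (SIGMA t:{0..<int l}. flex_slice l c t) (zero_set l (flex_form c))"
    by (rule bij_betwI[where g = "\<lambda>(w, z, t). (t, w, z)"]) (auto simp: zero_set_def flex_slice_def)
  hence "card (zero_set l (flex_form c)) = card (SIGMA t:{0..<int l}. flex_slice l c t)"
    by (metis bij_betw_same_card)
  also have "\<dots> = (\<Sum>t\<in>{0..<int l}. card (flex_slice l c t))" by (rule card_SigmaI) auto
  also have "{0..<int l} = insert 0 {1..<int l}" using l0 by auto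
  also have "(\<Sum>t\<in>\<dots>. card (flex_slice l c t)) = card (flex_slice l c 0) + (\<Sum>t\<in>{1..<int l}. card (flex_slice l c t))"
    by simp
  also have "(\<Sum>t\<in>{1..<int l}. card (flex_slice l c t)) = (\<Sum>t\<in>{1..<int l}. card (flex_slice l c 1))"
    using card_flex_slice_scale[OF l] by (intro sum.cong refl antisym) auto
  also have "\<dots> = (l - 1) * card (flex_slice l c 1)"
  proof -
    have "nat (int l - 1) = l - 1" by linarith
    thus ?thesis by simp
  qed
  finally show ?thesis .
qed

text \<open>At t = 0 the twist is w (w^2 + 6 z^2), which splits into three distinct lines as -6 is a
  square. They meet only in the origin, so there are 3 (l - 1) + 1 solutions.\<close>

lemma card_flex_slice_infinity:
  assumes l: "prime l" "l > 3" and \<delta>: "[\<delta>\<^sup>2 = -6] (mod int l)"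
  shows "card (flex_slice l c 0) = 3 * l - 2"
proof -
  have l0: "int l > 0" using l by simp
  have n2: "\<not> int l dvd 2" "\<not> int l dvd 3" using l(2) zdvd_not_zless[of _ "int l"] by auto
  have nd: "\<not> int l dvd \<delta>"
  proof
    assume "int l dvd \<delta>"
    hence "int l dvd \<delta>\<^sup>2" by (simp add: power2_eq_square)
    hence "int l dvd - 6" using \<delta> cong_dvd_iff by blast
    hence "int l dvd 2 * 3" by simp
    thus False using n2 l(1) prime_dvd_mult_iff[of "int l" 2 3] by auto
  qed
  have fact: "[flex_form c w z 0 = w * ((w - \<delta> * z) * (w + \<delta> * z))] (mod int l)" for w z
  proof -
    have "[w * (w\<^sup>2 - (-6) * z\<^sup>2) = w * (w\<^sup>2 - \<delta>\<^sup>2 * z\<^sup>2)] (mod int l)"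
      by (intro cong_mult cong_diff cong_refl cong_sym[OF \<delta>])
    moreover have "w * (w\<^sup>2 - (-6) * z\<^sup>2) = flex_form c w z 0" "w * (w\<^sup>2 - \<delta>\<^sup>2 * z\<^sup>2) = w * ((w - \<delta> * z) * (w + \<delta> * z))"
      unfolding flex_form_def by (simp_all add: algebra_simps power2_eq_square power3_eq_cube)
    ultimately show ?thesis by metis
  qed
  have mem: "(w, z) \<in> flex_slice l c 0 \<longleftrightarrow> z \<in> {0..<int l} \<and> w \<in> {0, (\<delta> * z) mod int l, (- \<delta> * z) mod int l}" for w z
  proof -
    have "int l dvd flex_form c w z 0 \<longleftrightarrow> int l dvd w \<or> int l dvd w - \<delta> * z \<or> int l dvd w - (- \<delta> * z)"
      using cong_dvd_iff[OF fact] l(1) by (auto simp: prime_dvd_mult_iff)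
    also have "\<dots> \<longleftrightarrow> w mod int l = 0 \<or> w mod int l = (\<delta> * z) mod int l \<or> w mod int l = (- \<delta> * z) mod int l"
      by (simp only: mod_eq_dvd_iff dvd_eq_mod_eq_0)
    finally have E: "int l dvd flex_form c w z 0 \<longleftrightarrow> w mod int l \<in> {0, (\<delta> * z) mod int l, (- \<delta> * z) mod int l}"
      by simp
    show ?thesis
    proof (cases "w \<in> {0..<int l}")
      case True
      hence "w mod int l = w" by simp
      thus ?thesis using True E by (simp add: flex_slice_def)
    next
      case False
      hence "w \<notin> {0, (\<delta> * z) mod int l, (- \<delta> * z) mod int l}"
        using l0 pos_mod_bound[OF l0] pos_mod_sign[OF l0] by auto
      thus ?thesis using False by (auto simp: flex_slice_def)
    qed
  qed
  define U where "U = (\<lambda>z. {0, (\<delta> * z) mod int l, (- \<delta> * z) mod int l})"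
  have mem': "(w, z) \<in> flex_slice l c 0 \<longleftrightarrow> z \<in> {0..<int l} \<and> w \<in> U z" for w z
    unfolding U_def by (rule mem)
  have "bij_betw (\<lambda>(z, w). (w, z)) (SIGMA z:{0..<int l}. U z) (flex_slice l c 0)"
    by (rule bij_betwI[where g = "\<lambda>(w, z). (z, w)"]) (auto simp: mem')
  from bij_betw_same_card[OF this, symmetric]
  have "card (flex_slice l c 0) = card (SIGMA z:{0..<int l}. U z)" .
  also have "\<dots> = (\<Sum>z\<in>{0..<int l}. card (U z))" by (rule card_SigmaI) (simp_all add: U_def)
  also have "\<dots> = (\<Sum>z\<in>{0..<int l}. card {0, (\<delta> * z) mod int l, (- \<delta> * z) mod int l})" by (simp only: U_def)
  also have "{0..<int l} = insert 0 {1..<int l}" using l0 by auto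
  also have "(\<Sum>z\<in>\<dots>. card {0, (\<delta> * z) mod int l, (- \<delta> * z) mod int l}) = 1 + (\<Sum>z\<in>{1..<int l}. card {0, (\<delta> * z) mod int l, (- \<delta> * z) mod int l})"
    by simp
  also have "(\<Sum>z\<in>{1..<int l}. card {0, (\<delta> * z) mod int l, (- \<delta> * z) mod int l}) = (\<Sum>z\<in>{1..<int l}. 3)"
  proof (rule sum.cong[OF refl])
    fix z assume z: "z \<in> {1..<int l}"
    hence nz: "\<not> int l dvd z" using zdvd_not_zless[of z "int l"] by auto
    have "\<not> int l dvd \<delta> * z" using nz nd l(1) by (simp add: prime_dvd_mult_iff)
    moreover from this have "\<not> int l dvd \<delta> * z - (- \<delta> * z)"
    proof -
      have "\<delta> * z - (- \<delta> * z) = 2 * (\<delta> * z)" by simp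
      thus ?thesis using \<open>\<not> int l dvd \<delta> * z\<close> n2 l(1) prime_dvd_mult_iff[of "int l" 2] by auto
    qed
    hence "(\<delta> * z) mod int l \<noteq> (- \<delta> * z) mod int l" unfolding mod_eq_dvd_iff .
    moreover have "\<not> int l dvd - \<delta> * z" using calculation(1) by simp
    ultimately have "0 \<noteq> (\<delta> * z) mod int l" "0 \<noteq> (- \<delta> * z) mod int l" "(\<delta> * z) mod int l \<noteq> (- \<delta> * z) mod int l"
      by (metis dvd_eq_mod_eq_0)+
    thus "card {0, (\<delta> * z) mod int l, (- \<delta> * z) mod int l} = 3" by simp
  qed
  also have "\<dots> = (l - 1) * 3"
  proof -
    have "nat (int l - 1) = l - 1" by linarith
    thus ?thesis by simp
  qed
  finally show ?thesis using l by simp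
qed

text \<open>For fixed w the form is quadratic in z without linear term and with leading coefficient
  6 (w - 4), so it has at most two zeros. On the flex tangent w = 4 it is the nonzero constant 8 (c
  + 32).\<close>

lemma card_flex_slice_le:
  assumes l: "prime l" "l > 3" and bad: "\<not> int l dvd c + 32"
  shows "card (flex_slice l c 1) \<le> 2 * (l - 1)"
proof -
  have n2: "\<not> int l dvd 2" "\<not> int l dvd 3" using l(2) zdvd_not_zless[of _ "int l"] by auto
  \<comment> \<open>So l > 4, and 4 is one of the residues w that are summed over.\<close>
  have "l \<noteq> 2 * 2" using l(1) prime_product[of 2 2] by force
  hence l5: "l > 4" using l(2) by simp
  have ff: "flex_form c w z 1 = 2 * 3 * (w - 4) * z\<^sup>2 + (w ^ 3 + 12 * w\<^sup>2 + 8 * c)" for w z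
    unfolding flex_form_def by (simp add: algebra_simps power2_eq_square power3_eq_cube)
  define T where "T = (\<lambda>w. {z \<in> {0..<int l}. int l dvd flex_form c w z 1})"
  have finT: "finite (T w)" for w unfolding T_def by (rule finite_subset[of _ "{0..<int l}"]) auto
  have "flex_slice l c 1 = (SIGMA w:{0..<int l}. T w)" unfolding flex_slice_def T_def by auto
  also have "card \<dots> = (\<Sum>w\<in>{0..<int l}. card (T w))" by (rule card_SigmaI) (use finT in auto)
  also have "\<dots> \<le> (\<Sum>w\<in>{0..<int l}. if w = 4 then 0 else 2)"
  proof (rule sum_mono)
    fix w assume w: "w \<in> {0..<int l}"
    show "card (T w) \<le> (if w = 4 then 0 else 2)"
    proof (cases "w = 4")
      case True
      have "\<not> int l dvd flex_form c 4 z 1" for z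
      proof
        assume "int l dvd flex_form c 4 z 1"
        hence "int l dvd 2 * (2 * (2 * (c + 32)))" unfolding ff by (simp add: algebra_simps)
        thus False using bad n2 l(1) by (metis prime_dvd_mult_iff prime_nat_int_transfer)
      qed
      thus ?thesis using True by (simp add: T_def)
    next
      case False
      have nw: "\<not> int l dvd w - 4"
      proof
        assume "int l dvd w - 4"
        hence "w = 4" using w l by (intro int_eq_if_dvd_diff[of "int l"]) (auto simp: l5)
        thus False using False by simp
      qed
      show ?thesis
      proof (cases "T w = {}")
        case False
        then obtain z0 where z0: "z0 \<in> T w" by blast
        have "T w \<subseteq> {z0, (- z0) mod int l}"
        proof
          fix z assume z: "z \<in> T w"
          have "int l dvd flex_form c w z 1 - flex_form c w z0 1" using z z0 unfolding T_def by (intro dvd_diff) auto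
          also have "flex_form c w z 1 - flex_form c w z0 1 = 2 * (3 * ((w - 4) * ((z - z0) * (z - (- z0)))))"
            unfolding ff by (simp add: algebra_simps power2_eq_square)
          finally have "int l dvd z - z0 \<or> int l dvd z - (- z0)"
            using nw n2 l(1) by (metis prime_dvd_mult_iff prime_nat_int_transfer)
          thus "z \<in> {z0, (- z0) mod int l}"
          proof
            assume "int l dvd z - z0"
            hence "z = z0" using z z0 unfolding T_def by (intro int_eq_if_dvd_diff[of "int l"]) auto
            thus ?thesis by simp
          next
            assume "int l dvd z - (- z0)"
            hence "z mod int l = (- z0) mod int l" by (simp only: mod_eq_dvd_iff)
            thus ?thesis using z unfolding T_def by simp
          qed
        qed
        hence "card (T w) \<le> card {z0, (- z0) mod int l}" by (intro card_mono) auto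
        also have "\<dots> \<le> 2" by (simp add: card_insert_if)
        finally show ?thesis using \<open>w \<noteq> 4\<close> by simp
      qed simp
    qed
  qed
  also have "\<dots> = 2 * (l - 1)"
  proof -
    have "(4::int) \<in> {0..<int l}" using l5 by auto
    hence "(\<Sum>w\<in>{0..<int l}. if w = 4 then 0 else 2) = (\<Sum>w\<in>{0..<int l} - {4}. 2::nat)"
      by (subst sum.remove[of _ 4]) auto
    thus ?thesis using \<open>4 \<in> {0..<int l}\<close> by simp
  qed
  finally show ?thesis .
qed

lemma three_dvd_card_free_action:
  assumes S: "finite S" and fS: "\<And>x. x \<in> S \<Longrightarrow> f x \<in> S" and f3: "\<And>x. x \<in> S \<Longrightarrow> f (f (f x)) = x"
    and free: "\<And>x. x \<in> S \<Longrightarrow> f x \<noteq> x"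
  shows "3 dvd card S"
proof -
  define orb where "orb = (\<lambda>x. {x, f x, f (f x)})"
  have U: "\<Union> (orb ` S) = S" using fS by (auto simp: orb_def)
  have orb_eq: "orb y = orb x" if "x \<in> S" "y \<in> orb x" for x y
    using that f3[OF that(1)] f3[OF fS[OF that(1)]] by (auto simp: orb_def)
  have "card (orb x) = 3" if x: "x \<in> S" for x
  proof -
    have "f (f x) \<noteq> x"
    proof
      assume "f (f x) = x"
      hence "f (f (f x)) = f x" by simp
      thus False using f3[OF x] free[OF x] by simp
    qed
    thus ?thesis using free[OF x] free[OF fS[OF x]] by (auto simp: orb_def)
  qed
  hence c3: "\<forall>o1\<in>orb ` S. 3 dvd card o1" by simp
  have "3 dvd card (\<Union> (orb ` S))"
  proof (rule dvd_partition)
    show "finite (\<Union> (orb ` S))" unfolding U by (rule S)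
    show "\<forall>o1\<in>orb ` S. 3 dvd card o1" by (rule c3)
    show "\<forall>o1\<in>orb ` S. \<forall>o2\<in>orb ` S. o1 \<noteq> o2 \<longrightarrow> o1 \<inter> o2 = {}"
    proof (intro ballI impI)
      fix o1 o2 assume "o1 \<in> orb ` S" "o2 \<in> orb ` S" and ne: "o1 \<noteq> o2"
      then obtain x y where xy: "x \<in> S" "y \<in> S" "o1 = orb x" "o2 = orb y" by auto
      show "o1 \<inter> o2 = {}"
      proof (rule ccontr)
        assume "o1 \<inter> o2 \<noteq> {}"
        then obtain v where "v \<in> orb x" "v \<in> orb y" using xy by auto
        hence "orb x = orb y" using orb_eq[OF xy(1)] orb_eq[OF xy(2)] by metis
        thus False using ne xy by simp
      qed
    qed
  qed
  thus ?thesis by (simp add: U)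
qed

text \<open>Multiplication of \<open>w + z * sqrt 2\<close> by the primitive cube root of unity
  \<open>(- 1 + (\<delta> / 2) * sqrt 2) / 2\<close> acts freely on the affine points.\<close>

lemma three_dvd_card_flex_slice:
  assumes l: "prime l" "l > 3" and \<delta>: "[\<delta>\<^sup>2 = -6] (mod int l)" and c: "\<not> int l dvd c"
  shows "3 dvd card (flex_slice l c 1)"
proof -
  define m where "m = int l"
  have pm: "prime m" and m0: "m > 0" using l by (auto simp: m_def)
  have n2: "\<not> m dvd 2" "\<not> m dvd 3" using l(2) zdvd_not_zless[of _ m] by (auto simp: m_def)
  have n4: "\<not> m dvd 4"
    using n2 pm prime_dvd_mult_iff[of m 2 2] by auto
  have "coprime 4 m" using n4 pm by (metis coprime_commute prime_imp_coprime)
  then obtain u where u: "[4 * u = 1] (mod m)" using cong_solve_coprime_int by blast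
  \<comment> \<open>Four times the coordinates of (w + z sqrt 2) multiplied by the cube root of
    unity; \<open>u\<close> below undoes the factor 4.\<close>
  define P Q where "P = (\<lambda>w z. - 2 * w + 2 * \<delta> * z)" and "Q = (\<lambda>w z. \<delta> * w - 2 * z)"
  define f where "f = (\<lambda>(w, z). ((u * P w z) mod m, (u * Q w z) mod m))"
  have \<delta>': "m dvd \<delta>\<^sup>2 + 6" using \<delta> by (simp add: m_def cong_iff_dvd_diff)
  have PQ: "[P w z = P w' z'] (mod m)" "[Q w z = Q w' z'] (mod m)" if "[w = w'] (mod m)" "[z = z'] (mod m)" for w z w' z'
    unfolding P_def Q_def by (intro cong_add cong_mult cong_diff cong_refl that)+
  have fm: "[fst (f v) = u * P (fst v) (snd v)] (mod m)" "[snd (f v) = u * Q (fst v) (snd v)] (mod m)" for v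
    by (auto simp: f_def cong_def split: prod.splits)
  have u4: "[4 * (u * x) = x] (mod m)" for x
    using cong_mult[OF u cong_refl[of x]] by (simp add: mult.assoc)
  have cancel4: "m dvd x" if "m dvd 4 * x" for x
    using that n4 pm by (simp add: prime_dvd_mult_iff)
  have f4: "[4 * fst (f v) = P (fst v) (snd v)] (mod m)" "[4 * snd (f v) = Q (fst v) (snd v)] (mod m)" for v
    using cong_trans[OF cong_mult[OF cong_refl[of 4] fm(1)] u4] cong_trans[OF cong_mult[OF cong_refl[of 4] fm(2)] u4] .
  have box: "f v \<in> {0..<m} \<times> {0..<m}" for v
    using m0 by (auto simp: f_def split: prod.splits)
  have flexbox: "v \<in> flex_slice l c 1 \<longleftrightarrow> v \<in> {0..<m} \<times> {0..<m} \<and> m dvd flex_form c (fst v) (snd v) 1" for v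
    by (auto simp: flex_slice_def m_def)
  show ?thesis
  proof (rule three_dvd_card_free_action[where f = f])
    fix v assume v: "v \<in> flex_slice l c 1"
    obtain w z where wz: "v = (w, z)" by (cases v)
    have vm: "m dvd flex_form c w z 1" using v by (simp add: wz flexbox)
    show "f v \<in> flex_slice l c 1"
    proof -
      obtain w1 z1 where 1: "f v = (w1, z1)" by (cases "f v")
      have c1: "[4 * w1 = P w z] (mod m)" "[4 * z1 = Q w z] (mod m)" using f4[of v, unfolded 1] by (simp_all add: wz)
      have "64 * flex_form c w1 z1 1 = (4 * w1) ^ 3 + 6 * (4 * w1) * (4 * z1)\<^sup>2 + 48 * ((4 * w1)\<^sup>2 - 2 * (4 * z1)\<^sup>2) + 512 * c"
        unfolding flex_form_def by (simp add: algebra_simps power2_eq_square power3_eq_cube)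
      also have "[\<dots> = (P w z) ^ 3 + 6 * (P w z) * (Q w z)\<^sup>2 + 48 * ((P w z)\<^sup>2 - 2 * (Q w z)\<^sup>2) + 512 * c] (mod m)"
        by (rule cong_add[OF cong_add[OF cong_add[OF cong_pow[OF c1(1)]
            cong_mult[OF cong_mult[OF cong_refl c1(1)] cong_pow[OF c1(2)]]]
            cong_mult[OF cong_refl cong_diff[OF cong_pow[OF c1(1)] cong_mult[OF cong_refl cong_pow[OF c1(2)]]]]] cong_refl])
      also have "(P w z) ^ 3 + 6 * (P w z) * (Q w z)\<^sup>2 + 48 * ((P w z)\<^sup>2 - 2 * (Q w z)\<^sup>2) + 512 * c
          = 64 * flex_form c w z 1 + (\<delta>\<^sup>2 + 6) * (- 64 * w * z\<^sup>2 + P w z * (6 * w\<^sup>2 + 4 * z\<^sup>2) + 48 * (4 * z\<^sup>2 - 2 * w\<^sup>2))"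
      proof -
        \<comment> \<open>The cubic part is A (A^2 + 6 B^2) and the quadratic part is the norm A^2 -
          2 B^2. Up to multiples of \<delta>^2 + 6 they are 64 and 16 times their values at (w,
          z).\<close>
        define A B where "A = P w z" and "B = Q w z"
        have i1: "A\<^sup>2 - 2 * B\<^sup>2 = 16 * (w\<^sup>2 - 2 * z\<^sup>2) + (\<delta>\<^sup>2 + 6) * (4 * z\<^sup>2 - 2 * w\<^sup>2)"
          unfolding A_def B_def P_def Q_def by (simp add: algebra_simps power2_eq_square)
        have i2: "A\<^sup>2 + 6 * B\<^sup>2 = - 32 * w * (w + \<delta> * z) + (\<delta>\<^sup>2 + 6) * (6 * w\<^sup>2 + 4 * z\<^sup>2)"
          unfolding A_def B_def P_def Q_def by (simp add: algebra_simps power2_eq_square)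
        have i3: "A * (- 32 * w * (w + \<delta> * z)) = 64 * w * (w\<^sup>2 + 6 * z\<^sup>2) - (\<delta>\<^sup>2 + 6) * (64 * w * z\<^sup>2)"
          unfolding A_def P_def by (simp add: algebra_simps power2_eq_square)
        have "A ^ 3 + 6 * A * B\<^sup>2 + 48 * (A\<^sup>2 - 2 * B\<^sup>2) + 512 * c = A * (A\<^sup>2 + 6 * B\<^sup>2) + 48 * (A\<^sup>2 - 2 * B\<^sup>2) + 512 * c"
          by (simp add: algebra_simps power2_eq_square power3_eq_cube)
        also have "\<dots> = A * (- 32 * w * (w + \<delta> * z)) + (\<delta>\<^sup>2 + 6) * (A * (6 * w\<^sup>2 + 4 * z\<^sup>2))
            + 48 * (16 * (w\<^sup>2 - 2 * z\<^sup>2)) + (\<delta>\<^sup>2 + 6) * (48 * (4 * z\<^sup>2 - 2 * w\<^sup>2)) + 512 * c"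
          unfolding i1 i2 by (simp only: distrib_left mult.left_commute add.assoc)
        also have "\<dots> = 64 * flex_form c w z 1 + (\<delta>\<^sup>2 + 6) * (- 64 * w * z\<^sup>2 + A * (6 * w\<^sup>2 + 4 * z\<^sup>2) + 48 * (4 * z\<^sup>2 - 2 * w\<^sup>2))"
          unfolding i3 flex_form_def by (simp add: algebra_simps power2_eq_square power3_eq_cube)
        finally show ?thesis unfolding A_def B_def .
      qed
      finally have "m dvd 64 * flex_form c w1 z1 1"
        using cong_dvd_iff dvd_add[OF dvd_mult[OF vm] dvd_mult2[OF \<delta>']] by blast
      hence "m dvd 4 * (4 * (4 * flex_form c w1 z1 1))" by simp
      hence "m dvd flex_form c w1 z1 1" by (rule cancel4[OF cancel4[OF cancel4]])
      thus ?thesis using box[of v] by (simp add: flexbox 1)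
    qed
    show "f (f (f v)) = v"
    proof -
      obtain w1 z1 where 1: "f v = (w1, z1)" by (cases "f v")
      obtain w2 z2 where 2: "f (w1, z1) = (w2, z2)" by (cases "f (w1, z1)")
      obtain w3 z3 where 3: "f (w2, z2) = (w3, z3)" by (cases "f (w2, z2)")
      have c1: "[4 * w1 = P w z] (mod m)" "[4 * z1 = Q w z] (mod m)" using f4[of v, unfolded 1] by (simp_all add: wz)
      have c2: "[4 * w2 = P w1 z1] (mod m)" "[4 * z2 = Q w1 z1] (mod m)" using f4[of "(w1, z1)", unfolded 2] by simp_all
      have c3: "[4 * w3 = P w2 z2] (mod m)" "[4 * z3 = Q w2 z2] (mod m)" using f4[of "(w2, z2)", unfolded 3] by simp_all
      have lin: "4 * P x y = P (4 * x) (4 * y)" "4 * Q x y = Q (4 * x) (4 * y)" for x y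
        by (simp_all add: P_def Q_def algebra_simps)
      have d2: "[4 * (4 * w2) = P (P w z) (Q w z)] (mod m)" "[4 * (4 * z2) = Q (P w z) (Q w z)] (mod m)"
        using cong_trans[OF cong_mult[OF cong_refl[of 4] c2(1)]] cong_trans[OF cong_mult[OF cong_refl[of 4] c2(2)]] PQ[OF c1]
        unfolding lin by blast+
      have "[4 * (4 * (4 * w3)) = P (4 * (4 * w2)) (4 * (4 * z2))] (mod m)" "[4 * (4 * (4 * z3)) = Q (4 * (4 * w2)) (4 * (4 * z2))] (mod m)"
        using cong_mult[OF cong_refl[of 4] cong_mult[OF cong_refl[of 4] c3(1)]] cong_mult[OF cong_refl[of 4] cong_mult[OF cong_refl[of 4] c3(2)]]
        unfolding lin .
      hence d3: "[4 * (4 * (4 * w3)) = P (P (P w z) (Q w z)) (Q (P w z) (Q w z))] (mod m)"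
          "[4 * (4 * (4 * z3)) = Q (P (P w z) (Q w z)) (Q (P w z) (Q w z))] (mod m)"
        using PQ[OF d2] cong_trans by blast+
      have id: "P (P (P w z) (Q w z)) (Q (P w z) (Q w z)) = 64 * w + (\<delta>\<^sup>2 + 6) * (2 * P w z - 8 * w)"
          "Q (P (P w z) (Q w z)) (Q (P w z) (Q w z)) = 64 * z + (\<delta>\<^sup>2 + 6) * (2 * Q w z - 8 * z)"
        by (simp_all add: P_def Q_def algebra_simps power2_eq_square)
      have "m dvd 4 * (4 * (4 * (w3 - w)))"
      proof -
        have "m dvd 4 * (4 * (4 * w3)) - (64 * w + (\<delta>\<^sup>2 + 6) * (2 * P w z - 8 * w))"
          using d3(1) unfolding id cong_iff_dvd_diff .
        hence "m dvd (4 * (4 * (4 * w3)) - (64 * w + (\<delta>\<^sup>2 + 6) * (2 * P w z - 8 * w))) + (\<delta>\<^sup>2 + 6) * (2 * P w z - 8 * w)"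
          by (rule dvd_add[OF _ dvd_mult2[OF \<delta>']])
        thus ?thesis by (simp add: algebra_simps)
      qed
      hence "m dvd w3 - w" by (rule cancel4[OF cancel4[OF cancel4]])
      moreover have "m dvd 4 * (4 * (4 * (z3 - z)))"
      proof -
        have "m dvd 4 * (4 * (4 * z3)) - (64 * z + (\<delta>\<^sup>2 + 6) * (2 * Q w z - 8 * z))"
          using d3(2) unfolding id cong_iff_dvd_diff .
        hence "m dvd (4 * (4 * (4 * z3)) - (64 * z + (\<delta>\<^sup>2 + 6) * (2 * Q w z - 8 * z))) + (\<delta>\<^sup>2 + 6) * (2 * Q w z - 8 * z)"
          by (rule dvd_add[OF _ dvd_mult2[OF \<delta>']])
        thus ?thesis by (simp add: algebra_simps)
      qed
      hence "m dvd z3 - z" by (rule cancel4[OF cancel4[OF cancel4]])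
      moreover have "w \<in> {0..<m}" "z \<in> {0..<m}" using v by (simp_all add: flexbox wz)
      moreover have "w3 \<in> {0..<m}" "z3 \<in> {0..<m}" using box[of "(w2, z2)"] by (simp_all add: 3)
      ultimately have "w3 = w" "z3 = z" by (blast intro: int_eq_if_dvd_diff)+
      thus ?thesis unfolding 1 2 3 by (simp add: wz)
    qed
    show "f v \<noteq> v"
    proof
      assume fix': "f v = v"
      have c1: "m dvd 4 * w - P w z" "m dvd 4 * z - Q w z"
        using f4[of v] unfolding fix' by (simp_all add: wz cong_iff_dvd_diff)
      have six: "m dvd x" if "m dvd 2 * (3 * x)" for x
        using that n2 pm by (metis prime_dvd_mult_iff)
      \<comment> \<open>The combination that eliminates z: it equals 48 w.\<close>
      have "m dvd 6 * (4 * w - P w z) + 2 * \<delta> * (4 * z - Q w z) + 2 * w * (\<delta>\<^sup>2 + 6)"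
        by (rule dvd_add[OF dvd_add[OF dvd_mult[OF c1(1)] dvd_mult[OF c1(2)]] dvd_mult[OF \<delta>']])
      also have "6 * (4 * w - P w z) + 2 * \<delta> * (4 * z - Q w z) + 2 * w * (\<delta>\<^sup>2 + 6) = 4 * (2 * (3 * (2 * w)))"
        by (simp add: P_def Q_def algebra_simps power2_eq_square)
      finally have "m dvd 2 * w" by (rule six[OF cancel4])
      hence w: "m dvd w" using n2 pm by (simp add: prime_dvd_mult_iff)
      have "m dvd (4 * z - Q w z) + \<delta> * w" by (rule dvd_add[OF c1(2) dvd_mult[OF w]])
      also have "(4 * z - Q w z) + \<delta> * w = 2 * (3 * z)" by (simp add: Q_def)
      finally have z: "m dvd z" by (rule six)
      \<comment> \<open>Only the origin is fixed, and the form has the value 8 c there.\<close>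
      have "w = 0" "z = 0" using w z v int_eq_if_dvd_diff[of m w 0] int_eq_if_dvd_diff[of m z 0] m0 by (simp_all add: flexbox wz)
      hence "m dvd 4 * (2 * c)" using vm by (simp add: flex_form_def)
      hence "m dvd 2 * c" by (rule cancel4)
      thus False using c n2 pm by (simp add: m_def prime_dvd_mult_iff)
    qed
  qed simp
qed

text \<open>If the trivial zero is the only one, (3 l - 2) + (l - 1) N is 1 modulo l, so l divides N
  + 3, the number of projective points of the twist. N + 3 is below 3 l and thus l or 2 l, while 3
  divides N.\<close>

lemma nontrivial_zero_residue:
  assumes l: "prime l" "l > 3" and \<delta>: "[\<delta>\<^sup>2 = -6] (mod int l)" and c: "\<not> int l dvd c" "\<not> int l dvd c + 32"
  shows "\<exists>w z t. int l dvd cubic_form c w z t \<and> \<not> (int l dvd w \<and> int l dvd z \<and> int l dvd t)"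
proof (rule ccontr)
  assume no: "\<not> ?thesis"
  define N where "N = card (flex_slice l c 1)"
  have "zero_set l (cubic_form c) = {(0, 0, 0)}"
  proof (intro equalityI subsetI)
    fix v assume "v \<in> zero_set l (cubic_form c)"
    then obtain w z t where v: "v = (w, z, t)" and b: "w \<in> {0..<int l}" "z \<in> {0..<int l}" "t \<in> {0..<int l}"
      and d: "int l dvd cubic_form c w z t" by (auto simp: zero_set_def)
    have "int l dvd w" "int l dvd z" "int l dvd t" using no d by blast+
    hence "w = 0" "z = 0" "t = 0" using b int_eq_if_dvd_diff[of "int l" _ 0] l by auto
    thus "v \<in> {(0, 0, 0)}" by (simp add: v)
  next
    fix v :: "int \<times> int \<times> int" assume "v \<in> {(0, 0, 0)}"
    thus "v \<in> zero_set l (cubic_form c)" using l by (simp add: zero_set_def cubic_form_def)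
  qed
  hence "[1 = int (card (zero_set l (flex_form c)))] (mod int l)"
    using card_zero_set_twist[of l c] l by simp
  also have "card (zero_set l (flex_form c)) = (3 * l - 2) + (l - 1) * N"
    using card_zero_set_flex_form[OF l(1)] card_flex_slice_infinity[OF l \<delta>] by (simp add: N_def)
  also have "int \<dots> = 1 + (int l * (3 + int N) - (int N + 3))"
  proof -
    have e: "int (3 * l - 2) = 3 * int l - 2" "int (l - 1) = int l - 1" using l(2) by auto
    show ?thesis unfolding of_nat_add of_nat_mult e by (simp add: algebra_simps)
  qed
  finally have "int l dvd 1 - (1 + (int l * (3 + int N) - (int N + 3)))" by (simp only: cong_iff_dvd_diff)
  hence "int l dvd (1 - (1 + (int l * (3 + int N) - (int N + 3)))) + int l * (3 + int N)" by (intro dvd_add dvd_triv_left)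
  hence "int l dvd int (N + 3)" by (simp add: add.commute)
  hence "l dvd N + 3" by (simp only: int_dvd_int_iff)
  then obtain k where k: "N + 3 = l * k" by (elim dvdE)
  have "N \<le> 2 * (l - 1)" unfolding N_def by (rule card_flex_slice_le[OF l c(2)])
  hence "l * k < l * 3" using k l(2) by linarith
  hence "k < 3" by simp
  moreover have "k \<noteq> 0" using k by (intro notI) simp
  moreover have "3 dvd l * k"
    using three_dvd_card_flex_slice[OF l \<delta> c(1)] unfolding k[symmetric] N_def by simp
  hence "3 dvd l \<or> 3 dvd k" by (simp add: prime_dvd_mult_iff)
  moreover have "\<not> 3 dvd l" using l primes_dvd_imp_eq[of 3 l] by auto
  ultimately show False by (auto dest: dvd_imp_le)
qed

section \<open>Points at infinity when -6 is a nonresidue\<close>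

text \<open>Frobenius sends e = 1 + sqrt 2 to 1 + s sqrt 2 with s the symbol of 2, and the symbol of
  -6 ties s to l modulo 3. If l = 2 modulo 3, then s = 1, so e^(l-1) = 1; otherwise s = -1 and
  e^(l+1) is the norm -1, so e^(2(l+1)) = 1. Either exponent is 1 modulo 3.\<close>

lemma unit_power_residue:
  assumes l: "prime l" "l > 3" and L: "Legendre (-6) (int l) = -1"
  obtains m where "zdvd l ((1 + sqrt 2) ^ (3 * m + 1) - 1)"
proof -
  define e where "e = 1 + sqrt 2"
  have e: "e \<in> Zsqrt2" by (simp add: e_def Zsqrt2_add)
  have inv: "(sqrt 2 - 1) * e = 1" by (simp add: e_def algebra_simps)
  have im: "sqrt 2 - 1 \<in> Zsqrt2" by (simp add: Zsqrt2_diff)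
  have g: "prime (int l)" "int l > 2" "int l > 3" using l by auto
  have odd: "odd l" using l by (intro prime_odd_nat) auto
  define k where "k = (l - 1) div 2"
  have k: "l = 2 * k + 1" using odd by (simp add: k_def)
  define s where "s = Legendre 2 (int l)"
  have "[s = 2 ^ k] (mod int l)"
    unfolding s_def k_def using euler_criterion[of l 2] l by simp
  hence "zdvd l (of_int (2 ^ k - s))" unfolding zdvd_of_int_iff by (simp add: cong_iff_dvd_diff dvd_diff_commute)
  hence "zdvd l (sqrt 2 * of_int (2 ^ k - s))" by (intro zdvd_mult Zsqrt2_sqrt2)
  moreover have "sqrt 2 ^ l = sqrt 2 * 2 ^ k" unfolding k by (simp add: power_mult)
  ultimately have "zdvd l ((1 + sqrt 2 ^ l) - (1 + of_int s * sqrt 2))" by (simp add: algebra_simps)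
  moreover have "zdvd l (e ^ l - (1 ^ l + sqrt 2 ^ l))"
    unfolding e_def by (intro zdvd_freshman l Zsqrt2_numeral Zsqrt2_sqrt2)
  ultimately have frob: "zdvd l (e ^ l - (1 + of_int s * sqrt 2))"
    using zdvd_diff_trans[of l "e ^ l" "1 + sqrt 2 ^ l"] by simp
  have six: "Legendre (-3) (int l) * s = -1" using Legendre_mult[OF g(1,2), of "-3" 2] L by (simp add: s_def)
  have m3: "l mod 3 = 1 \<or> l mod 3 = 2"
  proof -
    have "\<not> 3 dvd l" using l primes_dvd_imp_eq[of 3 l] by auto
    thus ?thesis by presburger
  qed
  have ml: "int l mod 3 = 1 \<longleftrightarrow> l mod 3 = 1" by presburger
  show ?thesis
  proof (cases "l mod 3 = 1")
    case False
    hence "s = 1" using six Legendre_minus_three[OF g(1,3)] ml by simp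
    hence "zdvd l ((sqrt 2 - 1) * (e ^ l - e))" using frob by (intro zdvd_mult im) (simp add: e_def)
    moreover have "l = Suc (l - 1)" using l by simp
    hence "e ^ l = e * e ^ (l - 1)" by (metis power_Suc)
    hence "(sqrt 2 - 1) * (e ^ l - e) = ((sqrt 2 - 1) * e) * e ^ (l - 1) - (sqrt 2 - 1) * e" by (simp add: algebra_simps)
    ultimately have "zdvd l (e ^ (l - 1) - 1)" unfolding inv by simp
    moreover have "l - 1 = 3 * ((l - 2) div 3) + 1" using m3 False l(2) by presburger
    ultimately have "zdvd l (e ^ (3 * ((l - 2) div 3) + 1) - 1)" by (simp only:)
    thus ?thesis unfolding e_def by (rule that)
  next
    case True
    hence "s = -1" using six Legendre_minus_three[OF g(1,3)] ml by simp
    hence "zdvd l (e * (e ^ l - (1 - sqrt 2)))" using frob by (intro zdvd_mult e) simp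
    moreover have "e * (e ^ l - (1 - sqrt 2)) = e ^ (l + 1) + 1"
      using inv by (simp add: algebra_simps)
    ultimately have "zdvd l ((e ^ (l + 1) - 1) * (e ^ (l + 1) + 1))"
      by (intro zdvd_mult Zsqrt2_intros e Zsqrt2_numeral) simp
    moreover have "(e ^ (l + 1) - 1) * (e ^ (l + 1) + 1) = e ^ (2 * (l + 1)) - 1"
    proof -
      have "e ^ (2 * (l + 1)) = e ^ (l + 1) * e ^ (l + 1)" by (simp only: mult_2 power_add)
      moreover have "(y - 1) * (y + 1) = y * y - 1" for y :: real by (simp add: algebra_simps)
      ultimately show ?thesis by (simp only:)
    qed
    moreover have "2 * (l + 1) = 3 * ((2 * l + 1) div 3) + 1" using True by presburger
    ultimately have "zdvd l (e ^ (3 * ((2 * l + 1) div 3) + 1) - 1)" by (simp only:)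
    thus ?thesis unfolding e_def by (rule that)
  qed
qed

text \<open>Take x = e^m with e = 1 + sqrt 2. Since 2 + sqrt 2 = e sqrt 2, (2 + sqrt 2) x^3 =
  e^(3m+1) sqrt 2 is congruent to sqrt 2, whose rational part is 0; that part is 2 (A + B), twice
  the form at t = 0. As x is a unit, its coordinates are not both divisible by l.\<close>

lemma nontrivial_zero_nonresidue:
  assumes l: "prime l" "l > 3" and L: "Legendre (-6) (int l) = -1"
  shows "\<exists>w z. int l dvd cubic_form c w z 0 \<and> \<not> (int l dvd w \<and> int l dvd z)"
proof -
  obtain m where m: "zdvd l ((1 + sqrt 2) ^ (3 * m + 1) - 1)" by (rule unit_power_residue[OF assms])
  have "(1 + sqrt 2) ^ m \<in> Zsqrt2" by (intro Zsqrt2_intros) simp_all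
  then obtain w z where x: "(1 + sqrt 2) ^ m = of_int w + of_int z * sqrt 2" unfolding Zsqrt2_def by blast
  define A B where "A = w ^ 3 + 6 * w * z\<^sup>2" and "B = 3 * w\<^sup>2 * z + 2 * z ^ 3"
  have "\<not> (int l dvd w \<and> int l dvd z)"
  proof
    assume "int l dvd w \<and> int l dvd z"
    hence "zdvd l (of_int w)" "zdvd l (of_int z)" unfolding zdvd_of_int_iff by auto
    hence "zdvd l ((sqrt 2 - 1) ^ m * (1 + sqrt 2) ^ m)"
      unfolding x by (intro zdvd_mult zdvd_add zdvd_mult2 Zsqrt2_intros Zsqrt2_sqrt2 Zsqrt2_numeral)
    moreover have "(sqrt 2 - 1) ^ m * (1 + sqrt 2) ^ m = ((sqrt 2 - 1) * (1 + sqrt 2)) ^ m" by (simp only: power_mult_distrib)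
    moreover have "(sqrt 2 - 1) * (1 + sqrt 2) = 1" by (simp add: algebra_simps)
    ultimately have "zdvd l (of_int 1)" by simp
    thus False using l unfolding zdvd_of_int_iff by simp
  qed
  moreover have "int l dvd cubic_form c w z 0"
  proof -
    have s: "sqrt 2 * (sqrt 2 * y) = 2 * y" for y :: real by (simp flip: mult.assoc)
    have "sqrt 2 * ((1 + sqrt 2) ^ (3 * m + 1)) = (2 + sqrt 2) * ((1 + sqrt 2) ^ m) ^ 3"
      by (simp add: algebra_simps power_mult[symmetric] s)
    also have "\<dots> = of_int (2 * (A + B)) + of_int (A + 2 * B) * sqrt 2"
      unfolding x A_def B_def by (simp add: algebra_simps power2_eq_square power3_eq_cube s)
    finally have eq: "sqrt 2 * ((1 + sqrt 2) ^ (3 * m + 1) - 1) = of_int (2 * (A + B)) + of_int (A + 2 * B - 1) * sqrt 2"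
      by (simp add: algebra_simps)
    have "zdvd l (sqrt 2 * ((1 + sqrt 2) ^ (3 * m + 1) - 1))" by (intro zdvd_mult m Zsqrt2_sqrt2)
    then obtain i j where "of_int (2 * (A + B)) + of_int (A + 2 * B - 1) * sqrt 2 = of_nat l * (of_int i + of_int j * sqrt 2)"
      unfolding eq zdvd_def Zsqrt2_def by blast
    hence "of_int (2 * (A + B) - int l * i) + of_int (A + 2 * B - 1 - int l * j) * sqrt 2 = 0"
      by (simp add: algebra_simps)
    hence "2 * (A + B) = int l * i" using sqrt2_coords_unique by fastforce
    hence "int l dvd 2 * (A + B)" by simp
    moreover have "\<not> int l dvd 2" using l zdvd_not_zless[of 2 "int l"] by auto
    ultimately have "int l dvd A + B" using l(1) by (metis prime_dvd_mult_iff prime_nat_int_transfer)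
    thus ?thesis by (simp add: cubic_form_def A_def B_def algebra_simps)
  qed
  ultimately show ?thesis by blast
qed

section \<open>Partial derivatives and singular points modulo a prime\<close>

definition cubic_dw :: "int \<Rightarrow> int \<Rightarrow> int \<Rightarrow> int" where
  "cubic_dw w z t = 3 * w\<^sup>2 + 6 * w * z + 6 * z\<^sup>2 + 12 * w * t"
definition cubic_dz :: "int \<Rightarrow> int \<Rightarrow> int \<Rightarrow> int" where
  "cubic_dz w z t = 3 * w\<^sup>2 + 12 * w * z + 6 * z\<^sup>2 - 24 * z * t"
definition cubic_dt :: "int \<Rightarrow> int \<Rightarrow> int \<Rightarrow> int \<Rightarrow> int" where
  "cubic_dt c w z t = 6 * (w\<^sup>2 - 2 * z\<^sup>2) + 6 * c * t\<^sup>2"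

text \<open>Modulo t the difference of the two derivatives is 6 w z, and once w or z vanishes the
  first derivative kills the other.\<close>

lemma cubic_singular_at_infinity:
  fixes m :: int
  assumes m: "prime m" "m > 3" and d: "m dvd cubic_dw w z t" "m dvd cubic_dz w z t" and t: "m dvd t"
  shows "m dvd w \<and> m dvd z"
proof -
  have n2: "\<not> m dvd 2" "\<not> m dvd 3" using m(2) zdvd_not_zless[of _ m] by auto
  have can: "m dvd y" if "m dvd 2 * y \<or> m dvd 3 * y" for y
    using that n2 m(1) by (auto simp: prime_dvd_mult_iff)
  have "m dvd cubic_dz w z t - cubic_dw w z t + 12 * (2 * z + w) * t"
    using d t by (intro dvd_add dvd_diff dvd_mult)
  also have "\<dots> = 3 * (2 * (w * z))" by (simp add: cubic_dw_def cubic_dz_def algebra_simps)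
  finally have "m dvd w * z" using can by blast
  hence wz: "m dvd w \<or> m dvd z" using m(1) by (simp add: prime_dvd_mult_iff)
  have "m dvd cubic_dw w z t - 12 * w * t" using d t by (intro dvd_diff dvd_mult)
  also have "\<dots> = 3 * (w\<^sup>2 + 2 * w * z + 2 * z\<^sup>2)" by (simp add: cubic_dw_def)
  finally have E: "m dvd w\<^sup>2 + 2 * w * z + 2 * z\<^sup>2" using can by blast
  from wz show ?thesis
  proof
    assume w: "m dvd w"
    have "m dvd w\<^sup>2 + 2 * w * z + 2 * z\<^sup>2 - w * (w + 2 * z)" using E w by (intro dvd_diff dvd_mult2)
    also have "\<dots> = 2 * z\<^sup>2" by (simp add: algebra_simps power2_eq_square)
    finally have "m dvd z\<^sup>2" using can by blast
    thus ?thesis using w m(1) prime_dvd_power by blast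
  next
    assume z: "m dvd z"
    have "m dvd w\<^sup>2 + 2 * w * z + 2 * z\<^sup>2 - z * (2 * w + 2 * z)" using E z by (intro dvd_diff dvd_mult2)
    also have "\<dots> = w\<^sup>2" by (simp add: algebra_simps power2_eq_square)
    finally show ?thesis using z m(1) prime_dvd_power by blast
  qed
qed

text \<open>For x = w + z sqrt 2, U + V sqrt 2 is (2 + sqrt 2) x^2, and the first two derivatives
  vanish when this equals -8 t times the conjugate of x. Taking norms, 2 n^2 = 64 n t^2. The third
  derivative gives n = - c t^2, so t is 0 unless c or c + 32 is.\<close>

lemma cubic_singular:
  fixes m :: int
  assumes m: "prime m" "m > 3" and c: "\<not> m dvd c" "\<not> m dvd c + 32"
    and d: "m dvd cubic_dw w z t" "m dvd cubic_dz w z t" "m dvd cubic_dt c w z t"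
  shows "m dvd w \<and> m dvd z \<and> m dvd t"
proof -
  have n2: "\<not> m dvd 2" "\<not> m dvd 3" using m(2) zdvd_not_zless[of _ m] by auto
  have can: "m dvd y" if "m dvd 2 * y \<or> m dvd 3 * y" for y
    using that n2 m(1) by (auto simp: prime_dvd_mult_iff)
  define n where "n = w\<^sup>2 - 2 * z\<^sup>2"
  define U V where "U = 2 * w\<^sup>2 + 4 * z\<^sup>2 + 4 * w * z" and "V = w\<^sup>2 + 2 * z\<^sup>2 + 4 * w * z"
  have "m dvd 3 * (U + 8 * w * t)"
  proof -
    have "3 * (U + 8 * w * t) = 2 * cubic_dw w z t" by (simp add: U_def cubic_dw_def)
    thus ?thesis using d(1) by simp
  qed
  hence U: "m dvd U + 8 * w * t" using can by blast
  have "m dvd 3 * (V - 8 * z * t)"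
  proof -
    have "3 * (V - 8 * z * t) = cubic_dz w z t" by (simp add: V_def cubic_dz_def)
    thus ?thesis using d(2) by simp
  qed
  hence V: "m dvd V - 8 * z * t" using can by blast
  have "cubic_dt c w z t = 2 * (3 * (n + c * t\<^sup>2))" by (simp add: cubic_dt_def n_def)
  hence n: "m dvd n + c * t\<^sup>2" using d(3) can by metis
  have "m dvd (U + 8 * w * t) * (U - 8 * w * t) - 2 * ((V - 8 * z * t) * (V + 8 * z * t))"
    by (intro dvd_diff dvd_mult dvd_mult2 U V)
  also have "\<dots> = 2 * (n * (n - 32 * t\<^sup>2))"
    unfolding U_def V_def n_def by (simp add: algebra_simps power2_eq_square)
  finally have "m dvd n * (n - 32 * t\<^sup>2)" using can by blast
  hence "m dvd n \<or> m dvd n - 32 * t\<^sup>2" using m(1) by (simp add: prime_dvd_mult_iff)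
  hence "m dvd t\<^sup>2"
  proof
    assume "m dvd n"
    hence "m dvd (n + c * t\<^sup>2) - n" using n by (intro dvd_diff)
    thus ?thesis using c(1) m(1) by (simp add: prime_dvd_mult_iff)
  next
    assume "m dvd n - 32 * t\<^sup>2"
    hence "m dvd (n + c * t\<^sup>2) - (n - 32 * t\<^sup>2)" by (rule dvd_diff[OF n])
    hence "m dvd (c + 32) * t\<^sup>2" by (simp add: algebra_simps)
    thus ?thesis using c(2) m(1) prime_dvd_mult_iff by blast
  qed
  hence t: "m dvd t" using m(1) prime_dvd_power by blast
  thus ?thesis using cubic_singular_at_infinity[OF m d(1,2) t] by blast
qed

text \<open>A nonresidue -6 gives a point at infinity, which is smooth even where the curve has bad
  reduction. If -6 is a residue and l is not p - 6, then l divides neither c nor c + 32 = (p + 2)(p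
  - 4)^2, so every nontrivial zero is smooth.\<close>

lemma (in prime_constellation) smooth_zero_mod:
  assumes l: "prime l" "l > 3"
  shows "\<exists>w z t. int l dvd cubic_form (p\<^sup>2 * (p - 6)) w z t \<and>
    \<not> (int l dvd cubic_dw w z t \<and> int l dvd cubic_dz w z t \<and> int l dvd cubic_dt (p\<^sup>2 * (p - 6)) w z t)"
proof -
  define c where "c = p\<^sup>2 * (p - 6)"
  have g: "prime (int l)" "int l > 3" using l by auto
  have n2: "\<not> int l dvd 2" "\<not> int l dvd 3" using g(2) zdvd_not_zless[of _ "int l"] by auto
  have "\<not> int l dvd 2 * 3" using n2 g(1) prime_dvd_mult_iff[of "int l" 2 3] by blast
  hence n6: "\<not> int l dvd - 6" by simp
  have "Legendre (-6) (int l) \<noteq> 0" unfolding Legendre_def cong_0_iff using n6 by simp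
  then consider (q) "int l = p - 6" | (N) "Legendre (-6) (int l) = -1" | (R) "Legendre (-6) (int l) = 1" "int l \<noteq> p - 6"
    using Legendre_cases[of "-6" "int l"] by blast
  hence "\<exists>w z t. int l dvd cubic_form c w z t \<and>
    \<not> (int l dvd cubic_dw w z t \<and> int l dvd cubic_dz w z t \<and> int l dvd cubic_dt c w z t)"
  proof cases
    case q
    \<comment> \<open>Modulo p - 6 the coefficient c vanishes, and on z = 0 the form is w^2 (w + 6
      t), with the simple root w = 6 at t = -1.\<close>
    have "cubic_form c 6 0 (-1) = (p - 6) * (- 2 * p\<^sup>2)" by (simp add: cubic_form_def c_def)
    hence "int l dvd cubic_form c 6 0 (-1)" unfolding q by (rule dvdI)
    moreover have "cubic_dw 6 0 (-1) = 2 * 3 * (2 * 3)" by (simp add: cubic_dw_def)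
    hence "\<not> int l dvd cubic_dw 6 0 (-1)" using n2 g(1) by (metis prime_dvd_mult_iff)
    ultimately show ?thesis by blast
  next
    case N
    then obtain w z where wz: "int l dvd cubic_form c w z 0" "\<not> (int l dvd w \<and> int l dvd z)"
      using nontrivial_zero_nonresidue[OF l] by blast
    hence "\<not> (int l dvd cubic_dw w z 0 \<and> int l dvd cubic_dz w z 0)"
      using cubic_singular_at_infinity[OF g, of w z 0] by auto
    thus ?thesis using wz(1) by blast
  next
    case R
    have L6: "Legendre (-6) x = Legendre (-1) x * Legendre 2 x * Legendre 3 x" if "prime x" "x > 2" for x :: int
      using Legendre_mult[OF that, of "-1 * 2" 3] Legendre_mult[OF that, of "-1" 2] by simp
    have "Legendre (-6) p = -1" "Legendre (-6) (p + 2) = -1" "Legendre (-6) (p - 4) = -1"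
      using L6[OF p] L6[OF h] L6[OF prime_constellation.l[OF prime_constellation_axioms]] p_gt Legendre_at_p Legendre_at_h Legendre_at_l by simp_all
    hence ne: "int l \<noteq> p" "int l \<noteq> p + 2" "int l \<noteq> p - 4" using R(1) by auto
    have c1: "\<not> int l dvd c"
    proof
      assume "int l dvd c"
      hence "int l dvd p \<or> int l dvd p - 6" using g(1) unfolding c_def by (metis prime_dvd_mult_iff prime_dvd_power)
      thus False using distinct_primes[OF g(1)] ne R(2) by blast
    qed
    have c2: "\<not> int l dvd c + 32"
    proof
      assume "int l dvd c + 32"
      moreover have "c + 32 = (p + 2) * (p - 4)\<^sup>2" by (simp add: c_def algebra_simps power2_eq_square)
      ultimately have "int l dvd p + 2 \<or> int l dvd p - 4" using g(1) by (metis prime_dvd_mult_iff prime_dvd_power)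
      thus False using distinct_primes[OF g(1)] ne by blast
    qed
    have "QuadRes (int l) (-6)" using R(1) by (auto simp: Legendre_def split: if_splits)
    then obtain \<delta> where "[\<delta>\<^sup>2 = -6] (mod int l)" by (auto simp: QuadRes_def)
    from nontrivial_zero_residue[OF l this c1 c2] cubic_singular[OF g c1 c2] show ?thesis by blast
  qed
  thus ?thesis unfolding c_def .
qed

section \<open>Local points\<close>

text \<open>Only one coordinate is lifted, so a cubic in one variable suffices. The recursion keeps
  the exponent \<open>Suc n\<close>; the result is weakened to n to match
  \<open>padic_closure_point\<close>.\<close>

lemma hensel_cubic:
  fixes a0 a1 a2 a3 x0 :: int
  defines "g \<equiv> \<lambda>x. a0 + a1 * x + a2 * x\<^sup>2 + a3 * x ^ 3"
  assumes l: "prime l" and x0: "int l dvd g x0" and d0: "\<not> int l dvd a1 + 2 * a2 * x0 + 3 * a3 * x0\<^sup>2"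
  obtains s :: "nat \<Rightarrow> int" where "\<And>n. int l ^ n dvd g (s n)" "\<And>n. int l ^ n dvd s (Suc n) - s n" "\<And>n. int l dvd s n - x0"
proof -
  let ?P = "\<lambda>n x. int l ^ Suc n dvd g x \<and> int l dvd x - x0"
  let ?Q = "\<lambda>n x y. int l ^ Suc n dvd y - x"
  have "\<exists>s. \<forall>n. ?P n (s n) \<and> ?Q n (s n) (s (Suc n))"
  proof (rule dependent_nat_choice)
    show "\<exists>x. ?P 0 x" using x0 by (intro exI[of _ x0]) simp
  next
    fix x n assume x: "?P n x"
    define L where "L = int l ^ Suc n"
    obtain k where k: "g x = L * k" using x unfolding L_def by (auto elim: dvdE)
    define D where "D = a1 + 2 * a2 * x + 3 * a3 * x\<^sup>2"
    have "[D = a1 + 2 * a2 * x0 + 3 * a3 * x0\<^sup>2] (mod int l)"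
      unfolding D_def using x by (intro cong_add cong_mult cong_pow cong_refl) (simp_all add: cong_iff_dvd_diff)
    hence "\<not> int l dvd D" using d0 by (simp add: cong_dvd_iff)
    hence "coprime D (int l)" using l by (metis coprime_commute prime_imp_coprime prime_nat_int_transfer)
    then obtain u where u: "[D * u = 1] (mod int l)" using cong_solve_coprime_int by blast
    define t where "t = - k * u"
    define y where "y = x + L * t"
    have gy: "g y = L * (k + t * D) + L * L * (t\<^sup>2 * (a2 + 3 * a3 * x) + L * t ^ 3 * a3)"
    proof -
      have "g y = g x + L * (t * D) + L * L * (t\<^sup>2 * (a2 + 3 * a3 * x) + L * t ^ 3 * a3)"
        unfolding g_def y_def D_def by (simp add: algebra_simps power2_eq_square power3_eq_cube)
      thus ?thesis unfolding k by (simp add: algebra_simps)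
    qed
    have "int l dvd - k * (D * u - 1)" using u by (simp add: cong_iff_dvd_diff)
    hence "int l dvd k + t * D" by (simp add: t_def algebra_simps)
    hence f1: "L * int l dvd L * (k + t * D)" by (intro mult_dvd_mono dvd_refl)
    have "int l dvd L" unfolding L_def by simp
    hence f2: "L * int l dvd L * L" by (intro mult_dvd_mono dvd_refl)
    have "L * int l dvd g y" unfolding gy by (rule dvd_add[OF f1 dvd_mult2[OF f2]])
    moreover have "L * int l = int l ^ Suc (Suc n)" by (simp add: L_def)
    moreover have "int l dvd (x - x0) + L * t" using x \<open>int l dvd L\<close> by (intro dvd_add dvd_mult2) auto
    hence "int l dvd y - x0" by (simp add: y_def algebra_simps)
    moreover have "L dvd y - x" by (simp add: y_def)
    ultimately show "\<exists>y. ?P (Suc n) y \<and> ?Q n x y" unfolding L_def by metis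
  qed
  then obtain s where s: "\<And>n. int l ^ Suc n dvd g (s n)" "\<And>n. int l dvd s n - x0" "\<And>n. int l ^ Suc n dvd s (Suc n) - s n"
    by blast
  have "int l ^ n dvd int l ^ Suc n" for n by simp
  hence "int l ^ n dvd g (s n)" "int l ^ n dvd s (Suc n) - s n" for n using s dvd_trans by blast+
  thus ?thesis using that s(2) by blast
qed

lemma padic_abs_power_dvd:
  assumes l: "prime l" and d: "int l ^ n dvd a"
  shows "padic_abs l (of_int a) \<le> (1 / real l) ^ n"
proof -
  interpret v: rat_abs_value "padic_abs l" by (rule padic_abs_value[OF l])
  have l0: "l > 0" "l > 1" using l prime_gt_0_nat prime_gt_1_nat by blast+
  have pw: "padic_abs l (y ^ n) = padic_abs l y ^ n" for y n by (induction n) (simp_all add: v.mult)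
  have "multiplicity (int l) (int l) = 1" using l0 by (intro multiplicity_self) (auto simp: zdvd1_eq)
  hence L: "padic_abs l (of_int (int l)) = 1 / real l"
    using padic_abs_divide[OF l, of "int l" 1] l0 by (simp add: power_int_minus inverse_eq_divide)
  obtain b where "a = int l ^ n * b" using d by (elim dvdE)
  hence "padic_abs l (of_int a) = (1 / real l) ^ n * padic_abs l (of_int b)"
    using L by (simp add: v.mult pw)
  also have "\<dots> \<le> (1 / real l) ^ n * 1" by (intro mult_left_mono padic_abs_of_int l) simp
  finally show ?thesis by simp
qed

lemma padic_power_small:
  assumes "prime l" "e > 0" shows "\<exists>N. (1 / real l) ^ N < e"
  using assms real_arch_pow_inv[of e "1 / real l"] prime_gt_1_nat[of l] by auto

lemma padic_int_seq_cauchy: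
  assumes l: "prime l" and s: "\<And>n. int l ^ n dvd s (Suc n) - s n"
  shows "(\<lambda>n. of_int (s n)) \<in> cauchy_seqs (padic_abs l)"
  unfolding cauchy_seqs_def
proof (clarsimp)
  fix e :: real assume "e > 0"
  then obtain N where N: "(1 / real l) ^ N < e" using padic_power_small[OF l] by blast
  have d: "int l ^ N dvd s (N + k) - s N" for k
  proof (induction k)
    case (Suc k)
    have "int l ^ N dvd int l ^ (N + k)" by (simp add: le_imp_power_dvd)
    hence "int l ^ N dvd s (Suc (N + k)) - s (N + k)" using s dvd_trans by blast
    hence "int l ^ N dvd (s (Suc (N + k)) - s (N + k)) + (s (N + k) - s N)" using Suc by (rule dvd_add)
    thus ?case by simp
  qed simp
  have "padic_abs l (of_int (s m) - of_int (s n)) < e" if "m \<ge> N" "n \<ge> N" for m n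
  proof -
    have "int l ^ N dvd s m - s n"
      using dvd_diff[OF d[of "m - N"] d[of "n - N"]] that by simp
    hence "padic_abs l (of_int (s m - s n)) \<le> (1 / real l) ^ N" by (intro padic_abs_power_dvd l) simp
    thus ?thesis using N by simp
  qed
  thus "\<exists>N. \<forall>m\<ge>N. \<forall>n\<ge>N. padic_abs l (of_int (s m) - of_int (s n)) < e" by blast
qed

lemma padic_int_seq_null:
  assumes l: "prime l" and s: "\<And>n. int l ^ n dvd s n"
  shows "(\<lambda>n. of_int (s n)) \<in> null_seqs (padic_abs l)"
proof -
  interpret v: rat_abs_value "padic_abs l" by (rule padic_abs_value[OF l])
  have lim: "(\<lambda>n. (1 / real l) ^ n) \<longlonglongrightarrow> 0"
    using prime_gt_1_nat[OF l] by (intro LIMSEQ_power_zero) simp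
  have e1: "\<forall>\<^sub>F n in sequentially. 0 \<le> padic_abs l (of_int (s n))"
    by (simp add: v.nonneg)
  have e2: "\<forall>\<^sub>F n in sequentially. padic_abs l (of_int (s n)) \<le> (1 / real l) ^ n"
    by (intro always_eventually allI padic_abs_power_dvd[OF l s])
  show ?thesis unfolding null_seqs_def mem_Collect_eq
    by (rule tendsto_sandwich[OF e1 e2 tendsto_const lim])
qed

lemma padic_int_seq_not_null:
  assumes l: "prime l" and s: "\<And>n. \<not> int l dvd s n"
  shows "(\<lambda>n. of_int (s n)) \<notin> null_seqs (padic_abs l)"
  using padic_abs_of_int(2)[OF l s] by (simp add: null_seqs_def LIMSEQ_const_iff)

section \<open>From integer sequences to points over the completions\<close>

context rat_abs_value
begin

lemma cauchy_ring_pow: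
  "s [^]\<^bsub>cauchy_ring v\<^esub> (k :: nat) = (\<lambda>n. s n ^ k)"
  by (induction k) (simp_all add: nat_pow_def cauchy_ring_def mult.commute)

lemma cauchy_ring_finsum:
  assumes "finite A" "\<And>a. a \<in> A \<Longrightarrow> g a \<in> cauchy_seqs v"
  shows "finsum (cauchy_ring v) g A = (\<lambda>n. \<Sum>a\<in>A. g a n)"
proof -
  interpret C: cring "cauchy_ring v" by (rule cauchy_ring_cring)
  show ?thesis
    using assms
  proof (induction A)
    case empty
    show ?case unfolding C.finsum_empty by (simp add: cauchy_ring_def)
  next
    case (insert a A)
    have "finsum (cauchy_ring v) g (insert a A) = g a \<oplus>\<^bsub>cauchy_ring v\<^esub> finsum (cauchy_ring v) g A"
      using insert by (intro C.finsum_insert) (auto simp: cauchy_ring_def)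
    also have "finsum (cauchy_ring v) g A = (\<lambda>n. \<Sum>a\<in>A. g a n)" using insert by simp
    finally show ?case using insert(1,2) by (simp add: cauchy_ring_def)
  qed
qed

lemma cauchy_power: "s \<in> cauchy_seqs v \<Longrightarrow> (\<lambda>n. s n ^ k) \<in> cauchy_seqs v"
  by (induction k) (simp_all add: const_cauchy cauchy_mult)

text \<open>The coset map is a ring homomorphism, so the form may be evaluated termwise on rational
  sequences. Being a zero in the completion then means that the values form a null sequence.\<close>

lemma eval_homogenization_completion:
  assumes fin: "finite (bimonomials f)" and c: "x \<in> cauchy_seqs v" "y \<in> cauchy_seqs v" "t \<in> cauchy_seqs v"
  defines "\<rho> \<equiv> \<lambda>s. null_seqs v +>\<^bsub>cauchy_ring v\<^esub> s"
  shows "eval_homogenization (completion v) (completion_emb v) f (\<rho> x, \<rho> y, \<rho> t)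
    = \<rho> (\<lambda>n. eval_homogenization ring_of_type_algebra of_rat f (x n, y n, t n))"
proof -
  interpret C: cring "cauchy_ring v" by (rule cauchy_ring_cring)
  interpret K: cring "completion v" by (rule completion_cring)
  interpret h: ring_hom_cring "cauchy_ring v" "completion v" \<rho>
    unfolding \<rho>_def by (intro ring_hom_cring.intro ring_hom_cring_axioms.intro C.is_cring K.is_cring coset_hom)
  interpret Q: field "ring_of_type_algebra :: rat ring" by (rule field_from_type_algebra)
  define q where "q = (\<lambda>(i, j). Polynomial.coeff (Polynomial.coeff f j) i)"
  define g where "g = (\<lambda>(i, j) n. q (i, j) * x n ^ i * y n ^ j * t n ^ (total_degree f - (i + j)))"
  have car: "x \<in> carrier (cauchy_ring v)" "y \<in> carrier (cauchy_ring v)" "t \<in> carrier (cauchy_ring v)"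
      "(\<lambda>n. r) \<in> carrier (cauchy_ring v)" for r
    using c const_cauchy by (simp_all add: cauchy_ring_def)
  have gc: "g ij \<in> cauchy_seqs v" for ij
    unfolding g_def by (cases ij) (auto intro!: cauchy_mult cauchy_power const_cauchy c)
  have fs: "finsum (ring_of_type_algebra :: rat ring) k A = sum k A" if "finite A" for k :: "nat \<times> nat \<Rightarrow> rat" and A
    using that by (induction A) (simp_all add: Q.finsum_insert ring_of_type_algebra_simps)
  have trm: "\<rho> (g (i, j)) = completion_emb v (q (i, j)) \<otimes>\<^bsub>completion v\<^esub> \<rho> x [^]\<^bsub>completion v\<^esub> i
      \<otimes>\<^bsub>completion v\<^esub> \<rho> y [^]\<^bsub>completion v\<^esub> j \<otimes>\<^bsub>completion v\<^esub> \<rho> t [^]\<^bsub>completion v\<^esub> (total_degree f - (i + j))" for i j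
  proof -
    have "g (i, j) = (\<lambda>n. q (i, j)) \<otimes>\<^bsub>cauchy_ring v\<^esub> x [^]\<^bsub>cauchy_ring v\<^esub> i \<otimes>\<^bsub>cauchy_ring v\<^esub> y [^]\<^bsub>cauchy_ring v\<^esub> j
        \<otimes>\<^bsub>cauchy_ring v\<^esub> t [^]\<^bsub>cauchy_ring v\<^esub> (total_degree f - (i + j))"
      unfolding cauchy_ring_pow g_def by (simp add: cauchy_ring_def)
    thus ?thesis
      using car by (simp add: h.hom_mult h.hom_pow) (simp add: completion_emb_def \<rho>_def)
  qed
  have "eval_homogenization (completion v) (completion_emb v) f (\<rho> x, \<rho> y, \<rho> t)
      = finsum (completion v) (\<lambda>ij. \<rho> (g ij)) (bimonomials f)"
    unfolding eval_homogenization_def prod.case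
    by (intro K.finsum_cong') (auto simp: trm q_def gc cauchy_ring_def intro!: h.hom_closed[unfolded cauchy_ring_def, simplified])
  also have "\<dots> = \<rho> (finsum (cauchy_ring v) g (bimonomials f))"
    using h.hom_finsum[of g "bimonomials f"] gc by (simp add: cauchy_ring_def comp_def)
  also have "finsum (cauchy_ring v) g (bimonomials f) = (\<lambda>n. \<Sum>ij\<in>bimonomials f. g ij n)"
    using fin gc by (rule cauchy_ring_finsum)
  also have "\<dots> = (\<lambda>n. eval_homogenization ring_of_type_algebra of_rat f (x n, y n, t n))"
    unfolding eval_homogenization_def prod.case fs[OF fin]
    by (intro ext sum.cong refl) (auto simp: g_def q_def ring_of_type_algebra_simps ring_of_type_algebra_pow)
  finally show ?thesis .
qed

end

text \<open>The hypothesis \<open>unit\<close> makes the limit triple nonzero: integers prime to l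
  have absolute value 1.\<close>

lemma padic_closure_point:
  fixes h :: int and W Z T :: "nat \<Rightarrow> int"
  assumes l: "prime l" and h: "h \<noteq> 2" "h \<noteq> 8"
    and cauchy: "\<And>n. int l ^ n dvd W (Suc n) - W n" "\<And>n. int l ^ n dvd Z (Suc n) - Z n" "\<And>n. int l ^ n dvd T (Suc n) - T n"
    and zero: "\<And>n. int l ^ n dvd cubic_form ((h - 2)\<^sup>2 * (h - 8)) (W n) (Z n) (T n)"
    and unit: "(\<forall>n. \<not> int l dvd W n) \<or> (\<forall>n. \<not> int l dvd Z n) \<or> (\<forall>n. \<not> int l dvd T n)"
  shows "closure_points (padic_field l) (padic_emb l) (cubic_poly h) \<noteq> {}"
proof -
  interpret v: rat_abs_value "padic_abs l" by (rule padic_abs_value[OF l])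
  interpret K: cring "padic_field l" by (rule v.completion_cring)
  define \<rho> where "\<rho> = (\<lambda>s. null_seqs (padic_abs l) +>\<^bsub>cauchy_ring (padic_abs l)\<^esub> s)"
  define x y t :: "nat \<Rightarrow> rat" where "x = (\<lambda>n. of_int (W n))" and "y = (\<lambda>n. of_int (Z n))" and "t = (\<lambda>n. of_int (T n))"
  have c: "x \<in> cauchy_seqs (padic_abs l)" "y \<in> cauchy_seqs (padic_abs l)" "t \<in> cauchy_seqs (padic_abs l)"
    unfolding x_def y_def t_def by (intro padic_int_seq_cauchy l cauchy)+
  have car: "\<rho> x \<in> carrier (padic_field l)" "\<rho> y \<in> carrier (padic_field l)" "\<rho> t \<in> carrier (padic_field l)"
    using c unfolding v.carrier_completion \<rho>_def by auto
  have "x \<notin> null_seqs (padic_abs l) \<or> y \<notin> null_seqs (padic_abs l) \<or> t \<notin> null_seqs (padic_abs l)"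
    using unit padic_int_seq_not_null[OF l] unfolding x_def y_def t_def by blast
  hence "(\<rho> x, \<rho> y, \<rho> t) \<in> proj_triples (padic_field l)"
    using car v.coset_eq_zero_iff[OF c(1)] v.coset_eq_zero_iff[OF c(2)] v.coset_eq_zero_iff[OF c(3)]
    unfolding proj_triples_def \<rho>_def by auto
  moreover have "eval_homogenization (padic_field l) (padic_emb l) (cubic_poly h) (\<rho> x, \<rho> y, \<rho> t) = \<zero>\<^bsub>padic_field l\<^esub>"
  proof -
    have "finite (bimonomials (cubic_poly h))" using bimonomials_cubic_poly[OF h] by simp
    hence "eval_homogenization (padic_field l) (padic_emb l) (cubic_poly h) (\<rho> x, \<rho> y, \<rho> t)
        = \<rho> (\<lambda>n. eval_homogenization ring_of_type_algebra of_rat (cubic_poly h) (x n, y n, t n))"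
      unfolding \<rho>_def by (rule v.eval_homogenization_completion[OF _ c])
    also have "(\<lambda>n. eval_homogenization ring_of_type_algebra of_rat (cubic_poly h) (x n, y n, t n))
        = (\<lambda>n. of_int (cubic_form ((h - 2)\<^sup>2 * (h - 8)) (W n) (Z n) (T n)))"
      unfolding eval_homogenization_cubic_poly[OF h] x_def y_def t_def cubic_form_def
      by (rule ext) (simp add: algebra_simps)
    also have "\<rho> \<dots> = \<zero>\<^bsub>padic_field l\<^esub>"
    proof -
      have "(\<lambda>n. of_int (cubic_form ((h - 2)\<^sup>2 * (h - 8)) (W n) (Z n) (T n))) \<in> null_seqs (padic_abs l)"
        by (rule padic_int_seq_null[OF l zero])
      thus ?thesis unfolding \<rho>_def using v.coset_eq_zero_iff[OF v.null_imp_cauchy] by blast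
    qed
    finally show ?thesis .
  qed
  ultimately show ?thesis unfolding closure_points_def by blast
qed

text \<open>Hensel's lemma is applied to a variable whose derivative is a unit, the other two
  staying constant. At a triple divisible by l all derivatives vanish, so some coordinate is prime
  to l, and lifting keeps it so.\<close>

lemma cubic_smooth_padic_point:
  fixes h :: int
  assumes l: "prime l" and h: "h \<noteq> 2" "h \<noteq> 8" and zero: "int l dvd cubic_form ((h - 2)\<^sup>2 * (h - 8)) w z t"
    and smooth: "\<not> (int l dvd cubic_dw w z t \<and> int l dvd cubic_dz w z t \<and> int l dvd cubic_dt ((h - 2)\<^sup>2 * (h - 8)) w z t)"
  shows "closure_points (padic_field l) (padic_emb l) (cubic_poly h) \<noteq> {}"
proof -
  define c where "c = (h - 2)\<^sup>2 * (h - 8)"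
  have "\<not> (int l dvd w \<and> int l dvd z \<and> int l dvd t)"
  proof
    assume "int l dvd w \<and> int l dvd z \<and> int l dvd t"
    hence "int l dvd cubic_dw w z t" "int l dvd cubic_dz w z t" "int l dvd cubic_dt c w z t"
      unfolding cubic_dw_def cubic_dz_def cubic_dt_def power2_eq_square
      by (auto intro!: dvd_add dvd_diff)
    thus False using smooth unfolding c_def by blast
  qed
  hence nz: "\<not> int l dvd w \<or> \<not> int l dvd z \<or> \<not> int l dvd t" by blast
  have keep: "\<not> int l dvd x" if "int l dvd x - y" "\<not> int l dvd y" for x y
    using that by (metis dvd_diff_commute diff_add_cancel dvd_add_right_iff)
  from smooth consider "\<not> int l dvd cubic_dw w z t" | "\<not> int l dvd cubic_dz w z t" | "\<not> int l dvd cubic_dt c w z t"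
    unfolding c_def by blast
  thus ?thesis
  proof cases
    case 1
    have F: "cubic_form c x z t = (2 * z ^ 3 - 12 * z\<^sup>2 * t + 2 * c * t ^ 3) + 6 * z\<^sup>2 * x + (3 * z + 6 * t) * x\<^sup>2 + 1 * x ^ 3" for x
      unfolding cubic_form_def by (simp add: algebra_simps)
    have z0: "int l dvd (2 * z ^ 3 - 12 * z\<^sup>2 * t + 2 * c * t ^ 3) + 6 * z\<^sup>2 * w + (3 * z + 6 * t) * w\<^sup>2 + 1 * w ^ 3"
      using zero unfolding c_def[symmetric] F .
    have d0: "\<not> int l dvd 6 * z\<^sup>2 + 2 * (3 * z + 6 * t) * w + 3 * 1 * w\<^sup>2"
      using 1 by (simp add: cubic_dw_def algebra_simps)
    obtain s where r: "\<And>n. int l ^ n dvd (2 * z ^ 3 - 12 * z\<^sup>2 * t + 2 * c * t ^ 3) + 6 * z\<^sup>2 * s n + (3 * z + 6 * t) * (s n)\<^sup>2 + 1 * s n ^ 3"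
        and s: "\<And>n. int l ^ n dvd s (Suc n) - s n" "\<And>n. int l dvd s n - w"
      by (rule hensel_cubic[OF l z0 d0]) blast
    have "int l ^ n dvd cubic_form c (s n) z t" for n unfolding F by (rule r)
    thus ?thesis unfolding c_def using nz keep[OF s(2)] s(1)
      by (intro padic_closure_point[OF l h, of s "\<lambda>_. z" "\<lambda>_. t"]) auto
  next
    case 2
    have F: "cubic_form c w x t = (w ^ 3 + 6 * w\<^sup>2 * t + 2 * c * t ^ 3) + 3 * w\<^sup>2 * x + (6 * w - 12 * t) * x\<^sup>2 + 2 * x ^ 3" for x
      unfolding cubic_form_def by (simp add: algebra_simps)
    have z0: "int l dvd (w ^ 3 + 6 * w\<^sup>2 * t + 2 * c * t ^ 3) + 3 * w\<^sup>2 * z + (6 * w - 12 * t) * z\<^sup>2 + 2 * z ^ 3"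
      using zero unfolding c_def[symmetric] F .
    have d0: "\<not> int l dvd 3 * w\<^sup>2 + 2 * (6 * w - 12 * t) * z + 3 * 2 * z\<^sup>2"
      using 2 by (simp add: cubic_dz_def algebra_simps)
    obtain s where r: "\<And>n. int l ^ n dvd (w ^ 3 + 6 * w\<^sup>2 * t + 2 * c * t ^ 3) + 3 * w\<^sup>2 * s n + (6 * w - 12 * t) * (s n)\<^sup>2 + 2 * s n ^ 3"
        and s: "\<And>n. int l ^ n dvd s (Suc n) - s n" "\<And>n. int l dvd s n - z"
      by (rule hensel_cubic[OF l z0 d0]) blast
    have "int l ^ n dvd cubic_form c w (s n) t" for n unfolding F by (rule r)
    thus ?thesis unfolding c_def using nz keep[OF s(2)] s(1)
      by (intro padic_closure_point[OF l h, of "\<lambda>_. w" s "\<lambda>_. t"]) auto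
  next
    case 3
    have F: "cubic_form c w z x = (w ^ 3 + 3 * w\<^sup>2 * z + 6 * w * z\<^sup>2 + 2 * z ^ 3) + 6 * (w\<^sup>2 - 2 * z\<^sup>2) * x + 0 * x\<^sup>2 + 2 * c * x ^ 3" for x
      unfolding cubic_form_def by (simp add: algebra_simps)
    have z0: "int l dvd (w ^ 3 + 3 * w\<^sup>2 * z + 6 * w * z\<^sup>2 + 2 * z ^ 3) + 6 * (w\<^sup>2 - 2 * z\<^sup>2) * t + 0 * t\<^sup>2 + 2 * c * t ^ 3"
      using zero unfolding c_def[symmetric] F .
    have d0: "\<not> int l dvd 6 * (w\<^sup>2 - 2 * z\<^sup>2) + 2 * 0 * t + 3 * (2 * c) * t\<^sup>2"
      using 3 by (simp add: cubic_dt_def algebra_simps)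
    obtain s where r: "\<And>n. int l ^ n dvd (w ^ 3 + 3 * w\<^sup>2 * z + 6 * w * z\<^sup>2 + 2 * z ^ 3) + 6 * (w\<^sup>2 - 2 * z\<^sup>2) * s n + 0 * (s n)\<^sup>2 + 2 * c * s n ^ 3"
        and s: "\<And>n. int l ^ n dvd s (Suc n) - s n" "\<And>n. int l dvd s n - t"
      by (rule hensel_cubic[OF l z0 d0]) blast
    have "int l ^ n dvd cubic_form c w z (s n)" for n unfolding F by (rule r)
    thus ?thesis unfolding c_def using nz keep[OF s(2)] s(1)
      by (intro padic_closure_point[OF l h, of "\<lambda>_. w" "\<lambda>_. z" s]) auto
  qed
qed

text \<open>The cubic is singular modulo 3, so Hensel's lemma is applied after the substitution
  \<open>w = -1\<close>, \<open>z = 3 y\<close>, \<open>t = 1\<close>, which makes the form divisible by 9.\<close>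

lemma cubic_3adic_point:
  fixes h :: int
  assumes h: "h mod 3 = 1"
  shows "closure_points (padic_field 3) (padic_emb 3) (cubic_poly h) \<noteq> {}"
proof -
  define c where "c = (h - 2)\<^sup>2 * (h - 8)"
  define j where "j = h div 3"
  have j: "h = 3 * j + 1" using h div_mult_mod_eq[of h 3] by (simp add: j_def)
  \<comment> \<open>c = 2 modulo 9 makes the constant term 5 + 2 c of the substituted form divisible
    by 9.\<close>
  have "c = 9 * (3 * j ^ 3 - 9 * j\<^sup>2 + 5 * j - 1) + 2"
    unfolding c_def j by (simp add: algebra_simps power2_eq_square power3_eq_cube)
  then obtain k where k: "c = 9 * k + 2" by blast
  have F: "cubic_form c (-1) (3 * y) 1 = 9 * ((2 * k + 1) + 1 * y + (-18) * y\<^sup>2 + 6 * y ^ 3)" for y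
    unfolding cubic_form_def k by (simp add: algebra_simps power2_eq_square power3_eq_cube)
  \<comment> \<open>Modulo 3 the cofactor is 2 k + 1 + y, hence the starting value y = - (2 k + 1)
    and the unit derivative.\<close>
  have z0: "int 3 dvd (2 * k + 1) + 1 * (- (2 * k + 1)) + (-18) * (- (2 * k + 1))\<^sup>2 + 6 * (- (2 * k + 1)) ^ 3"
    by (simp add: dvd_diff)
  have d0: "\<not> int 3 dvd 1 + 2 * (-18) * (- (2 * k + 1)) + 3 * 6 * (- (2 * k + 1))\<^sup>2"
    by presburger
  obtain s where r: "\<And>n. int 3 ^ n dvd (2 * k + 1) + 1 * s n + (-18) * (s n)\<^sup>2 + 6 * s n ^ 3"
      and s: "\<And>n. int 3 ^ n dvd s (Suc n) - s n"
    by (rule hensel_cubic[OF _ z0 d0]) (simp, blast)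
  have "int 3 ^ n dvd cubic_form c (-1) (3 * s n) 1" for n unfolding F by (rule dvd_mult[OF r])
  moreover have "int 3 ^ n dvd 3 * s (Suc n) - 3 * s n" for n
    using dvd_mult[OF s[of n], of 3] by (simp add: algebra_simps)
  ultimately show ?thesis unfolding c_def
    using h by (intro padic_closure_point[of 3 h "\<lambda>_. -1" "\<lambda>n. 3 * s n" "\<lambda>_. 1"]) auto
qed

lemma cubic_real_point:
  fixes h :: int
  assumes h: "h > 8"
  shows "closure_points (ring_of_type_algebra :: real ring) of_rat (cubic_poly h) \<noteq> {}"
proof -
  define k :: real where "k = of_int (2 * (h - 2)\<^sup>2 * (h - 8))"
  have k: "k > 0" unfolding k_def of_int_0_less_iff using h by simp
  \<comment> \<open>The line z = 0 at t = 1. At x = - (k + 6) the term x^2 (x + 6) = - k (k + 6)^2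
    outweighs k, while at 0 the value is k > 0.\<close>
  have "\<exists>x. - (k + 6) \<le> x \<and> x \<le> 0 \<and> x ^ 3 + 6 * x\<^sup>2 + k = 0"
  proof (rule IVT)
    have "(- (k + 6)) ^ 3 + 6 * (- (k + 6))\<^sup>2 + k = k * (1 - (k + 6)\<^sup>2)"
      by (simp add: algebra_simps power2_eq_square power3_eq_cube)
    also have "\<dots> \<le> 0" using k one_le_power[of "k + 6" 2] by (intro mult_nonneg_nonpos) auto
    finally show "(- (k + 6)) ^ 3 + 6 * (- (k + 6))\<^sup>2 + k \<le> 0" .
  qed (use k in auto)
  then obtain x where "x ^ 3 + 6 * x\<^sup>2 + k = 0" by blast
  hence "eval_homogenization ring_of_type_algebra of_rat (cubic_poly h) (x, 0, 1) = 0"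
    using h by (subst eval_homogenization_cubic_poly) (auto simp: k_def)
  moreover have "(x, 0, 1) \<in> proj_triples (ring_of_type_algebra :: real ring)"
    by (simp add: proj_triples_def ring_of_type_algebra_simps)
  ultimately show ?thesis
    unfolding closure_points_def using ring_of_type_algebra_simps(2)[where ?'a = real] by (metis (mono_tags, lifting) Collect_empty_eq image_is_empty)
qed

theorem corollary2:
  fixes h :: int
  assumes "h > 0" and "[h = 3] (mod 8)"
    and "prime h" and "prime (h - 2)" and "prime (h - 6)" and "prime (h - 8)"
  shows "closure_points (ring_of_type_algebra :: real ring) of_rat (cubic_poly h) \<noteq> {}
    \<and> (\<forall>p. prime p \<longrightarrow> closure_points (padic_field p) (padic_emb p) (cubic_poly h) \<noteq> {})
    \<and> closure_points (ring_of_type_algebra :: rat ring) of_rat (cubic_poly h) = {}"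
proof -
  have "(h - 2) mod 8 = 1"
  proof -
    have "[h - 2 = 3 - 2] (mod 8)" by (intro cong_diff cong_refl assms)
    thus ?thesis by (simp add: cong_def)
  qed
  then interpret P: prime_constellation "h - 2"
    using assms by unfold_locales simp_all
  have h: "h > 8" using P.p_gt by simp
  have h28: "h \<noteq> 2" "h \<noteq> 8" using h by auto
  have "closure_points (padic_field l) (padic_emb l) (cubic_poly h) \<noteq> {}" if l: "prime l" for l
  proof -
    have "l \<ge> 2" using l by (rule prime_ge_2_nat)
    then consider "l = 2" | "l = 3" | "l > 3" by linarith
    thus ?thesis
    proof cases
      case 1
      show ?thesis
      proof (rule cubic_smooth_padic_point[OF l h28])
        \<comment> \<open>At (1, 1, 0) the form is 12 and its derivative in w is 15, so the point is
          smooth modulo 2.\<close>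
        show "int l dvd cubic_form ((h - 2)\<^sup>2 * (h - 8)) 1 1 0" by (simp add: 1 cubic_form_def)
        show "\<not> (int l dvd cubic_dw 1 1 0 \<and> int l dvd cubic_dz 1 1 0 \<and> int l dvd cubic_dt ((h - 2)\<^sup>2 * (h - 8)) 1 1 0)"
          by (simp add: 1 cubic_dw_def)
      qed
    next
      case 2
      have "h mod 3 = 1" using P.residues_mod(8) by simp
      thus ?thesis unfolding 2 by (rule cubic_3adic_point)
    next
      case 3
      from P.smooth_zero_mod[OF l 3] show ?thesis
        using cubic_smooth_padic_point[OF l h28] by (auto simp: algebra_simps)
    qed
  qed
  moreover have "closure_points (ring_of_type_algebra :: rat ring) of_rat (cubic_poly h) = {}"
  proof -
    have False if v: "(x, y, t) \<in> proj_triples (ring_of_type_algebra :: rat ring)"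
        and e: "eval_homogenization ring_of_type_algebra of_rat (cubic_poly h) (x, y, t) = (0::rat)" for x y t :: rat
    proof -
      have "3 * x\<^sup>2 * y + 2 * y ^ 3 + x ^ 3 + 6 * x * y\<^sup>2 + of_int (2 * (h - 2)\<^sup>2 * (h - 2 - 6)) * t ^ 3
          - (12 * y\<^sup>2 * t - 6 * x\<^sup>2 * t) = 0"
        using e unfolding eval_homogenization_cubic_poly[OF h28] by simp
      from P.cubic_no_rational_point[OF this] show False
        using v by (simp add: proj_triples_def ring_of_type_algebra_simps)
    qed
    thus ?thesis unfolding closure_points_def by (auto simp: ring_of_type_algebra_simps)
  qed
  ultimately show ?thesis using cubic_real_point[OF h] by blast
qed

end
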